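(* Let $\mathcal{Q}$ and $A\subset\mathcal{X}$ be as in the context (in particular, $\mathcal{Q}$ is a non-empty, compact, convex set of rate matrices with separately specified rows, all states in $A$ are absorbing, and $A$ is lower reachable from every state in $A^c$). Let $\underline{h}$ and $\overline{h}$ denote the lower and upper expected hitting times of $A$ for any one of $\mathcal{P}^{\mathrm{HM}}_{\mathcal{Q}}$, $\mathcal{P}^{\mathrm{M}}_{\mathcal{Q}}$, or $\mathcal{P}^{\mathrm{I}}_{\mathcal{Q}}$, that is, $\underline{h}=\underline{\mathbb{E}}^{*}_{\mathcal{Q}}[\tau_{\mathbb{R}_{\ge0}}\mid X_0]$ and $\overline{h}=\overline{\mathbb{E}}^{*}_{\mathcal{Q}}[\tau_{\mathbb{R}_{\ge0}}\mid X_0]$ with $*\in\{\mathrm{HM},\mathrm{M},\mathrm{I}\}$. Then $\underline{h}$ is the minimal non-negative solution to the non-linear system $$\mathbb{I}_A\underline{h}=\mathbb{I}_{A^c}+\mathbb{I}_{A^c}\,\underline{Q}\,\underline{h},$$ and $\overline{h}$ is the minimal non-negative solution to the non-linear system $$\mathbb{I}_A\overline{h}=\mathbb{I}_{A^c}+\mathbb{I}_{A^c}\,\overline{Q}\,\overline{h}.$$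
   Context: $\mathcal{X}$ is a finite set with at least two elements; $A\subset\mathcal{X}$ is a fixed non-empty proper subset and $A^c=\mathcal{X}\setminus A$. $\mathbb{R}^{\mathcal{X}}$ is the space of real functions on $\mathcal{X}$ with the supremum norm $\|\cdot\|$; inequalities, infima, suprema and products of functions are pointwise; $\mathbb{I}_B$ is the indicator of $B$, and $\mathbb{I}_x:=\mathbb{I}_{\{x\}}$. A (non-linear) operator $M$ with $M(\lambda f)=\lambda Mf$ for $\lambda\ge 0$ has norm $\|M\|=\sup\{\|Mf\|:\|f\|=1\}$. A rate matrix is a linear operator $Q$ on $\mathbb{R}^{\mathcal{X}}$, with entries $Q(x,y)=Q\mathbb{I}_y(x)$, such that $Q(x,y)\ge0$ for $x\ne y$ and $\sum_yQ(x,y)=0$ for all $x$. Standing assumptions. $\mathcal{Q}$ is a non-empty, compact, convex set of rate matrices with separately specified rows: for any family $(Q_x)_{x\in\mathcal{X}}$ in $\mathcal{Q}$, the matrix whose $x$-row is the $x$-row of $Q_x$, for each $x$, belongs to $\mathcal{Q}$. Let $\underline{Q}f:=\inf_{Q\in\mathcal{Q}}Qf$ and $\overline{Q}f:=\sup_{Q\in\mathcal{Q}}Qf$ (pointwise), and for $t\ge0$ let $e^{\underline{Q}t}:=\lim_{n\to\infty}(I+\frac{t}{n}\underline{Q})^n$ (limit in operator norm; it exists). Assume: (1) $Q(x,x)=0$ for all $Q\in\mathcal{Q}$ and $x\in A$; (2) $e^{\underline{Q}t}\mathbb{I}_A(x)>0$ for all $t>0$ and $x\in A^c$. Processes. $\Omega_{\mathbb{R}_{\ge0}}$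 is the set of cadlag functions $\omega:\mathbb{R}_{\ge0}\to\mathcal{X}$, with the $\sigma$-algebra generated by the coordinate maps $X_t(\omega)=\omega(t)$. A continuous-time stochastic process $P$ is a probability measure on this space, where conditional probability measures $P(\cdot\mid X_u=x_u)$ are taken to be given for every finite history $X_u=x_u$, i.e. $X_{t_0}=x_{t_0},\dots,X_{t_n}=x_{t_n}$ with $u=\{t_0<\dots<t_n\}$ (including those of probability zero; the empty history corresponds to $P$ itself), with $P(X_u=x_u\mid X_u=x_u)=1$ and with the chain rule $P(B\cap\{X_s=y\}\mid X_u=x_u)=P(B\mid X_u=x_u,X_s=y)\,P(X_s=y\mid X_u=x_u)$ for all $s>\max u$, $y\in\mathcal{X}$ and all events $B$ generated by $(X_r)_{r\ge s}$. $P$ is a Markov chain if $P(X_s=y\mid X_{t_0}=x_{t_0},\dots,X_{t_n}=x_{t_n})=P(X_s=y\mid X_{t_n}=x_{t_n})$ for all $t_0<\dots<t_n\le s$ and all states; it is a homogeneous Markov chain if in addition $P(X_s=y\mid X_t=x)=P(X_{s-t}=y\mid X_0=x)$ for all $t\le s$. A homogeneous Markov chain $P$ has a unique rate matrix ${}^PQ$ such that $P(X_t=y\mid X_0=x)=e^{{}^PQt}(x,y)$ for all $t\geq 0$. Consistency with $\mathcal{Q}$. For a process $P$, a (possibly empty) history $X_u=x_u$ and $\max u<t\le s$, let $T_{t,x_u}^s(x,y):=P(X_s=y\mid X_t=x,X_u=x_u)$. $P$ is consistent with $\mathcal{Q}$ if, for every history $X_u=x_u$ and every $t>\max u$ (every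 $t\ge0$ if $u=\emptyset$): the quotients $\frac1\Delta(T_{t,x_u}^{t+\Delta}-I)$ and, if $t>0$, $\frac1\Delta(T_{t-\Delta,x_u}^{t}-I)$ have bounded norm as $\Delta\to0^+$ (finite $\limsup$), and every limit of either quotient along a sequence $\Delta_i\to0^+$ belongs to $\mathcal{Q}$. Imprecise-Markov chains. $\mathcal{P}^{\mathrm{HM}}_{\mathcal{Q}}$ is the set of all homogeneous Markov chains $P$ with ${}^PQ\in\mathcal{Q}$; $\mathcal{P}^{\mathrm{M}}_{\mathcal{Q}}$ is the set of all Markov chains consistent with $\mathcal{Q}$; $\mathcal{P}^{\mathrm{I}}_{\mathcal{Q}}$ is the set of all processes consistent with $\mathcal{Q}$. Initial distributions are unconstrained. One has $\mathcal{P}^{\mathrm{HM}}_{\mathcal{Q}}\subseteq\mathcal{P}^{\mathrm{M}}_{\mathcal{Q}}\subseteq\mathcal{P}^{\mathrm{I}}_{\mathcal{Q}}$. Hitting times. $\tau_{\mathbb{R}_{\ge0}}(\omega):=\inf\{t\ge0:\omega(t)\in A\}\in[0,+\infty]$; $\mathbb{E}_P[\tau_{\mathbb{R}_{\ge0}}\mid X_0=x]:=\int\tau_{\mathbb{R}_{\ge0}}\,\mathrm{d}P(\cdot\mid X_0=x)$, and $\mathbb{E}_P[\tau_{\mathbb{R}_{\ge0}}\mid X_0]$ denotes the function $x\mapsto\mathbb{E}_P[\tau_{\mathbb{R}_{\ge0}}\mid X_0=x]$. For $*\in\{\mathrm{HM},\mathrm{M},\mathrm{I}\}$, $\underline{\mathbb{E}}^{*}_{\mathcal{Q}}[\cdot\mid\cdot]:=\inf_{P\in\mathcal{P}^*_{\mathcal{Q}}}\mathbb{E}_P[\cdot\mid\cdot]$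 and $\overline{\mathbb{E}}^{*}_{\mathcal{Q}}[\cdot\mid\cdot]:=\sup_{P\in\mathcal{P}^*_{\mathcal{Q}}}\mathbb{E}_P[\cdot\mid\cdot]$. "Minimal non-negative solution" means the pointwise smallest among the non-negative solutions in $\mathbb{R}^{\mathcal{X}}$. *)

theory Defs
  imports "HOL-Probability.Probability"
begin

section \<open>Operators and rate matrices\<close>

text \<open>
  The finite state space is a type \<open>'a::finite\<close>. A function in \<open>\<real>\<^sup>\<X>\<close> is a vector of type
  \<open>real ^ 'a\<close> (whose multiplication is componentwise), its supremum norm is \<^const>\<open>infnorm\<close>, and a
  linear operator \<open>Q\<close> is a matrix acting by \<open>Q *v f\<close>, so that \<open>Q(x,y)\<close> is \<open>Q $ x $ y\<close>.
\<close>

definition ind_vec :: "'a set \<Rightarrow> real ^ ('a::finite)"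
  where "ind_vec B = (\<chi> x. indicator B x)"

definition nonneg_homogeneous :: "(real ^ ('a::finite) \<Rightarrow> real ^ 'a) \<Rightarrow> bool"
  where "nonneg_homogeneous M \<longleftrightarrow> (\<forall>c\<ge>0. \<forall>f. M (c *\<^sub>R f) = c *\<^sub>R M f)"

text \<open>The norm takes values in \<^typ>\<open>ennreal\<close>, so that an unbounded operator has norm \<open>\<infinity>\<close>.\<close>

definition op_norm :: "(real ^ ('a::finite) \<Rightarrow> real ^ 'a) \<Rightarrow> ennreal"
  where "op_norm M = (SUP f\<in>{f. infnorm f = 1}. ennreal (infnorm (M f)))"

definition rate_matrix :: "real ^ 'a ^ ('a::finite) \<Rightarrow> bool"
  where "rate_matrix Q \<longleftrightarrow>
    (\<forall>x y. x \<noteq> y \<longrightarrow> 0 \<le> Q $ x $ y) \<and> (\<forall>x. (\<Sum>y\<in>UNIV. Q $ x $ y) = 0)"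

definition separately_specified_rows :: "(real ^ 'a ^ ('a::finite)) set \<Rightarrow> bool"
  where "separately_specified_rows \<Q> \<longleftrightarrow>
    (\<forall>R. (\<forall>x. R x \<in> \<Q>) \<longrightarrow> (\<chi> x. R x $ x) \<in> \<Q>)"

definition lower_rate :: "(real ^ 'a ^ ('a::finite)) set \<Rightarrow> real ^ 'a \<Rightarrow> real ^ 'a"
  where "lower_rate \<Q> f = (\<chi> x. INF Q\<in>\<Q>. (Q *v f) $ x)"

definition upper_rate :: "(real ^ 'a ^ ('a::finite)) set \<Rightarrow> real ^ 'a \<Rightarrow> real ^ 'a"
  where "upper_rate \<Q> f = (\<chi> x. SUP Q\<in>\<Q>. (Q *v f) $ x)"

text \<open>
  \<open>op_exp M t\<close> is the limit of \<open>(I + (t/n) M)\<^sup>n\<close> in operator norm, among the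
  non-negatively homogeneous operators.
\<close>

definition op_exp :: "(real ^ ('a::finite) \<Rightarrow> real ^ 'a) \<Rightarrow> real \<Rightarrow> real ^ 'a \<Rightarrow> real ^ 'a"
  where "op_exp M t = (THE E. nonneg_homogeneous E \<and>
    (\<lambda>n. op_norm (\<lambda>f. ((\<lambda>g. g + (t / real n) *\<^sub>R M g) ^^ n) f - E f)) \<longlonglongrightarrow> 0)"

definition mat_exp :: "real ^ 'a ^ ('a::finite) \<Rightarrow> real ^ 'a ^ 'a"
  where "mat_exp M = (\<Sum>k. (1 / fact k) *\<^sub>R (((\<lambda>N. M ** N) ^^ k) (mat 1)))"


section \<open>Processes\<close>

text \<open>
  Paths are functions on \<open>{0..}\<close>, represented by extensional functions on \<^typ>\<open>real\<close>.
\<close>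

definition cadlag_paths :: "(real \<Rightarrow> 'a::finite) set"
  where "cadlag_paths = {\<omega> \<in> {0..} \<rightarrow>\<^sub>E UNIV.
    (\<forall>t\<ge>0. limitin (discrete_topology UNIV) \<omega> (\<omega> t) (at_right t)) \<and>
    (\<forall>t>0. \<exists>l. limitin (discrete_topology UNIV) \<omega> l (at_left t))}"

definition path_space_from :: "real \<Rightarrow> (real \<Rightarrow> 'a::finite) measure"
  where "path_space_from s =
    sigma cadlag_paths {{\<omega> \<in> cadlag_paths. \<omega> r = x} | r x. s \<le> r}"

abbreviation path_space :: "(real \<Rightarrow> 'a::finite) measure"
  where "path_space \<equiv> path_space_from 0"

definition state_event :: "real \<Rightarrow> 'a \<Rightarrow> (real \<Rightarrow> 'a::finite) set"
  where "state_event t x = {\<omega> \<in> cadlag_paths. \<omega> t = x}"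

text \<open>
  A finite history \<open>X\<^sub>u = x\<^sub>u\<close> is a partial map with finite domain \<open>u \<subseteq> {0..}\<close>; the empty map is the
  empty history.
\<close>

definition history :: "(real \<rightharpoonup> 'a) \<Rightarrow> bool"
  where "history h \<longleftrightarrow> finite (dom h) \<and> dom h \<subseteq> {0..}"

definition history_event :: "(real \<rightharpoonup> 'a) \<Rightarrow> (real \<Rightarrow> 'a::finite) set"
  where "history_event h = {\<omega> \<in> cadlag_paths. \<forall>t\<in>dom h. h t = Some (\<omega> t)}"

definition after :: "(real \<rightharpoonup> 'a) \<Rightarrow> real \<Rightarrow> bool"
  where "after h t \<longleftrightarrow> 0 \<le> t \<and> (\<forall>r\<in>dom h. r < t)"

text \<open>
  A process is the family of its conditional measures: \<open>P h\<close> is the measure conditional on the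
  history \<open>h\<close>, and \<open>P Map.empty\<close> is the unconditional one. The values of \<open>P\<close> at maps that are not
  histories are irrelevant.
\<close>

type_synonym 'a process = "(real \<rightharpoonup> 'a) \<Rightarrow> (real \<Rightarrow> 'a) measure"

definition stochastic_process :: "('a::finite) process \<Rightarrow> bool"
  where "stochastic_process P \<longleftrightarrow>
    (\<forall>h. history h \<longrightarrow>
      prob_space (P h) \<and> space (P h) = space path_space \<and> sets (P h) = sets path_space \<and>
      measure (P h) (history_event h) = 1 \<and>
      (\<forall>s y. after h s \<longrightarrow> (\<forall>B\<in>sets (path_space_from s).
        measure (P h) (B \<inter> state_event s y) =
          measure (P (h(s \<mapsto> y))) B * measure (P h) (state_event s y))))"

definition markov_chain :: "('a::finite) process \<Rightarrow> bool"
  where "markov_chain P \<longleftrightarrow> stochastic_process P \<and>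
    (\<forall>h t x s y. history h \<and> after h t \<and> t \<le> s \<longrightarrow>
      measure (P (h(t \<mapsto> x))) (state_event s y) = measure (P [t \<mapsto> x]) (state_event s y))"

definition homogeneous_markov_chain :: "('a::finite) process \<Rightarrow> bool"
  where "homogeneous_markov_chain P \<longleftrightarrow> markov_chain P \<and>
    (\<forall>t s x y. 0 \<le> t \<and> t \<le> s \<longrightarrow>
      measure (P [t \<mapsto> x]) (state_event s y) = measure (P [0 \<mapsto> x]) (state_event (s - t) y))"

definition has_rate_matrix :: "('a::finite) process \<Rightarrow> real ^ 'a ^ 'a \<Rightarrow> bool"
  where "has_rate_matrix P Q \<longleftrightarrow> rate_matrix Q \<and>
    (\<forall>t\<ge>0. \<forall>x y. measure (P [0 \<mapsto> x]) (state_event t y) = mat_exp (t *\<^sub>R Q) $ x $ y)"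


section \<open>Consistency and imprecise-Markov chains\<close>

definition trans_matrix ::
    "('a::finite) process \<Rightarrow> (real \<rightharpoonup> 'a) \<Rightarrow> real \<Rightarrow> real \<Rightarrow> real ^ 'a ^ 'a"
  where "trans_matrix P h t s = (\<chi> x y. measure (P (h(t \<mapsto> x))) (state_event s y))"

definition forward_quotient ::
    "('a::finite) process \<Rightarrow> (real \<rightharpoonup> 'a) \<Rightarrow> real \<Rightarrow> real \<Rightarrow> real ^ 'a ^ 'a"
  where "forward_quotient P h t \<Delta> = (1 / \<Delta>) *\<^sub>R (trans_matrix P h t (t + \<Delta>) - mat 1)"

definition backward_quotient ::
    "('a::finite) process \<Rightarrow> (real \<rightharpoonup> 'a) \<Rightarrow> real \<Rightarrow> real \<Rightarrow> real ^ 'a ^ 'a"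
  where "backward_quotient P h t \<Delta> = (1 / \<Delta>) *\<^sub>R (trans_matrix P h (t - \<Delta>) t - mat 1)"

definition derivative_consistent ::
    "(real ^ 'a ^ ('a::finite)) set \<Rightarrow> (real \<Rightarrow> real ^ 'a ^ 'a) \<Rightarrow> bool"
  where "derivative_consistent \<Q> D \<longleftrightarrow>
    Limsup (at_right 0) (\<lambda>\<Delta>. op_norm (\<lambda>f. D \<Delta> *v f)) < \<infinity> \<and>
    (\<forall>\<delta> L. filterlim \<delta> (at_right 0) sequentially \<and> (\<lambda>i::nat. D (\<delta> i)) \<longlonglongrightarrow> L \<longrightarrow> L \<in> \<Q>)"

definition consistent :: "(real ^ 'a ^ ('a::finite)) set \<Rightarrow> 'a process \<Rightarrow> bool"
  where "consistent \<Q> P \<longleftrightarrow>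
    (\<forall>h t. history h \<and> after h t \<longrightarrow>
      derivative_consistent \<Q> (forward_quotient P h t) \<and>
      (t > 0 \<longrightarrow> derivative_consistent \<Q> (backward_quotient P h t)))"

definition imprecise_HM :: "(real ^ 'a ^ ('a::finite)) set \<Rightarrow> 'a process set"
  where "imprecise_HM \<Q> = {P. homogeneous_markov_chain P \<and> (\<exists>Q\<in>\<Q>. has_rate_matrix P Q)}"

definition imprecise_M :: "(real ^ 'a ^ ('a::finite)) set \<Rightarrow> 'a process set"
  where "imprecise_M \<Q> = {P. markov_chain P \<and> consistent \<Q> P}"

definition imprecise_I :: "(real ^ 'a ^ ('a::finite)) set \<Rightarrow> 'a process set"
  where "imprecise_I \<Q> = {P. stochastic_process P \<and> consistent \<Q> P}"


section \<open>Hitting times\<close>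

definition hitting_time :: "'a set \<Rightarrow> (real \<Rightarrow> 'a) \<Rightarrow> ennreal"
  where "hitting_time A \<omega> = (INF t\<in>{t. 0 \<le> t \<and> \<omega> t \<in> A}. ennreal t)"

definition expected_hitting_time :: "'a set \<Rightarrow> ('a::finite) process \<Rightarrow> 'a \<Rightarrow> ennreal"
  where "expected_hitting_time A P x = (\<integral>\<^sup>+ \<omega>. hitting_time A \<omega> \<partial>P [0 \<mapsto> x])"

definition lower_hitting_time :: "'a set \<Rightarrow> ('a::finite) process set \<Rightarrow> 'a \<Rightarrow> ennreal"
  where "lower_hitting_time A \<P> x = (INF P\<in>\<P>. expected_hitting_time A P x)"

definition upper_hitting_time :: "'a set \<Rightarrow> ('a::finite) process set \<Rightarrow> 'a \<Rightarrow> ennreal"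
  where "upper_hitting_time A \<P> x = (SUP P\<in>\<P>. expected_hitting_time A P x)"

definition minimal_nonneg_solution :: "(real ^ ('a::finite) \<Rightarrow> bool) \<Rightarrow> real ^ 'a \<Rightarrow> bool"
  where "minimal_nonneg_solution S h \<longleftrightarrow>
    S h \<and> (\<forall>x. 0 \<le> h $ x) \<and> (\<forall>g. S g \<and> (\<forall>x. 0 \<le> g $ x) \<longrightarrow> (\<forall>x. h $ x \<le> g $ x))"

end

theory Submission
  imports Defs
begin

text \<open>
  Since the states of \<open>A\<close> are absorbing for every matrix in \<open>\<Q>\<close>, the survival function
  \<open>P(\<tau> > t)\<close> of a consistent process agrees with \<open>P(X\<^sub>t \<notin> A)\<close> up to endpoints, so the expected
  hitting time is its integral over \<open>t\<close>. Consistency bounds the one-sided derivatives of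
  \<open>t \<mapsto> E[g(X\<^sub>t)]\<close> by \<open>Q g\<close> for \<open>Q \<in> \<Q>\<close>; hence \<open>Q g \<le> -1\<close> off \<open>A\<close> for all \<open>Q\<close>
  makes \<open>g \<ge> 0\<close> an upper bound for the expected hitting time, and \<open>Q g \<ge> -1\<close> makes it a lower
  bound if \<open>g\<close> vanishes on \<open>A\<close>, with no Markov assumption. Both bounds are attained: because the rows are separately specified, a
  single \<open>Q \<in> \<Q>\<close> realises the infimum (or supremum) at the solution, and the homogeneous Markov
  chain with rate matrix \<open>Q\<close> is consistent with \<open>{Q}\<close>. That chain is built by uniformization, and
  its Markov property and transition matrix follow from uniqueness of bounded solutions of a renewal
  equation. Lower reachability provides a supersolution, from which the minimal solution is
  obtained as the infimum of all supersolutions.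
\<close>

section \<open>Cadlag paths and jump sources\<close>

text \<open>Consistency controls only limit points of one-sided difference quotients, separately for
  each time and history: neither differentiability nor uniformity in time is available. Means are
  therefore compared with integrals by a Dini-type monotonicity argument, in which right quotients
  bound right increments and the quotients from both sides supply continuity. The two bounds on the
  hitting time differ in the boundary term \<open>E g(X_b)\<close>. It is dropped as non-negative in
  the upper bound; in the lower bound it must be made small, which works because \<open>g\<close>
  vanishes on \<open>A\<close> and a finite expectation forces the survival function near 0. A
  process must supply a conditional measure for every history, impossible ones included, so
  constructing a chain means constructing a whole coherent family. For the chain itself,
  conditioning once on the first holding time gives a convolution equation that is a contraction on
  \<open>[0, T]\<close> with factor \<open>1 - exp (- l * T)\<close>; this avoids any count of the
  jumps. For the operators, everything rests on one fact: \<open>I + d Q\<close> has non-negative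
  entries once \<open>d * bound <= 1\<close>. Monotonicity and stability of Euler steps follow from
  it.\<close>

lemma limitin_discrete_iff:
  "limitin (discrete_topology UNIV) f l F \<longleftrightarrow> eventually (\<lambda>x. f x = l) F"
  unfolding limitin_def
  by (auto elim!: eventually_mono dest: spec[of _ "{l}"])

lemma cadlag_paths_iff:
  "\<omega> \<in> cadlag_paths \<longleftrightarrow> \<omega> \<in> {0..} \<rightarrow>\<^sub>E UNIV \<and>
    (\<forall>t\<ge>0. eventually (\<lambda>s. \<omega> s = \<omega> t) (at_right t)) \<and>
    (\<forall>t>0. \<exists>l. eventually (\<lambda>s. \<omega> s = l) (at_left t))"
  by (simp add: cadlag_paths_def limitin_discrete_iff)

text \<open>
  Entry \<open>n\<close> of a jump source is the \<open>n\<close>-th holding time together with the random map that is applied to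
  the current state at the next jump. Maps may fix the state, so these are not always visible jumps.
\<close>

type_synonym 'a jump_source = "(real \<times> ('a \<Rightarrow> 'a)) stream"

definition jump_time :: "nat \<Rightarrow> 'a jump_source \<Rightarrow> real"
  where "jump_time n \<omega> = (\<Sum>i<n. fst (\<omega> !! i))"

primrec embedded_chain :: "'a \<Rightarrow> nat \<Rightarrow> 'a jump_source \<Rightarrow> 'a"
  where
    "embedded_chain x 0 \<omega> = x"
  | "embedded_chain x (Suc n) \<omega> = snd (\<omega> !! n) (embedded_chain x n \<omega>)"

text \<open>The strict inequality counts a jump at time \<open>t\<close> itself as already made,
  which is what makes the path right-continuous.\<close>

definition num_jumps :: "'a jump_source \<Rightarrow> real \<Rightarrow> nat"
  where "num_jumps \<omega> t = (LEAST n. t < jump_time (Suc n) \<omega>)"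

text \<open>The second clause rules out explosion. Testing natural bounds keeps it a countable
  condition, hence a measurable one.\<close>

definition regular_source :: "'a jump_source \<Rightarrow> bool"
  where "regular_source \<omega> \<longleftrightarrow>
    (\<forall>n. 0 < fst (\<omega> !! n)) \<and> (\<forall>k::nat. \<exists>n. real k < jump_time n \<omega>)"

text \<open>Irregular sources are sent to a constant path: they form a null set, but a measurable
  map into path space must take cadlag values everywhere.\<close>

definition jump_path :: "'a \<Rightarrow> 'a jump_source \<Rightarrow> real \<Rightarrow> 'a"
  where "jump_path x \<omega> =
    (\<lambda>t\<in>{0..}. if regular_source \<omega> then embedded_chain x (num_jumps \<omega> t) \<omega> else x)"

lemma jump_time_0 [simp]: "jump_time 0 \<omega> = 0"
  by (simp add: jump_time_def)

lemma jump_time_Stream: "jump_time (Suc n) (a ## s) = fst a + jump_time n s"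
  by (simp add: jump_time_def sum.lessThan_Suc_shift del: sum.lessThan_Suc)

lemma embedded_chain_Stream:
  "embedded_chain x (Suc n) (a ## s) = embedded_chain (snd a x) n s"
  by (induction n) simp_all

lemma regular_source_strict_mono:
  assumes "regular_source \<omega>"
  shows "strict_mono (\<lambda>n. jump_time n \<omega>)"
  using assms by (intro strict_monoI_Suc) (auto simp: regular_source_def jump_time_def)

lemma regular_source_unbounded:
  assumes "regular_source \<omega>"
  shows "\<exists>n. t < jump_time n \<omega>"
proof -
  obtain k :: nat where "t < real k" using reals_Archimedean2 by blast
  then show ?thesis using assms unfolding regular_source_def by (meson less_trans)
qed

lemma num_jumps_eqI:
  assumes "regular_source \<omega>" "jump_time n \<omega> \<le> t" "t < jump_time (Suc n) \<omega>"
  shows "num_jumps \<omega> t = n"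
  unfolding num_jumps_def
proof (rule Least_equality)
  fix m assume "t < jump_time (Suc m) \<omega>"
  then have "jump_time n \<omega> < jump_time (Suc m) \<omega>" using assms by simp
  then have "n < Suc m"
    using strict_mono_less[OF regular_source_strict_mono[OF assms(1)]] by blast
  then show "n \<le> m" by simp
qed fact

lemma num_jumps_bounds:
  assumes "regular_source \<omega>" "0 \<le> t"
  shows "jump_time (num_jumps \<omega> t) \<omega> \<le> t" "t < jump_time (Suc (num_jumps \<omega> t)) \<omega>"
proof -
  have "\<exists>n. t < jump_time (Suc n) \<omega>"
  proof -
    obtain n where n: "t < jump_time n \<omega>" using regular_source_unbounded[OF assms(1)] by blast
    then show ?thesis using assms(2) by (cases n) auto
  qed
  then show "t < jump_time (Suc (num_jumps \<omega> t)) \<omega>"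
    unfolding num_jumps_def by (rule LeastI_ex)
  show "jump_time (num_jumps \<omega> t) \<omega> \<le> t"
  proof (cases "num_jumps \<omega> t")
    case (Suc m)
    then have "\<not> t < jump_time (Suc m) \<omega>"
      unfolding num_jumps_def using not_less_Least by (metis lessI)
    then show ?thesis using Suc by simp
  qed (use assms in simp)
qed

lemma regular_source_Stream:
  "regular_source (a ## s) \<longleftrightarrow> 0 < fst a \<and> regular_source s"
proof -
  have 1: "(\<forall>n. 0 < fst ((a ## s) !! n)) \<longleftrightarrow> 0 < fst a \<and> (\<forall>n. 0 < fst (s !! n))"
    by (auto simp: Stream_snth split: nat.splits)
  have 2: "(\<forall>k::nat. \<exists>n. real k < jump_time n (a ## s)) \<longleftrightarrow> (\<forall>k::nat. \<exists>n. real k < jump_time n s)"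
    if "0 < fst a"
  proof safe
    fix k :: nat
    assume *: "\<forall>k::nat. \<exists>n. real k < jump_time n (a ## s)"
    obtain k' :: nat where k': "real k + fst a < real k'" using reals_Archimedean2 by blast
    obtain n where n: "real k' < jump_time n (a ## s)" using * by blast
    then obtain m where "n = Suc m" by (cases n) auto
    then show "\<exists>n. real k < jump_time n s"
      using n k' by (intro exI[of _ m]) (auto simp: jump_time_Stream)
  next
    fix k :: nat
    assume *: "\<forall>k::nat. \<exists>n. real k < jump_time n s"
    then obtain n where "real k < jump_time n s" by blast
    then show "\<exists>n. real k < jump_time n (a ## s)"
      using that by (intro exI[of _ "Suc n"]) (auto simp: jump_time_Stream)
  qed
  show ?thesis unfolding regular_source_def using 1 2 by blast
qed

text \<open>Decomposition at the first entry of the source. Integrated over the source, this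
  pathwise identity becomes the renewal equation \<open>law_renewal\<close>.\<close>

lemma jump_path_Stream:
  assumes reg: "regular_source (a ## s)" and t: "0 \<le> t"
  shows "jump_path x (a ## s) t =
    (if t < fst a then x else jump_path (snd a x) s (t - fst a))"
proof (cases "t < fst a")
  case True
  then have "num_jumps (a ## s) t = 0"
    by (intro num_jumps_eqI reg) (use t in \<open>auto simp: jump_time_Stream\<close>)
  then show ?thesis using True t reg by (simp add: jump_path_def)
next
  case False
  have s: "regular_source s" using reg by (simp add: regular_source_Stream)
  let ?n = "num_jumps s (t - fst a)"
  have "num_jumps (a ## s) t = Suc ?n"
    using num_jumps_bounds[OF s, of "t - fst a"] False
    by (intro num_jumps_eqI reg) (auto simp: jump_time_Stream)
  then show ?thesis using False t reg s
    by (simp add: jump_path_def embedded_chain_Stream del: embedded_chain.simps)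
qed

lemma jump_path_0: "jump_path x \<omega> 0 = x"
proof -
  have "num_jumps \<omega> 0 = 0" if "regular_source \<omega>"
    using regular_source_strict_mono[OF that] strict_mono_less[of "\<lambda>n. jump_time n \<omega>" 0 1]
    by (intro num_jumps_eqI that) auto
  then show ?thesis by (simp add: jump_path_def)
qed

lemma jump_path_cadlag: "jump_path x \<omega> \<in> cadlag_paths"
proof (cases "regular_source \<omega>")
  case False
  have "eventually (\<lambda>s. jump_path x \<omega> s = x) (at_right t)" if "t \<ge> 0" for t
    using eventually_at_right_less[of t] by eventually_elim (use that False in \<open>auto simp: jump_path_def\<close>)
  moreover have "eventually (\<lambda>s. jump_path x \<omega> s = x) (at_left t)" if "t > 0" for t
    using eventually_at_left_real[OF that] by eventually_elim (use that False in \<open>auto simp: jump_path_def\<close>)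
  moreover have "jump_path x \<omega> t = x" if "0 \<le> t" for t
    using that False by (simp add: jump_path_def)
  moreover have "jump_path x \<omega> \<in> {0..} \<rightarrow>\<^sub>E UNIV"
    by (simp add: jump_path_def)
  ultimately show ?thesis
    unfolding cadlag_paths_iff by metis
next
  case reg: True
  note sm = regular_source_strict_mono[OF reg]
  have eq: "jump_path x \<omega> s = embedded_chain x n \<omega>"
    if "jump_time n \<omega> \<le> s" "s < jump_time (Suc n) \<omega>" for n s
  proof -
    have "0 \<le> jump_time n \<omega>" using strict_mono_less_eq[OF sm, of 0 n] by simp
    then have "0 \<le> s" using that by simp
    then show ?thesis using num_jumps_eqI[OF reg that] reg by (simp add: jump_path_def)
  qed
  have "eventually (\<lambda>s. jump_path x \<omega> s = jump_path x \<omega> t) (at_right t)" if "t \<ge> 0" for t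
  proof -
    let ?n = "num_jumps \<omega> t"
    note b = num_jumps_bounds[OF reg that]
    show ?thesis
      using eventually_at_right_real[OF b(2)]
      by eventually_elim (use b eq[of ?n] in auto)
  qed
  moreover have "\<exists>l. eventually (\<lambda>s. jump_path x \<omega> s = l) (at_left t)" if "t > 0" for t
  proof -
    let ?n = "num_jumps \<omega> t"
    note b = num_jumps_bounds[OF reg less_imp_le[OF that]]
    show ?thesis
    proof (cases "jump_time ?n \<omega> < t")
      case True
      have "eventually (\<lambda>s. jump_path x \<omega> s = embedded_chain x ?n \<omega>) (at_left t)"
        using eventually_at_left_real[OF True] by eventually_elim (rule eq[of ?n], use b in auto)
      then show ?thesis ..
    next
      case False
      then have "jump_time ?n \<omega> = t" using b by simp
      moreover from this that obtain m where m: "?n = Suc m" by (cases ?n) auto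
      ultimately have t: "t = jump_time (Suc m) \<omega>" by simp
      have "jump_time m \<omega> < t" unfolding t using strict_mono_less[OF sm] by simp
      from eventually_at_left_real[OF this]
      have "eventually (\<lambda>s. jump_path x \<omega> s = embedded_chain x m \<omega>) (at_left t)"
        by eventually_elim (rule eq[of m], use t in auto)
      then show ?thesis ..
    qed
  qed
  ultimately show ?thesis
    unfolding cadlag_paths_iff by (auto simp: jump_path_def)
qed

section \<open>Time shifts of paths\<close>

definition shift_path :: "real \<Rightarrow> (real \<Rightarrow> 'a) \<Rightarrow> real \<Rightarrow> 'a"
  where "shift_path u v = (\<lambda>r\<in>{0..}. v (u + r))"

lemma eventually_at_right_plus:
  fixes u r :: real
  shows "eventually P (at_right (u + r)) \<Longrightarrow> eventually (\<lambda>s. P (u + s)) (at_right r)"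
  using eventually_at_right_to_0[of P "u + r"] eventually_at_right_to_0[of "\<lambda>s. P (u + s)" r]
  by (simp add: ac_simps)

lemma eventually_at_left_plus:
  fixes u r :: real
  shows "eventually P (at_left (u + r)) \<Longrightarrow> eventually (\<lambda>s. P (u + s)) (at_left r)"
  unfolding eventually_at_left_field
  by (metis add.commute add_less_cancel_left diff_add_cancel diff_less_eq less_diff_eq)

lemma shift_path_cadlag:
  assumes v: "v \<in> cadlag_paths" and u: "0 \<le> u"
  shows "shift_path u v \<in> cadlag_paths"
proof -
  have "eventually (\<lambda>s. shift_path u v s = shift_path u v t) (at_right t)" if "t \<ge> 0" for t
  proof -
    have "eventually (\<lambda>s. v s = v (u + t)) (at_right (u + t))"
      using v u that by (auto simp: cadlag_paths_iff)
    from eventually_at_right_plus[OF this] eventually_at_right_less[of t]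
    show ?thesis by eventually_elim (use that in \<open>auto simp: shift_path_def\<close>)
  qed
  moreover have "\<exists>l. eventually (\<lambda>s. shift_path u v s = l) (at_left t)" if "t > 0" for t
  proof -
    have "0 < u + t" using u that by simp
    then obtain l where "eventually (\<lambda>s. v s = l) (at_left (u + t))"
      using v by (auto simp: cadlag_paths_iff)
    from eventually_at_left_plus[OF this] eventually_at_left_real[OF that]
    have "eventually (\<lambda>s. shift_path u v s = l) (at_left t)"
      by eventually_elim (use that in \<open>auto simp: shift_path_def\<close>)
    then show ?thesis ..
  qed
  ultimately show ?thesis by (auto simp: cadlag_paths_iff shift_path_def)
qed

text \<open>A shift that stays inside the first holding time only shortens it. By memorylessness of
  the exponential law, the shortened source is then distributed like a fresh one.\<close>

lemma shift_jump_path_Stream_less: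
  assumes reg: "regular_source s" and u: "0 \<le> u" "u < fst a"
  shows "shift_path u (jump_path x (a ## s)) = jump_path x ((fst a - u, snd a) ## s)"
proof
  fix r
  have 1: "regular_source (a ## s)" "regular_source ((fst a - u, snd a) ## s)"
    using assms by (auto simp: regular_source_Stream)
  show "shift_path u (jump_path x (a ## s)) r = jump_path x ((fst a - u, snd a) ## s) r"
  proof (cases "0 \<le> r")
    case True
    then show ?thesis using u
      by (simp add: shift_path_def jump_path_Stream[OF 1(1)] jump_path_Stream[OF 1(2)] algebra_simps)
  qed (simp add: shift_path_def jump_path_def)
qed

lemma shift_jump_path_Stream_ge:
  assumes reg: "regular_source s" and u: "0 < fst a" "fst a \<le> u"
  shows "shift_path u (jump_path x (a ## s)) = shift_path (u - fst a) (jump_path (snd a x) s)"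
proof
  fix r
  have 1: "regular_source (a ## s)"
    using assms by (auto simp: regular_source_Stream)
  show "shift_path u (jump_path x (a ## s)) r = shift_path (u - fst a) (jump_path (snd a x) s) r"
  proof (cases "0 \<le> r")
    case True
    then show ?thesis using u
      by (simp add: shift_path_def jump_path_Stream[OF 1(1)] algebra_simps)
  qed (simp add: shift_path_def)
qed

section \<open>Path space and uniformization\<close>

lemma space_path_space_from [simp]: "space (path_space_from s) = cadlag_paths"
  unfolding path_space_from_def by (rule space_measure_of) auto

lemma sets_path_space_from:
  "sets (path_space_from s) =
    sigma_sets cadlag_paths {{\<omega> \<in> cadlag_paths. \<omega> r = x} | r x. s \<le> r}"
  unfolding path_space_from_def by (rule sets_measure_of) auto

lemma state_event_sets_from: "s \<le> r \<Longrightarrow> state_event r x \<in> sets (path_space_from s)"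
  unfolding sets_path_space_from state_event_def by (rule sigma_sets.Basic) auto

lemma state_event_sets [measurable]: "0 \<le> r \<Longrightarrow> state_event r x \<in> sets path_space"
  by (rule state_event_sets_from)

lemma measurable_path_spaceI:
  fixes f :: "'b \<Rightarrow> real \<Rightarrow> 'a::finite"
  assumes "\<And>\<omega>. \<omega> \<in> space M \<Longrightarrow> f \<omega> \<in> cadlag_paths"
    and "\<And>r x. s \<le> r \<Longrightarrow> {\<omega> \<in> space M. f \<omega> r = x} \<in> sets M"
  shows "f \<in> measurable M (path_space_from s)"
  unfolding path_space_from_def
proof (rule measurable_measure_of)
  fix E :: "(real \<Rightarrow> 'a) set" assume "E \<in> {{\<omega> \<in> cadlag_paths. \<omega> r = x} | r x. s \<le> r}"
  then obtain r x where E: "E = {\<omega> \<in> cadlag_paths. \<omega> r = x}" and r: "s \<le> r" by blast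
  have "f -` E \<inter> space M = {\<omega> \<in> space M. f \<omega> r = x}"
    using assms(1) by (auto simp: E)
  then show "f -` E \<inter> space M \<in> sets M" using assms(2)[OF r] by simp
qed (use assms(1) in auto)

lemma sets_path_space_from_subset: "0 \<le> s \<Longrightarrow> sets (path_space_from s) \<subseteq> sets path_space"
  unfolding sets_path_space_from by (rule sigma_sets_mono') auto

lemma measurable_shift_path:
  assumes "0 \<le> u"
  shows "shift_path u \<in> measurable path_space path_space"
proof (rule measurable_path_spaceI)
  fix r :: real and x :: 'a assume r: "0 \<le> r"
  have "{\<omega> \<in> space path_space. shift_path u \<omega> r = x} = state_event (u + r) x"
    using r by (auto simp: shift_path_def state_event_def)
  then show "{\<omega> \<in> space path_space. shift_path u \<omega> r = x} \<in> sets path_space"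
    using assms r by simp
qed (use shift_path_cadlag assms in auto)

text \<open>The chain rule of a process quantifies over events generated from time \<open>s\<close>
  on, whereas the Markov property is proved for arbitrary events of the shifted path. This lemma
  translates the former into the latter, by induction over the generated sigma-algebra.\<close>

lemma sets_path_space_from_shift:
  assumes "B \<in> sets (path_space_from s)" "0 \<le> s"
  obtains B' where "B' \<in> sets path_space" "B = {v \<in> cadlag_paths. shift_path s v \<in> B'}"
proof -
  have "\<exists>B'\<in>sets path_space. B = {v \<in> cadlag_paths. shift_path s v \<in> B'}"
    using assms(1) unfolding sets_path_space_from[of s]
  proof induction
    case (Basic a)
    then obtain r x where r: "s \<le> r" "a = {\<omega> \<in> cadlag_paths. \<omega> r = x}" by blast
    have eq: "shift_path s v (r - s) = v r" for v :: "real \<Rightarrow> 'a" using r(1) by (simp add: shift_path_def)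
    have "a = {v \<in> cadlag_paths. shift_path s v \<in> state_event (r - s) x}"
      unfolding r(2) state_event_def mem_Collect_eq eq
      by (intro Collect_cong conj_cong refl) (blast intro: shift_path_cadlag assms(2))
    then show ?case using r(1) by (intro bexI[of _ "state_event (r - s) x"]) auto
  next
    case Empty
    show ?case by (intro bexI[of _ "{}"]) auto
  next
    case (Compl a)
    then obtain B' where B': "B' \<in> sets path_space" "a = {v \<in> cadlag_paths. shift_path s v \<in> B'}" by blast
    have "cadlag_paths - a = {v \<in> cadlag_paths. shift_path s v \<in> cadlag_paths - B'}"
      unfolding B'(2) using shift_path_cadlag[OF _ assms(2)] by blast
    then show ?case using sets.compl_sets[OF B'(1)] by (intro bexI[of _ "cadlag_paths - B'"]) simp_all
  next
    case (Union a)
    then have "\<forall>i. \<exists>B'. B' \<in> sets path_space \<and> a i = {v \<in> cadlag_paths. shift_path s v \<in> B'}" by blast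
    then obtain B' where B': "\<And>i. B' i \<in> sets path_space" "\<And>i. a i = {v \<in> cadlag_paths. shift_path s v \<in> B' i}"
      by (auto dest!: choice)
    have "(\<Union>i. a i) = {v \<in> cadlag_paths. shift_path s v \<in> (\<Union>i. B' i)}"
      unfolding B'(2) by blast
    then show ?case using B'(1) by (intro bexI[of _ "\<Union>i. B' i"]) auto
  qed
  then show ?thesis using that by blast
qed

lemma measurable_finite_apply:
  fixes f :: "'b \<Rightarrow> ('a::finite \<Rightarrow> 'a)"
  assumes "f \<in> measurable M (count_space UNIV)" "g \<in> measurable M (count_space UNIV)"
  shows "(\<lambda>\<omega>. f \<omega> (g \<omega>)) \<in> measurable M (count_space UNIV)"
proof (rule measurable_compose_countable[of "\<lambda>y \<omega>. f \<omega> y", OF _ assms(2)])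
  fix y show "(\<lambda>\<omega>. f \<omega> y) \<in> measurable M (count_space UNIV)"
    by (rule measurable_compose[OF assms(1)]) simp
qed

text \<open>A Poisson clock of rate \<open>l\<close>, the same in every state, triggers a move by
  the kernel \<open>K\<close>. The chain obtained has rate matrix
  \<open>l * (K - I)\<close>.\<close>

locale uniformization =
  fixes l :: real and K :: "'a::finite \<Rightarrow> 'a pmf"
  assumes l_pos: "0 < l"
begin

text \<open>Drawing a whole map instead of just the next state makes the noise of a step independent
  of the current state. The steps are then i.i.d. and their sequence is a
  \<open>stream_space\<close>.\<close>

definition kernel_choice :: "('a \<Rightarrow> 'a) pmf"
  where "kernel_choice = Pi_pmf UNIV undefined K"

definition jump_step :: "(real \<times> ('a \<Rightarrow> 'a)) measure"
  where "jump_step = density lborel (exponential_density l) \<Otimes>\<^sub>M measure_pmf kernel_choice"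

definition source :: "'a jump_source measure"
  where "source = stream_space jump_step"

definition law :: "'a \<Rightarrow> (real \<Rightarrow> 'a) measure"
  where "law x = distr source path_space (jump_path x)"

lemma prob_exponential: "prob_space (density lborel (exponential_density l))"
  by (rule prob_space_exponential_density[OF l_pos])

lemma prob_jump_step: "prob_space jump_step"
proof -
  interpret E: prob_space "density lborel (exponential_density l)" by (rule prob_exponential)
  interpret pair_prob_space "density lborel (exponential_density l)" "measure_pmf kernel_choice" ..
  show ?thesis unfolding jump_step_def by (rule prob_space_axioms)
qed

sublocale step: prob_space jump_step by (rule prob_jump_step)

sublocale source: prob_space source
  unfolding source_def by (rule step.prob_space_stream_space)

lemma sets_jump_step: "sets jump_step = sets (borel \<Otimes>\<^sub>M count_space UNIV)"
  unfolding jump_step_def by (intro sets_pair_measure_cong) auto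

lemma space_jump_step [simp]: "space jump_step = UNIV"
  unfolding jump_step_def by (simp add: space_pair_measure)

lemma space_source [simp]: "space source = UNIV"
  by (simp add: source_def space_stream_space)

lemma measurable_snth_source [measurable]: "(\<lambda>\<omega>. \<omega> !! n) \<in> measurable source jump_step"
  unfolding source_def by measurable

lemma measurable_fst_step [measurable]: "fst \<in> measurable jump_step borel"
  unfolding measurable_cong_sets[OF sets_jump_step refl] by simp

lemma measurable_snd_step [measurable]: "snd \<in> measurable jump_step (count_space UNIV)"
  unfolding measurable_cong_sets[OF sets_jump_step refl] by simp

lemma measurable_jump_time [measurable]: "jump_time n \<in> borel_measurable source"
  unfolding jump_time_def by measurable

lemma measurable_embedded_chain [measurable]: "embedded_chain x n \<in> measurable source (count_space UNIV)"
proof (induction n)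
  case (Suc n)
  note Suc[measurable]
  show ?case unfolding embedded_chain.simps
    by (rule measurable_finite_apply) measurable
qed simp

lemma measurable_regular_source [measurable]: "Measurable.pred source regular_source"
  unfolding regular_source_def by measurable

text \<open>Measurability jointly in time and source, because the renewal equation integrates over
  the time that remains after the first jump. The \<open>max 0\<close> extends the path to all real
  times.\<close>

lemma measurable_jump_path_pair:
  "(\<lambda>p. jump_path x (snd p) (max 0 (fst p))) \<in> measurable (borel \<Otimes>\<^sub>M source) (count_space UNIV)"
proof -
  have N: "(\<lambda>p. num_jumps (snd p) (max 0 (fst p))) \<in> measurable (borel \<Otimes>\<^sub>M source) (count_space UNIV)"
    unfolding num_jumps_def by measurable
  have "(\<lambda>p. embedded_chain x (num_jumps (snd p) (max 0 (fst p))) (snd p))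
      \<in> measurable (borel \<Otimes>\<^sub>M source) (count_space UNIV)"
    by (rule measurable_compose_countable[OF _ N]) measurable
  then have [measurable]: "(\<lambda>p. embedded_chain x (num_jumps (snd p) (max 0 (fst p))) (snd p))
      \<in> measurable (borel \<Otimes>\<^sub>M source) (count_space UNIV)" .
  show ?thesis unfolding jump_path_def by simp measurable
qed

lemma measurable_shift_jump_path_pair:
  "(\<lambda>p. shift_path (max 0 (fst p)) (jump_path x (snd p)))
    \<in> measurable (borel \<Otimes>\<^sub>M source) path_space"
proof (rule measurable_path_spaceI)
  fix r :: real and y assume r: "0 \<le> r"
  have *: "(\<lambda>p. (max 0 (fst p) + r, snd p)) \<in> measurable (borel \<Otimes>\<^sub>M source) (borel \<Otimes>\<^sub>M source)"
    by measurable
  have [measurable]: "(\<lambda>p. jump_path x (snd p) (max 0 (fst p) + r))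
      \<in> measurable (borel \<Otimes>\<^sub>M source) (count_space UNIV)"
    using measurable_compose[OF * measurable_jump_path_pair[of x]] r by (simp add: max_def)
  have "{p \<in> space (borel \<Otimes>\<^sub>M source). jump_path x (snd p) (max 0 (fst p) + r) = y}
      \<in> sets (borel \<Otimes>\<^sub>M source)"
    by measurable
  then show "{p \<in> space (borel \<Otimes>\<^sub>M source). shift_path (max 0 (fst p)) (jump_path x (snd p)) r = y}
      \<in> sets (borel \<Otimes>\<^sub>M source)"
    unfolding shift_path_def using r by simp
qed (simp add: shift_path_cadlag jump_path_cadlag)

lemma measurable_jump_path [measurable]: "jump_path x \<in> measurable source path_space"
proof (rule measurable_path_spaceI)
  fix r :: real and y assume r: "0 \<le> r"
  have [measurable]: "(\<lambda>\<omega>. jump_path x \<omega> r) \<in> measurable source (count_space UNIV)"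
    using measurable_compose[OF measurable_Pair1'[of r borel source] measurable_jump_path_pair[of x]] r
    by simp
  show "{\<omega> \<in> space source. jump_path x \<omega> r = y} \<in> sets source" by measurable
qed (simp add: jump_path_cadlag)

lemma prob_law: "prob_space (law x)"
  unfolding law_def by (rule source.prob_space_distr) measurable

lemma sets_law [simp, measurable_cong]: "sets (law x) = sets path_space"
  by (simp add: law_def)

lemma space_law [simp]: "space (law x) = cadlag_paths"
  by (simp add: law_def)

section \<open>Almost sure absence of explosion\<close>

lemma exponential_laplace:
  "(\<integral>\<^sup>+e. ennreal (exp (- e)) \<partial>density lborel (exponential_density l)) = ennreal (l / (l + 1))"
proof -
  have "(\<integral>\<^sup>+e. ennreal (exp (- e)) \<partial>density lborel (exponential_density l))
      = (\<integral>\<^sup>+e. ennreal (exponential_density l e) * ennreal (exp (- e)) \<partial>lborel)"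
    by (simp add: nn_integral_density)
  also have "\<dots> = (\<integral>\<^sup>+e. ennreal (l / (l + 1)) * ennreal (exponential_density (l + 1) e) \<partial>lborel)"
  proof (rule nn_integral_cong)
    fix e :: real
    \<comment> \<open>Taking the Laplace transform at 1 amounts to a change of rate: the product is
      a multiple of the density of rate \<open>l + 1\<close>, which has mass 1.\<close>
    have "exponential_density l e * exp (- e) = l / (l + 1) * exponential_density (l + 1) e"
    proof -
      have "exp (- e * l) * exp (- e) = exp (- e * (l + 1))"
        by (simp add: exp_add[symmetric] algebra_simps)
      then show ?thesis using l_pos by (simp add: exponential_density_def)
    qed
    then show "ennreal (exponential_density l e) * ennreal (exp (- e)) =
        ennreal (l / (l + 1)) * ennreal (exponential_density (l + 1) e)"
      using l_pos by (simp add: ennreal_mult'[symmetric] ennreal_mult''[symmetric])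
  qed
  also have "\<dots> = ennreal (l / (l + 1)) * (\<integral>\<^sup>+e. ennreal (exponential_density (l + 1) e) \<partial>lborel)"
    by (simp add: nn_integral_cmult)
  also have "(\<integral>\<^sup>+e. ennreal (exponential_density (l + 1) e) \<partial>lborel)
      = emeasure (density lborel (exponential_density (l + 1))) UNIV"
    by (simp add: emeasure_density)
  also have "\<dots> = 1"
    using prob_space.emeasure_space_1[OF prob_space_exponential_density[of "l + 1"]] l_pos by simp
  finally show ?thesis by simp
qed

lemma nn_integral_jump_step:
  assumes [measurable]: "f \<in> borel_measurable jump_step"
  shows "(\<integral>\<^sup>+a. f a \<partial>jump_step) =
    (\<integral>\<^sup>+e. ennreal (exponential_density l e) * (\<integral>\<^sup>+g. f (e, g) \<partial>measure_pmf kernel_choice) \<partial>lborel)"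
proof -
  interpret E: prob_space "density lborel (exponential_density l)" by (rule prob_exponential)
  interpret P: pair_prob_space "density lborel (exponential_density l)" "measure_pmf kernel_choice" ..
  have f: "f \<in> borel_measurable (density lborel (exponential_density l) \<Otimes>\<^sub>M measure_pmf kernel_choice)"
    using assms by (simp add: jump_step_def)
  then have f': "(\<lambda>(x, y). f (x, y)) \<in> borel_measurable (lborel \<Otimes>\<^sub>M measure_pmf kernel_choice)"
    by (simp add: measurable_def sets_pair_measure space_pair_measure)
  have m: "(\<lambda>e. \<integral>\<^sup>+g. f (e, g) \<partial>measure_pmf kernel_choice) \<in> borel_measurable lborel"
    by (rule measure_pmf.borel_measurable_nn_integral[OF f'])
  have "(\<integral>\<^sup>+a. f a \<partial>jump_step)
      = (\<integral>\<^sup>+e. (\<integral>\<^sup>+g. f (e, g) \<partial>measure_pmf kernel_choice) \<partial>density lborel (exponential_density l))"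
    unfolding jump_step_def by (rule measure_pmf.nn_integral_fst[OF f, symmetric])
  also have "\<dots> = (\<integral>\<^sup>+e. ennreal (exponential_density l e) *
      (\<integral>\<^sup>+g. f (e, g) \<partial>measure_pmf kernel_choice) \<partial>lborel)"
    using m by (intro nn_integral_density) auto
  finally show ?thesis .
qed

lemma jump_step_laplace: "(\<integral>\<^sup>+a. ennreal (exp (- fst a)) \<partial>jump_step) = ennreal (l / (l + 1))"
  by (subst nn_integral_jump_step)
     (use exponential_laplace in \<open>simp_all add: nn_integral_density\<close>)

lemma jump_time_laplace: "(\<integral>\<^sup>+\<omega>. ennreal (exp (- jump_time n \<omega>)) \<partial>source) = ennreal ((l / (l + 1)) ^ n)"
proof (induction n)
  case 0
  show ?case by (simp add: source.emeasure_space_1[simplified])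
next
  case (Suc n)
  have m: "(\<lambda>\<omega>. ennreal (exp (- jump_time n \<omega>))) \<in> borel_measurable (stream_space jump_step)" for n
    using measurable_jump_time[of n] unfolding source_def by measurable
  have "(\<integral>\<^sup>+\<omega>. ennreal (exp (- jump_time (Suc n) \<omega>)) \<partial>source) =
      (\<integral>\<^sup>+a. (\<integral>\<^sup>+\<omega>. ennreal (exp (- jump_time (Suc n) (a ## \<omega>))) \<partial>source) \<partial>jump_step)"
    unfolding source_def by (rule step.nn_integral_stream_space[OF m])
  also have "\<dots> = (\<integral>\<^sup>+a. ennreal (exp (- fst a)) * ennreal ((l / (l + 1)) ^ n) \<partial>jump_step)"
  proof (rule nn_integral_cong)
    fix a :: "real \<times> ('a \<Rightarrow> 'a)"
    have "(\<integral>\<^sup>+\<omega>. ennreal (exp (- jump_time (Suc n) (a ## \<omega>))) \<partial>source) =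
        (\<integral>\<^sup>+\<omega>. ennreal (exp (- fst a)) * ennreal (exp (- jump_time n \<omega>)) \<partial>source)"
      by (intro nn_integral_cong)
         (simp add: jump_time_Stream exp_add[symmetric] ennreal_mult'[symmetric])
    also have "\<dots> = ennreal (exp (- fst a)) * ennreal ((l / (l + 1)) ^ n)"
      by (simp add: nn_integral_cmult Suc)
    finally show "(\<integral>\<^sup>+\<omega>. ennreal (exp (- jump_time (Suc n) (a ## \<omega>))) \<partial>source) =
        ennreal (exp (- fst a)) * ennreal ((l / (l + 1)) ^ n)" .
  qed
  also have "\<dots> = ennreal (l / (l + 1)) * ennreal ((l / (l + 1)) ^ n)"
    by (subst nn_integral_multc) (simp_all add: jump_step_laplace)
  also have "\<dots> = ennreal ((l / (l + 1)) ^ Suc n)"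
    using l_pos by (simp add: ennreal_mult'[symmetric])
  finally show ?case .
qed

text \<open>A Markov-type estimate: where all jump times stay below \<open>k\<close>, the constant
  \<open>exp (- k)\<close> is at most \<open>exp (- jump_time n)\<close> for each \<open>n\<close>,
  while the expectation of the latter, \<open>(l / (l + 1)) ^ n\<close>, tends to 0.\<close>

lemma AE_unbounded: "AE \<omega> in source. \<exists>n. real k < jump_time n \<omega>"
proof -
  let ?q = "l / (l + 1)"
  have meas: "{\<omega>. \<forall>n. jump_time n \<omega> \<le> real k} \<in> sets source"
  proof -
    have "{\<omega> \<in> space source. \<forall>n. jump_time n \<omega> \<le> real k} \<in> sets source" by measurable
    then show ?thesis by simp
  qed
  have le: "ennreal (exp (- real k)) * emeasure source {\<omega>. \<forall>n. jump_time n \<omega> \<le> real k} \<le> ennreal (?q ^ n)" for n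
  proof -
    have "ennreal (exp (- real k)) * emeasure source {\<omega>. \<forall>n. jump_time n \<omega> \<le> real k} =
        (\<integral>\<^sup>+\<omega>. ennreal (exp (- real k)) * indicator {\<omega>. \<forall>n. jump_time n \<omega> \<le> real k} \<omega> \<partial>source)"
      using meas by (simp add: nn_integral_cmult_indicator)
    also have "\<dots> \<le> (\<integral>\<^sup>+\<omega>. ennreal (exp (- jump_time n \<omega>)) \<partial>source)"
      by (intro nn_integral_mono) (auto split: split_indicator)
    finally show ?thesis by (simp add: jump_time_laplace)
  qed
  have "(\<lambda>n. ennreal (?q ^ n)) \<longlonglongrightarrow> ennreal 0"
    using l_pos by (intro tendsto_ennrealI LIMSEQ_power_zero) auto
  then have "ennreal (exp (- real k)) * emeasure source {\<omega>. \<forall>n. jump_time n \<omega> \<le> real k} \<le> ennreal 0"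
    by (rule LIMSEQ_le_const) (use le in auto)
  then have "emeasure source {\<omega>. \<forall>n. jump_time n \<omega> \<le> real k} = 0"
    by (simp add: ennreal_eq_0_iff)
  then show ?thesis
    using meas by (intro AE_I[where N = "{\<omega>. \<forall>n. jump_time n \<omega> \<le> real k}"]) (auto simp: not_less)
qed

lemma AE_regular_source: "AE \<omega> in source. regular_source \<omega>"
proof -
  have "AE a in jump_step. 0 < fst a"
  proof -
    have "(\<integral>\<^sup>+a. indicator {a. fst a \<le> 0} a \<partial>jump_step) =
        (\<integral>\<^sup>+e. ennreal (exponential_density l e) *
          (\<integral>\<^sup>+g. indicator {a. fst a \<le> 0} (e, g) \<partial>measure_pmf kernel_choice) \<partial>lborel)"
    proof (rule nn_integral_jump_step)
      have "{a \<in> space jump_step. fst a \<le> 0} \<in> sets jump_step" by measurable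
      then show "indicator {a. fst a \<le> 0} \<in> borel_measurable jump_step" by simp
    qed
    also have "\<dots> = 0"
      using AE_lborel_singleton[of 0]
      by (subst nn_integral_0_iff_AE)
         (auto simp: exponential_density_def indicator_def elim!: eventually_mono)
    finally have "(\<integral>\<^sup>+a. indicator {a. \<not> 0 < fst a} a \<partial>jump_step) = 0"
      by (simp add: not_less)
    then show ?thesis by (rule iffD2[OF AE_iff_nn_integral, rotated]) measurable
  qed
  then have "AE \<omega> in source. stream_all (\<lambda>a. 0 < fst a) \<omega>"
    unfolding source_def by (intro step.AE_stream_all) auto
  moreover have "AE \<omega> in source. \<forall>k::nat. \<exists>n. real k < jump_time n \<omega>"
    using AE_unbounded by (simp add: AE_all_countable)
  ultimately show ?thesis
    by eventually_elim (auto simp: regular_source_def stream_all_def)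
qed

end

section \<open>The renewal equation\<close>

text \<open>Leaving \<open>B\<close> general lets one renewal equation serve two purposes:
  \<open>B = cadlag_paths\<close> gives the transition probabilities, arbitrary \<open>B\<close> the
  Markov property.\<close>

definition markov_event :: "real \<Rightarrow> 'a::finite \<Rightarrow> (real \<Rightarrow> 'a) set \<Rightarrow> (real \<Rightarrow> 'a) set"
  where "markov_event u y B = {v \<in> cadlag_paths. v u = y \<and> shift_path u v \<in> B}"

lemma markov_event_sets:
  assumes "B \<in> sets path_space" "0 \<le> u"
  shows "markov_event u y B \<in> sets path_space"
proof -
  have "markov_event u y B = state_event u y \<inter> (shift_path u -` B \<inter> space path_space)"
    by (auto simp: markov_event_def state_event_def)
  then show ?thesis
    using measurable_sets[OF measurable_shift_path[OF assms(2)] assms(1)] assms(2) by simp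
qed

lemma markov_event_cadlag_paths:
  "0 \<le> u \<Longrightarrow> markov_event u y cadlag_paths = state_event u y"
  using shift_path_cadlag by (auto simp: markov_event_def state_event_def)

lemma cadlag_paths_sets: "cadlag_paths \<in> sets path_space"
  using sets.top[of path_space] by simp

context uniformization
begin

lemma measurable_Stream_source: "(\<lambda>p. fst p ## snd p) \<in> measurable (jump_step \<Otimes>\<^sub>M source) source"
  unfolding source_def by measurable

lemma measurable_law_markov_event:
  assumes [measurable]: "B \<in> sets path_space"
  shows "(\<lambda>u. emeasure (law z) (markov_event (max 0 u) y B)) \<in> borel_measurable borel"
proof -
  let ?Q = "{p \<in> space (borel \<Otimes>\<^sub>M source).
    jump_path z (snd p) (max 0 (fst p)) = y \<and> shift_path (max 0 (fst p)) (jump_path z (snd p)) \<in> B}"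
  note [measurable] = measurable_jump_path_pair[of z] measurable_shift_jump_path_pair[of z]
  have Q: "?Q \<in> sets (borel \<Otimes>\<^sub>M source)" by measurable
  have "emeasure (law z) (markov_event (max 0 u) y B) = emeasure source (Pair u -` ?Q)" for u
  proof -
    have "jump_path z -` markov_event (max 0 u) y B \<inter> space source = Pair u -` ?Q"
      by (auto simp: markov_event_def jump_path_cadlag space_pair_measure)
    then show ?thesis
      using markov_event_sets[OF assms, of "max 0 u" y] by (simp add: law_def emeasure_distr)
  qed
  then show ?thesis using source.measurable_emeasure_Pair[OF Q] by simp
qed

lemma nn_integral_kernel_choice:
  "(\<integral>\<^sup>+g. f (g x) \<partial>measure_pmf kernel_choice) = (\<Sum>z\<in>UNIV. ennreal (pmf (K x) z) * f z)"
proof -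
  have "(\<integral>\<^sup>+g. f (g x) \<partial>measure_pmf kernel_choice) = (\<integral>\<^sup>+z. f z \<partial>measure_pmf (map_pmf (\<lambda>g. g x) kernel_choice))"
    by simp
  also have "map_pmf (\<lambda>g. g x) kernel_choice = K x"
    unfolding kernel_choice_def by (subst Pi_pmf_component) auto
  finally show ?thesis
    by (simp add: nn_integral_pmf nn_integral_measure_pmf nn_integral_count_space_finite)
qed

lemma nn_integral_source:
  assumes "f \<in> borel_measurable source"
  shows "(\<integral>\<^sup>+\<omega>. f \<omega> \<partial>source) =
    (\<integral>\<^sup>+e. ennreal (exponential_density l e) *
      (\<integral>\<^sup>+g. \<integral>\<^sup>+s. f ((e, g) ## s) \<partial>source \<partial>measure_pmf kernel_choice) \<partial>lborel)"
    and "(\<lambda>e. \<integral>\<^sup>+g. \<integral>\<^sup>+s. f ((e, g) ## s) \<partial>source \<partial>measure_pmf kernel_choice) \<in> borel_measurable borel"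
proof -
  have "(\<lambda>p. f (fst p ## snd p)) \<in> borel_measurable (jump_step \<Otimes>\<^sub>M source)"
    by (rule measurable_compose[OF measurable_Stream_source assms])
  then have m: "(\<lambda>a. \<integral>\<^sup>+s. f (a ## s) \<partial>source) \<in> borel_measurable jump_step"
    by (intro source.borel_measurable_nn_integral) (simp add: case_prod_beta')
  have "(\<integral>\<^sup>+\<omega>. f \<omega> \<partial>source) = (\<integral>\<^sup>+a. \<integral>\<^sup>+s. f (a ## s) \<partial>source \<partial>jump_step)"
    using step.nn_integral_stream_space assms unfolding source_def by blast
  then show "(\<integral>\<^sup>+\<omega>. f \<omega> \<partial>source) =
    (\<integral>\<^sup>+e. ennreal (exponential_density l e) *
      (\<integral>\<^sup>+g. \<integral>\<^sup>+s. f ((e, g) ## s) \<partial>source \<partial>measure_pmf kernel_choice) \<partial>lborel)"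
    by (simp add: nn_integral_jump_step[OF m])
  have "(\<lambda>(e, g). \<integral>\<^sup>+s. f ((e, g) ## s) \<partial>source) \<in> borel_measurable (borel \<Otimes>\<^sub>M measure_pmf kernel_choice)"
  proof -
    have "(\<lambda>(e, g). \<integral>\<^sup>+s. f ((e, g) ## s) \<partial>source) = (\<lambda>a. \<integral>\<^sup>+s. f (a ## s) \<partial>source)" by auto
    then show ?thesis
      using m unfolding measurable_cong_sets[OF sets_jump_step refl]
      by (simp add: measurable_def sets_pair_measure space_pair_measure)
  qed
  then show "(\<lambda>e. \<integral>\<^sup>+g. \<integral>\<^sup>+s. f ((e, g) ## s) \<partial>source \<partial>measure_pmf kernel_choice) \<in> borel_measurable borel"
    by (rule measure_pmf.borel_measurable_nn_integral)
qed

lemma emeasure_law: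
  assumes "E \<in> sets path_space"
  shows "emeasure (law x) E = (\<integral>\<^sup>+\<omega>. indicator E (jump_path x \<omega>) \<partial>source)"
proof -
  have "emeasure (law x) E = (\<integral>\<^sup>+v. indicator E v \<partial>law x)"
    using assms by simp
  also have "\<dots> = (\<integral>\<^sup>+\<omega>. indicator E (jump_path x \<omega>) \<partial>source)"
    unfolding law_def using assms by (intro nn_integral_distr) auto
  finally show ?thesis .
qed

text \<open>Condition on the first entry \<open>(e, g)\<close> of the source. If
  \<open>e < u\<close>, the chain restarts from \<open>g x\<close> with time \<open>u - e\<close>
  left. If \<open>u < e\<close>, the path still sits in \<open>x\<close> and the shifted path starts
  with the residual holding time \<open>e - u\<close>; memorylessness turns this case into the
  factor \<open>exp (- l * u)\<close> times the law of \<open>x\<close>. The indicator allows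
  \<open>law y\<close> to stand for \<open>law x\<close>.\<close>

lemma law_renewal:
  assumes B: "B \<in> sets path_space" and u: "0 \<le> u"
  shows "emeasure (law x) (markov_event u y B) =
    ennreal (exp (- l * u)) * (indicator {y} x * emeasure (law y) B) +
    (\<integral>\<^sup>+e. ennreal (exponential_density l e) * (indicator {0..u} e *
      (\<Sum>z\<in>UNIV. ennreal (pmf (K x) z) * emeasure (law z) (markov_event (u - e) y B))) \<partial>lborel)"
    (is "?L = ?c * (?i * emeasure (law y) B) + (\<integral>\<^sup>+e. ?d e * (?r e) \<partial>lborel)")
proof -
  note E = markov_event_sets[OF B u, of y]
  define H where "H e = (\<integral>\<^sup>+g. \<integral>\<^sup>+s. indicator B (jump_path x ((e, g) ## s)) \<partial>source \<partial>measure_pmf kernel_choice)"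
    for e :: real
  define J where "J e = (\<integral>\<^sup>+g. \<integral>\<^sup>+s. indicator (markov_event u y B) (jump_path x ((e, g) ## s)) \<partial>source
    \<partial>measure_pmf kernel_choice)" for e :: real
  have mB: "(\<lambda>\<omega>. indicator B (jump_path x \<omega>) :: ennreal) \<in> borel_measurable source"
    using B by measurable
  have mE: "(\<lambda>\<omega>. indicator (markov_event u y B) (jump_path x \<omega>) :: ennreal) \<in> borel_measurable source"
    using E by measurable
  have [measurable]: "H \<in> borel_measurable borel"
    using nn_integral_source(2)[OF mB] unfolding H_def .
  have r_eq: "?r e = indicator {0..u} e *
      (\<Sum>z\<in>UNIV. ennreal (pmf (K x) z) * emeasure (law z) (markov_event (max 0 (u - e)) y B))" for e
    by (auto split: split_indicator)
  have [measurable]: "?r \<in> borel_measurable borel"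
    unfolding r_eq
    by (intro borel_measurable_times_ennreal borel_measurable_sum borel_measurable_const
        borel_measurable_indicator measurable_compose[OF _ measurable_law_markov_event[OF B]]) auto
  have low: "J e = ?r e" if e: "0 < e" "e < u" for e
  proof -
    have "(\<integral>\<^sup>+s. indicator (markov_event u y B) (jump_path x ((e, g) ## s)) \<partial>source) =
        emeasure (law (g x)) (markov_event (u - e) y B)" for g
    proof -
      have "(\<integral>\<^sup>+s. indicator (markov_event u y B) (jump_path x ((e, g) ## s)) \<partial>source) =
        (\<integral>\<^sup>+s. indicator (markov_event (u - e) y B) (jump_path (g x) s) \<partial>source)"
      proof (rule nn_integral_cong_AE)
        show "AE s in source. (indicator (markov_event u y B) (jump_path x ((e, g) ## s)) :: ennreal) =
            indicator (markov_event (u - e) y B) (jump_path (g x) s)"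
          using AE_regular_source
        proof eventually_elim
          case (elim s)
          then have "jump_path x ((e, g) ## s) u = jump_path (g x) s (u - e)"
            using e by (simp add: jump_path_Stream regular_source_Stream)
          moreover have "shift_path u (jump_path x ((e, g) ## s)) = shift_path (u - e) (jump_path (g x) s)"
            using shift_jump_path_Stream_ge[OF elim, of "(e, g)" u x] e by simp
          ultimately show ?case by (simp add: markov_event_def jump_path_cadlag indicator_def)
        qed
      qed
      also have "\<dots> = emeasure (law (g x)) (markov_event (u - e) y B)"
        using e by (intro emeasure_law[symmetric] markov_event_sets[OF B]) simp
      finally show ?thesis .
    qed
    then have "J e = (\<integral>\<^sup>+g. emeasure (law (g x)) (markov_event (u - e) y B) \<partial>measure_pmf kernel_choice)"
      by (simp add: J_def)
    then show ?thesis using e by (subst (asm) nn_integral_kernel_choice) simp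
  qed
  have high: "J e = ?i * H (e - u)" if e: "u < e" for e
  proof -
    have "(\<integral>\<^sup>+s. indicator (markov_event u y B) (jump_path x ((e, g) ## s)) \<partial>source) =
        (\<integral>\<^sup>+s. ?i * indicator B (jump_path x ((e - u, g) ## s)) \<partial>source)" for g
    proof (rule nn_integral_cong_AE)
      show "AE s in source. (indicator (markov_event u y B) (jump_path x ((e, g) ## s)) :: ennreal) =
          ?i * indicator B (jump_path x ((e - u, g) ## s))"
        using AE_regular_source
      proof eventually_elim
        case (elim s)
        then have "jump_path x ((e, g) ## s) u = x"
          using e u by (simp add: jump_path_Stream regular_source_Stream)
        moreover have "shift_path u (jump_path x ((e, g) ## s)) = jump_path x ((e - u, g) ## s)"
          using shift_jump_path_Stream_less[OF elim u, of "(e, g)" x] e by simp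
        ultimately show ?case by (auto simp: markov_event_def jump_path_cadlag indicator_def)
      qed
    qed
    also have "(\<integral>\<^sup>+s. ?i * indicator B (jump_path x ((e - u, g) ## s)) \<partial>source) =
        ?i * (\<integral>\<^sup>+s. indicator B (jump_path x ((e - u, g) ## s)) \<partial>source)" for g
      by (simp split: split_indicator)
    finally show ?thesis
      unfolding J_def H_def by (simp split: split_indicator)
  qed
  have "?L = (\<integral>\<^sup>+e. ?d e * J e \<partial>lborel)"
    unfolding emeasure_law[OF E] J_def by (rule nn_integral_source(1)[OF mE])
  also have "\<dots> = (\<integral>\<^sup>+e. ?d e * ?r e + ?i * (?d e * (indicator {u<..} e * H (e - u))) \<partial>lborel)"
  proof (rule nn_integral_cong_AE)
    \<comment> \<open>The values 0 and \<open>u\<close>, which neither \<open>low\<close> nor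
      \<open>high\<close> covers, form a null set.\<close>
    show "AE e in lborel. ?d e * J e = ?d e * ?r e + ?i * (?d e * (indicator {u<..} e * H (e - u)))"
      using AE_lborel_singleton[of 0] AE_lborel_singleton[of u]
    proof eventually_elim
      case (elim e)
      consider "e < 0" | "0 < e" "e < u" | "u < e" using elim by linarith
      then show ?case
      proof cases
        case 1 then show ?thesis by (simp add: exponential_density_def)
      next
        case 2 then show ?thesis using low[OF 2] by simp
      next
        case 3 then show ?thesis using high[OF 3] by (simp add: ac_simps)
      qed
    qed
  qed
  also have "\<dots> = (\<integral>\<^sup>+e. ?d e * ?r e \<partial>lborel) +
      ?i * (\<integral>\<^sup>+e. ?d e * (indicator {u<..} e * H (e - u)) \<partial>lborel)"
    by (subst nn_integral_add, measurable, subst nn_integral_cmult, measurable)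
  also have "(\<integral>\<^sup>+e. ?d e * (indicator {u<..} e * H (e - u)) \<partial>lborel) =
      (\<integral>\<^sup>+e. ?d (u + e) * (indicator {u<..} (u + e) * H e) \<partial>lborel)"
    by (subst nn_integral_real_affine[where c = 1 and t = u]) auto
  also have "\<dots> = (\<integral>\<^sup>+e. ?c * (?d e * H e) \<partial>lborel)"
  proof (rule nn_integral_cong_AE)
    show "AE e in lborel. ?d (u + e) * (indicator {u<..} (u + e) * H e) = ?c * (?d e * H e)"
      using AE_lborel_singleton[of 0]
    proof eventually_elim
      case (elim e)
      consider "e < 0" | "0 < e" using elim by linarith
      then show ?case
      proof cases
        case 2
        \<comment> \<open>Memorylessness of the exponential law.\<close>
        have "exponential_density l (u + e) = exp (- l * u) * exponential_density l e"
          using u 2 by (simp add: exponential_density_def exp_add[symmetric] algebra_simps)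
        then show ?thesis using 2 by (simp add: ennreal_mult' mult.assoc)
      qed (use u in \<open>simp add: exponential_density_def\<close>)
    qed
  qed
  also have "\<dots> = ?c * (\<integral>\<^sup>+e. ?d e * H e \<partial>lborel)"
    by (subst nn_integral_cmult) auto
  also have "(\<integral>\<^sup>+e. ?d e * H e \<partial>lborel) = emeasure (law x) B"
    unfolding emeasure_law[OF B] H_def by (rule nn_integral_source(1)[OF mB, symmetric])
  finally show ?thesis by (auto split: split_indicator simp: ac_simps)
qed

end

section \<open>Uniqueness for the renewal equation and the Markov property\<close>

context uniformization
begin

text \<open>The convolution equation with inhomogeneity \<open>exp (- l * u) * c x\<close>. It is
  stated with the Bochner integral, integrability included, because uniqueness subtracts two
  solutions and the difference has no sign.\<close>

definition solves_renewal :: "('a \<Rightarrow> real) \<Rightarrow> (real \<Rightarrow> 'a \<Rightarrow> real) \<Rightarrow> bool"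
  where "solves_renewal c G \<longleftrightarrow> (\<forall>u\<ge>0. \<forall>x.
    has_bochner_integral lborel
      (\<lambda>e. (l * exp (- l * e) * (\<Sum>z\<in>UNIV. pmf (K x) z * G (u - e) z)) * indicator {0..u} e)
      (G u x - exp (- l * u) * c x))"

lemma sum_pmf_UNIV: "(\<Sum>z\<in>UNIV. pmf (K x) z) = 1"
  using sum_pmf_eq_1[of UNIV "K x"] by simp

text \<open>The difference of two solutions solves the homogeneous equation, whose kernel has mass
  at most \<open>q = 1 - exp (- l * T) < 1\<close> on \<open>[0, T]\<close>. Any bound
  \<open>m\<close> on the difference thus improves to \<open>q * m\<close>, and iteration leaves
  only 0.\<close>

lemma solves_renewal_unique:
  assumes sol: "solves_renewal c G1" "solves_renewal c G2"
    and bound: "\<And>u x. 0 \<le> u \<Longrightarrow> u \<le> T \<Longrightarrow> \<bar>G1 u x - G2 u x\<bar> \<le> C"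
    and u: "0 \<le> u" "u \<le> T"
  shows "G1 u x = G2 u x"
proof -
  define D where "D u x = G1 u x - G2 u x" for u x
  define q where "q = 1 - exp (- l * T)"
  have T: "0 \<le> T" using u by simp
  have q: "0 \<le> q" "q < 1" using T l_pos by (auto simp: q_def)
  have int: "has_bochner_integral lborel
      (\<lambda>e. (l * exp (- l * e) * (\<Sum>z\<in>UNIV. pmf (K x) z * D (u - e) z)) * indicator {0..u} e) (D u x)"
    if "0 \<le> u" for u x
  proof -
    have 1: "has_bochner_integral lborel
      (\<lambda>e. (l * exp (- l * e) * (\<Sum>z\<in>UNIV. pmf (K x) z * G (u - e) z)) * indicator {0..u} e)
      (G u x - exp (- l * u) * c x)" if "solves_renewal c G" for G
      using that \<open>0 \<le> u\<close> unfolding solves_renewal_def by blast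
    show ?thesis
      using has_bochner_integral_diff[OF 1[OF sol(1)] 1[OF sol(2)]]
      by (simp add: D_def algebra_simps sum_subtractf)
  qed
  have exp_int: "has_bochner_integral lborel (\<lambda>e. (m * (l * exp (- l * e))) * indicator {0..T} e) (m * q)" for m
  proof -
    have "has_bochner_integral lborel (\<lambda>e. (m * (l * exp (- l * e))) * indicator {0..T} e)
      (m * (- exp (- l * T)) - m * (- exp (- l * 0)))"
      by (rule has_bochner_integral_FTC_Icc_real[OF T]) (auto intro!: derivative_eq_intros)
    then show ?thesis by (simp add: q_def algebra_simps)
  qed
  have step: "\<bar>D u x\<bar> \<le> q * m"
    if m: "\<And>u x. 0 \<le> u \<Longrightarrow> u \<le> T \<Longrightarrow> \<bar>D u x\<bar> \<le> m" and u: "0 \<le> u" "u \<le> T" for m u x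
  proof -
    have m0: "0 \<le> m" using m[OF u, of x] by linarith
    let ?f = "\<lambda>e. (l * exp (- l * e) * (\<Sum>z\<in>UNIV. pmf (K x) z * D (u - e) z)) * indicator {0..u} e"
    have le: "\<bar>?f e\<bar> \<le> (m * (l * exp (- l * e))) * indicator {0..T} e" for e
    proof (cases "e \<in> {0..u}")
      case True
      have "\<bar>\<Sum>z\<in>UNIV. pmf (K x) z * D (u - e) z\<bar> \<le> (\<Sum>z\<in>UNIV. \<bar>pmf (K x) z * D (u - e) z\<bar>)"
        by (rule sum_abs)
      also have "\<dots> \<le> (\<Sum>z\<in>UNIV. pmf (K x) z * m)"
        using True u by (intro sum_mono) (auto simp: abs_mult intro!: mult_left_mono m)
      also have "\<dots> = m" by (simp add: sum_distrib_right[symmetric] sum_pmf_UNIV)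
      finally show ?thesis using True u l_pos
        by (simp add: abs_mult mult.commute)
    next
      case False
      then show ?thesis using m0 l_pos by (simp add: indicator_def)
    qed
    have "\<bar>D u x\<bar> = \<bar>\<integral>e. ?f e \<partial>lborel\<bar>"
      using has_bochner_integral_integral_eq[OF int[OF u(1), of x]] by simp
    also have "\<dots> \<le> (\<integral>e. \<bar>?f e\<bar> \<partial>lborel)"
      by (rule integral_abs_bound)
    also have "\<dots> \<le> (\<integral>e. (m * (l * exp (- l * e))) * indicator {0..T} e \<partial>lborel)"
      using int[OF u(1), of x] exp_int[of m] le
      by (intro integral_mono) (auto simp: has_bochner_integral_iff)
    also have "\<dots> = q * m"
      using has_bochner_integral_integral_eq[OF exp_int[of m]] by simp
    finally show ?thesis .
  qed
  have "\<forall>u x. 0 \<le> u \<longrightarrow> u \<le> T \<longrightarrow> \<bar>D u x\<bar> \<le> q ^ n * C" for n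
  proof (induction n)
    case 0
    show ?case using bound by (simp add: D_def)
  next
    case (Suc n)
    then show ?case using step[of "q ^ n * C"] by (simp add: mult.assoc)
  qed
  then have "\<bar>D u x\<bar> \<le> q ^ n * C" for n using u by blast
  moreover have "(\<lambda>n. q ^ n * C) \<longlonglongrightarrow> 0 * C"
    using q by (intro tendsto_intros LIMSEQ_power_zero) auto
  ultimately have "\<bar>D u x\<bar> \<le> 0 * C"
    by (intro LIMSEQ_le_const) auto
  then show ?thesis by (simp add: D_def)
qed

lemma solves_renewal_law:
  assumes B: "B \<in> sets path_space"
  shows "solves_renewal (\<lambda>x. indicator {y} x * measure (law y) B)
    (\<lambda>u x. measure (law x) (markov_event u y B))"
  unfolding solves_renewal_def
proof safe
  fix u :: real and x assume u: "0 \<le> u"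
  interpret L: prob_space "law z" for z by (rule prob_law)
  let ?G = "\<lambda>u x. measure (law x) (markov_event u y B)"
  let ?f = "\<lambda>e. (l * exp (- l * e) * (\<Sum>z\<in>UNIV. pmf (K x) z * ?G (u - e) z)) * indicator {0..u} e"
  have f_eq: "?f e = (l * exp (- l * e) * (\<Sum>z\<in>UNIV. pmf (K x) z * ?G (max 0 (u - e)) z)) * indicator {0..u} e" for e
    by (simp split: split_indicator)
  have "(\<lambda>u. ?G (max 0 u) z) \<in> borel_measurable borel" for z
    unfolding measure_def
    by (rule measurable_compose[OF measurable_law_markov_event[OF B]]) simp
  then have [measurable]: "(\<lambda>e. ?G (max 0 (u - e)) z) \<in> borel_measurable borel" for z
    by (rule measurable_compose[rotated]) simp
  have meas: "?f \<in> borel_measurable lborel"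
    unfolding f_eq by measurable
  have nonneg: "0 \<le> ?f e" for e
    using l_pos by (intro mult_nonneg_nonneg sum_nonneg) auto
  have "(\<integral>\<^sup>+e. ennreal (exponential_density l e) * (indicator {0..u} e *
      (\<Sum>z\<in>UNIV. ennreal (pmf (K x) z) * emeasure (law z) (markov_event (u - e) y B))) \<partial>lborel) =
      (\<integral>\<^sup>+e. ennreal (?f e) \<partial>lborel)"
    using l_pos
    by (intro nn_integral_cong)
       (auto simp: exponential_density_def L.emeasure_eq_measure ennreal_mult[symmetric] sum_ennreal
         sum_nonneg mult.commute split: split_indicator)
  moreover have "emeasure (law y) B = ennreal (measure (law y) B)"
    by (rule L.emeasure_eq_measure)
  ultimately have *: "ennreal (?G u x) = ennreal (exp (- l * u) * (indicator {y} x * measure (law y) B)) +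
      (\<integral>\<^sup>+e. ennreal (?f e) \<partial>lborel)"
    using law_renewal[OF B u, of x y]
    by (simp add: L.emeasure_eq_measure ennreal_mult' indicator_def)
  let ?c = "exp (- l * u) * (indicator {y} x * measure (law y) B)"
  have c0: "0 \<le> ?c" by simp
  have "ennreal (?G u x - ?c) = ennreal (?G u x) - ennreal ?c"
    by (rule ennreal_minus[OF c0, symmetric])
  also have "\<dots> = (\<integral>\<^sup>+e. ennreal (?f e) \<partial>lborel)"
    unfolding * by simp
  finally have nn: "(\<integral>\<^sup>+e. ennreal (?f e) \<partial>lborel) = ennreal (?G u x - ?c)" ..
  have "ennreal ?c \<le> ennreal (?G u x)" unfolding * by simp
  then have "?c \<le> ?G u x" by (simp add: ennreal_le_iff)
  then show "has_bochner_integral lborel ?f (?G u x - ?c)"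
    using meas nonneg nn by (intro has_bochner_integral_nn_integral) auto
qed

text \<open>As functions of \<open>u\<close> and \<open>x\<close>, both sides solve the renewal
  equation with the same inhomogeneity: the right side is the solution for
  \<open>B = cadlag_paths\<close> times the constant \<open>measure (law y) B\<close>. Both are
  bounded by 1.\<close>

lemma law_markov:
  assumes B: "B \<in> sets path_space" and u: "0 \<le> u"
  shows "measure (law x) (markov_event u y B) = measure (law x) (state_event u y) * measure (law y) B"
proof -
  interpret L: prob_space "law z" for z by (rule prob_law)
  have one: "measure (law y) cadlag_paths = 1" for y
    using L.prob_space[of y] by simp
  have "solves_renewal (\<lambda>x. indicator {y} x * measure (law y) B)
      (\<lambda>u x. measure (law x) (markov_event u y cadlag_paths) * measure (law y) B)"
    unfolding solves_renewal_def
  proof safe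
    fix u :: real and x assume "0 \<le> u"
    have 1: "has_bochner_integral lborel
      (\<lambda>e. (l * exp (- l * e) * (\<Sum>z\<in>UNIV. pmf (K x) z * measure (law z) (markov_event (u - e) y cadlag_paths)))
        * indicator {0..u} e)
      (measure (law x) (markov_event u y cadlag_paths) - exp (- l * u) * (indicator {y} x * 1))"
      using solves_renewal_law[OF cadlag_paths_sets, of y] \<open>0 \<le> u\<close> unfolding solves_renewal_def one by blast
    from has_bochner_integral_mult_left[OF this, of "measure (law y) B"]
    show "has_bochner_integral lborel
      (\<lambda>e. (l * exp (- l * e) * (\<Sum>z\<in>UNIV. pmf (K x) z *
        (measure (law z) (markov_event (u - e) y cadlag_paths) * measure (law y) B))) * indicator {0..u} e)
      (measure (law x) (markov_event u y cadlag_paths) * measure (law y) B -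
        exp (- l * u) * (indicator {y} x * measure (law y) B))"
      by (simp add: algebra_simps sum_distrib_left sum_distrib_right)
  qed
  then have "measure (law x) (markov_event u y B) =
      measure (law x) (markov_event u y cadlag_paths) * measure (law y) B"
  proof (rule solves_renewal_unique[OF solves_renewal_law[OF B, of y]])
    fix v w
    have "0 \<le> a \<Longrightarrow> a \<le> 1 \<Longrightarrow> 0 \<le> b \<Longrightarrow> b \<le> 1 \<Longrightarrow> \<bar>a - b\<bar> \<le> 1" for a b :: real by linarith
    then show "\<bar>measure (law w) (markov_event v y B) -
        measure (law w) (markov_event v y cadlag_paths) * measure (law y) B\<bar> \<le> 1"
      using L.prob_le_1 by (simp add: mult_le_one)
  qed (use u in auto)
  also have "markov_event u y cadlag_paths = state_event u y" by (rule markov_event_cadlag_paths[OF u])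
  finally show ?thesis .
qed

lemma law_start: "measure (law x) (state_event 0 x) = 1"
proof -
  have "jump_path x \<omega> \<in> state_event 0 x" for \<omega>
    by (simp add: state_event_def jump_path_0 jump_path_cadlag)
  then have "emeasure (law x) (state_event 0 x) = (\<integral>\<^sup>+\<omega>. 1 \<partial>source)"
    using state_event_sets[of 0 x] by (subst emeasure_law) auto
  then show ?thesis using source.emeasure_space_1 by (simp add: measure_def)
qed

end

section \<open>The matrix exponential\<close>

definition mat_pow :: "real ^ 'a ^ ('a::finite) \<Rightarrow> nat \<Rightarrow> real ^ 'a ^ 'a"
  where "mat_pow Q k = ((\<lambda>N. Q ** N) ^^ k) (mat 1)"

lemma mat_pow_0: "mat_pow Q 0 $ x $ y = (if x = y then 1 else 0)"
  by (simp add: mat_pow_def mat_def)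

lemma mat_pow_Suc: "mat_pow Q (Suc k) $ x $ y = (\<Sum>z\<in>UNIV. Q $ x $ z * mat_pow Q k $ z $ y)"
  by (simp add: mat_pow_def matrix_matrix_mult_def)

lemma mat_pow_scaleR: "mat_pow (u *\<^sub>R Q) k = u ^ k *\<^sub>R mat_pow Q k"
proof (induction k)
  case 0
  show ?case by (simp add: mat_pow_def)
next
  case (Suc k)
  then show ?case
    by (simp add: vec_eq_iff mat_pow_Suc sum_distrib_left algebra_simps)
qed

lemma mat_pow_bound:
  fixes Q :: "real ^ 'a ^ ('a::finite)"
  assumes b: "\<And>x y. \<bar>Q $ x $ y\<bar> \<le> b"
  shows "\<bar>mat_pow Q k $ x $ y\<bar> \<le> (real CARD('a) * b) ^ k"
proof (induction k arbitrary: x)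
  case 0
  show ?case by (simp add: mat_pow_0)
next
  case (Suc k)
  have b0: "0 \<le> b" using b[of undefined undefined] by linarith
  have "\<bar>mat_pow Q (Suc k) $ x $ y\<bar> \<le> (\<Sum>z\<in>UNIV. \<bar>Q $ x $ z * mat_pow Q k $ z $ y\<bar>)"
    unfolding mat_pow_Suc by (rule sum_abs)
  also have "\<dots> \<le> (\<Sum>z\<in>(UNIV::'a set). b * (real CARD('a) * b) ^ k)"
    using b Suc b0 by (intro sum_mono) (auto simp: abs_mult intro!: mult_mono)
  finally show ?case by simp
qed

lemma mat_pow_summable:
  fixes Q :: "real ^ 'a ^ ('a::finite)"
  shows "summable (\<lambda>k. mat_pow Q k $ x $ y / fact k * u ^ k)"
proof -
  define b where "b = (\<Sum>x\<in>UNIV. \<Sum>y\<in>UNIV. \<bar>Q $ x $ y\<bar>)"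
  have b: "\<bar>Q $ x $ y\<bar> \<le> b" for x y
  proof -
    have "\<bar>Q $ x $ y\<bar> \<le> (\<Sum>y\<in>UNIV. \<bar>Q $ x $ y\<bar>)" by (rule member_le_sum) auto
    also have "\<dots> \<le> b" unfolding b_def
      by (rule member_le_sum[of x UNIV "\<lambda>x. \<Sum>y\<in>UNIV. \<bar>Q $ x $ y\<bar>"]) (auto intro: sum_nonneg)
    finally show ?thesis .
  qed
  let ?c = "real CARD('a) * b * \<bar>u\<bar>"
  have "norm (mat_pow Q k $ x $ y / fact k * u ^ k) \<le> inverse (fact k) * ?c ^ k" for k
    using mult_right_mono[OF mat_pow_bound[OF b, of k x y], of "\<bar>u\<bar> ^ k / fact k"]
    by (simp add: abs_mult power_abs power_mult_distrib field_simps)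
  then show ?thesis
    by (intro summable_comparison_test'[OF summable_exp[of ?c]])
qed

text \<open>Reduces the matrix series to scalar power series in \<open>u\<close>, entry by entry, so
  that termwise differentiation applies.\<close>

lemma mat_exp_nth:
  "mat_exp (u *\<^sub>R Q) $ x $ y = (\<Sum>k. mat_pow Q k $ x $ y / fact k * u ^ k)"
proof -
  let ?f = "\<lambda>k. (1 / fact k) *\<^sub>R mat_pow (u *\<^sub>R Q) k"
  let ?S = "\<chi> x y. (\<Sum>k. mat_pow Q k $ x $ y / fact k * u ^ k)"
  have "?f sums ?S"
    unfolding sums_def
  proof (intro vec_tendstoI)
    fix x y
    have "(\<lambda>k. mat_pow Q k $ x $ y / fact k * u ^ k) sums (\<Sum>k. mat_pow Q k $ x $ y / fact k * u ^ k)"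
      by (rule summable_sums[OF mat_pow_summable])
    then show "(\<lambda>n. sum ?f {..<n} $ x $ y) \<longlonglongrightarrow> ?S $ x $ y"
      by (simp add: sums_def mat_pow_scaleR mult.commute)
  qed
  then have "mat_exp (u *\<^sub>R Q) = ?S"
    unfolding mat_exp_def mat_pow_def[symmetric] by (rule sums_unique[symmetric])
  then show ?thesis by simp
qed

lemma mat_exp_zero: "mat_exp (0 *\<^sub>R Q) $ x $ y = (if x = y then 1 else 0)"
  unfolding mat_exp_nth
  using suminf_finite[of "{0}" "\<lambda>k. mat_pow Q k $ x $ y / fact k * 0 ^ k"] by (simp add: mat_pow_0)

text \<open>The Kolmogorov backward equation, by termwise differentiation. \<open>Q\<close> appears
  on the left because the powers are built by multiplication from the left; this is the form that
  matches conditioning on the first jump.\<close>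

lemma mat_exp_deriv:
  "((\<lambda>u. mat_exp (u *\<^sub>R Q) $ x $ y) has_real_derivative
    (\<Sum>z\<in>UNIV. Q $ x $ z * mat_exp (u *\<^sub>R Q) $ z $ y)) (at u)"
proof -
  let ?c = "\<lambda>x k. mat_pow Q k $ x $ y / fact k"
  have "((\<lambda>u. \<Sum>k. ?c x k * u ^ k) has_real_derivative (\<Sum>k. diffs (?c x) k * u ^ k)) (at u)"
    by (rule termdiffs_strong_converges_everywhere[OF mat_pow_summable])
  moreover have "(\<Sum>k. diffs (?c x) k * u ^ k) = (\<Sum>z\<in>UNIV. Q $ x $ z * (\<Sum>k. ?c z k * u ^ k))"
  proof -
    have "diffs (?c x) k * u ^ k = (\<Sum>z\<in>UNIV. Q $ x $ z * (?c z k * u ^ k))" for k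
      by (simp add: diffs_def mat_pow_Suc sum_divide_distrib sum_distrib_left sum_distrib_right field_simps
          del: of_nat_Suc)
    moreover have "(\<Sum>k. \<Sum>z\<in>UNIV. Q $ x $ z * (?c z k * u ^ k)) = (\<Sum>z\<in>UNIV. \<Sum>k. Q $ x $ z * (?c z k * u ^ k))"
      by (intro suminf_sum summable_mult mat_pow_summable)
    ultimately show ?thesis
      by (simp add: suminf_mult[OF mat_pow_summable] del: times_divide_eq_left times_divide_eq_right)
  qed
  ultimately show ?thesis unfolding mat_exp_nth by simp
qed

section \<open>Existence of homogeneous Markov chains\<close>

lemma markov_law_exists:
  fixes Q :: "real ^ 'a ^ ('a::finite)"
  assumes Q: "rate_matrix Q"
  obtains \<mu> :: "'a \<Rightarrow> (real \<Rightarrow> 'a) measure"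
  where "\<And>x. prob_space (\<mu> x)"
    and "\<And>x. sets (\<mu> x) = sets path_space"
    and "\<And>x. measure (\<mu> x) (state_event 0 x) = 1"
    and "\<And>x y u B. B \<in> sets path_space \<Longrightarrow> 0 \<le> u \<Longrightarrow>
      measure (\<mu> x) (markov_event u y B) = measure (\<mu> x) (state_event u y) * measure (\<mu> y) B"
    and "\<And>x y t. 0 \<le> t \<Longrightarrow> measure (\<mu> x) (state_event t y) = mat_exp (t *\<^sub>R Q) $ x $ y"
proof -
  \<comment> \<open>The rate must dominate every exit rate \<open>- Q $ x $ x\<close>, so that the
    kernel \<open>I + Q / l\<close> is non-negative; the summand 1 keeps it positive even for
    \<open>Q = 0\<close>.\<close>
  define l where "l = 1 + (\<Sum>x\<in>UNIV. \<bar>Q $ x $ x\<bar>)"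
  have l_pos: "0 < l" unfolding l_def by (intro add_pos_nonneg sum_nonneg) auto
  have l_ge: "- Q $ x $ x \<le> l" for x
    using member_le_sum[of x UNIV "\<lambda>x. \<bar>Q $ x $ x\<bar>"] by (simp add: l_def)
  define k where "k x z = (if x = z then 1 else 0) + Q $ x $ z / l" for x z
  have k_nonneg: "0 \<le> k x z" for x z
    using Q l_ge[of x] l_pos by (auto simp: k_def rate_matrix_def field_simps)
  have k_sum: "(\<Sum>z\<in>UNIV. k x z) = 1" for x
    using Q by (simp add: k_def rate_matrix_def sum.distrib sum_divide_distrib[symmetric])
  define K where "K x = embed_pmf (k x)" for x
  have K: "pmf (K x) z = k x z" for x z
    unfolding K_def
    by (rule pmf_embed_pmf)
       (simp_all add: k_nonneg nn_integral_count_space_finite sum_ennreal k_sum)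
  interpret uniformization l K by unfold_locales (rule l_pos)
  have "measure (law x) (state_event u y) = mat_exp (u *\<^sub>R Q) $ x $ y" if u: "0 \<le> u" for u x y
  proof -
    interpret L: prob_space "law z" for z by (rule prob_law)
    let ?E = "\<lambda>u x. mat_exp (u *\<^sub>R Q) $ x $ y"
    have one: "measure (law z) cadlag_paths = 1" for z
      using L.prob_space[of z] by simp
    have sol1: "solves_renewal (\<lambda>x. indicator {y} x * 1) (\<lambda>u x. measure (law x) (markov_event u y cadlag_paths))"
      using solves_renewal_law[OF cadlag_paths_sets, of y] unfolding one .
    have cont: "isCont (\<lambda>u. ?E u x) u" for u x
      by (rule DERIV_isCont[OF mat_exp_deriv])
    have sol2: "solves_renewal (\<lambda>x. indicator {y} x * 1) ?E"
      unfolding solves_renewal_def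
    proof safe
      fix u :: real and x assume u: "0 \<le> u"
      \<comment> \<open>An antiderivative of the integrand: by the backward equation and
        \<open>Q = l * (K - I)\<close>, the terms containing \<open>?E (u - e) x\<close> combine
        into the kernel average \<open>kE\<close>.\<close>
      let ?F = "\<lambda>e. - exp (- l * e) * ?E (u - e) x"
      have kE: "l * (\<Sum>z\<in>UNIV. pmf (K x) z * ?E v z) = l * ?E v x + (\<Sum>z\<in>UNIV. Q $ x $ z * ?E v z)" for v
      proof -
        have "pmf (K x) z * ?E v z = (if x = z then ?E v z else 0) + Q $ x $ z * ?E v z / l" for z
          by (simp add: K k_def field_simps)
        then have "(\<Sum>z\<in>UNIV. pmf (K x) z * ?E v z) = ?E v x + (\<Sum>z\<in>UNIV. Q $ x $ z * ?E v z) / l"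
          by (simp add: sum.distrib sum_divide_distrib)
        then show ?thesis using l_pos by (simp add: field_simps)
      qed
      have "has_bochner_integral lborel
        (\<lambda>e. (l * exp (- l * e) * (\<Sum>z\<in>UNIV. pmf (K x) z * ?E (u - e) z)) * indicator {0..u} e)
        (?F u - ?F 0)"
      proof (rule has_bochner_integral_FTC_Icc_real[OF u])
        fix e
        have "((\<lambda>e. ?E (u - e) x) has_real_derivative (\<Sum>z\<in>UNIV. Q $ x $ z * ?E (u - e) z) * (- 1)) (at e)"
          by (rule DERIV_chain2[OF mat_exp_deriv]) (auto intro!: derivative_eq_intros)
        then have "(?F has_real_derivative exp (- l * e) * (l * ?E (u - e) x + (\<Sum>z\<in>UNIV. Q $ x $ z * ?E (u - e) z))) (at e)"
          by (auto intro!: derivative_eq_intros simp: algebra_simps)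
        then show "(?F has_real_derivative l * exp (- l * e) * (\<Sum>z\<in>UNIV. pmf (K x) z * ?E (u - e) z)) (at e)"
          unfolding kE[symmetric] by (simp add: algebra_simps)
        show "isCont (\<lambda>e. l * exp (- l * e) * (\<Sum>z\<in>UNIV. pmf (K x) z * ?E (u - e) z)) e"
          by (intro continuous_intros isCont_o2[OF _ cont])
      qed
      then show "has_bochner_integral lborel
        (\<lambda>e. (l * exp (- l * e) * (\<Sum>z\<in>UNIV. pmf (K x) z * ?E (u - e) z)) * indicator {0..u} e)
        (?E u x - exp (- l * u) * (indicator {y} x * 1))"
        by (cases "x = y") (simp_all add: mat_exp_zero[simplified])
    qed
    \<comment> \<open>Uniqueness asks for a bound on a compact time interval, which continuity
      provides.\<close>
    have "\<exists>C. \<forall>v\<in>{0..u}. \<forall>x. \<bar>?E v x\<bar> \<le> C"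
    proof -
      define S where "S v = (\<Sum>x\<in>UNIV. \<bar>?E v x\<bar>)" for v
      have "isCont S v" for v
        unfolding S_def by (intro continuous_intros cont)
      then have "compact (S ` {0..u})"
        by (intro compact_continuous_image continuous_at_imp_continuous_on) auto
      then have "\<exists>C. \<forall>z\<in>S ` {0..u}. \<bar>z\<bar> \<le> C"
        using compact_imp_bounded bounded_real by blast
      then obtain C where C: "\<And>v. v \<in> {0..u} \<Longrightarrow> \<bar>S v\<bar> \<le> C" by blast
      show ?thesis
      proof (intro exI ballI allI)
        fix v x assume v: "v \<in> {0..u}"
        have "\<bar>?E v x\<bar> \<le> S v" unfolding S_def by (rule member_le_sum) auto
        then show "\<bar>?E v x\<bar> \<le> C" using C[OF v] by linarith
      qed
    qed
    then obtain C where C: "\<And>v x. v \<in> {0..u} \<Longrightarrow> \<bar>?E v x\<bar> \<le> C" by blast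
    have "measure (law x) (markov_event u y cadlag_paths) = ?E u x"
    proof (rule solves_renewal_unique[OF sol1 sol2])
      fix v w assume "0 \<le> v" "v \<le> u"
      then have "\<bar>?E v w\<bar> \<le> C" using C by simp
      moreover have "\<bar>a - b\<bar> \<le> 1 + C" if "0 \<le> a" "a \<le> 1" "\<bar>b\<bar> \<le> C" for a b :: real
        using that by linarith
      ultimately show "\<bar>measure (law w) (markov_event v y cadlag_paths) - ?E v w\<bar> \<le> 1 + C"
        using L.prob_le_1 by simp
    qed (use u in auto)
    then show ?thesis unfolding markov_event_cadlag_paths[OF u] .
  qed
  from that[of law, OF prob_law sets_law law_start law_markov this] show ?thesis .
qed

section \<open>Realising a history by a step function\<close>

definition last_time :: "(real \<rightharpoonup> 'a) \<Rightarrow> real"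
  where "last_time h = (if dom h = {} then 0 else Max (dom h))"

text \<open>For the empty history \<open>last_time\<close> is 0 and this is \<open>the None\<close>,
  an unspecified but fixed state. It serves as the initial state of the unconditional measure, as
  initial distributions are unconstrained.\<close>

definition last_state :: "(real \<rightharpoonup> 'a) \<Rightarrow> 'a"
  where "last_state h = the (h (last_time h))"

text \<open>Before the first time of the history the set is empty and \<open>Max {}\<close>
  unspecified, but it does not depend on \<open>r\<close>; the function is constant there, which is
  all that a cadlag path requires.\<close>

definition interpolate :: "(real \<rightharpoonup> 'a) \<Rightarrow> real \<Rightarrow> 'a"
  where "interpolate h r = the (h (Max {t \<in> dom h. t \<le> r}))"

text \<open>
  A history is realised deterministically by a step function, also when it is impossible under the
  chain; the chain rule only involves the path from the last time of the history onwards.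
\<close>

definition append_path :: "(real \<rightharpoonup> 'a) \<Rightarrow> (real \<Rightarrow> 'a) \<Rightarrow> real \<Rightarrow> 'a"
  where "append_path h v =
    (\<lambda>r\<in>{0..}. if r < last_time h then interpolate h r else v (r - last_time h))"

lemma last_time_nonneg: "history h \<Longrightarrow> 0 \<le> last_time h"
  unfolding history_def last_time_def using Max_in[of "dom h"] by (auto simp del: Max_in dom_eq_empty_conv)

lemma last_time_upd:
  assumes "history h" "after h s"
  shows "last_time (h(s \<mapsto> y)) = s"
proof -
  have "Max (insert s (dom h)) = s"
    using assms unfolding history_def after_def by (intro Max_eqI) (blast intro: less_imp_le order_refl)+
  then show ?thesis by (simp add: last_time_def)
qed

lemma last_state_upd: "history h \<Longrightarrow> after h s \<Longrightarrow> last_state (h(s \<mapsto> y)) = y"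
  by (simp add: last_state_def last_time_upd)

lemma last_time_le: "history h \<Longrightarrow> after h s \<Longrightarrow> last_time h \<le> s"
  unfolding history_def after_def last_time_def using Max_in[of "dom h"]
  by (metis less_imp_le)

lemma history_upd: "history h \<Longrightarrow> after h s \<Longrightarrow> history (h(s \<mapsto> y))"
  by (auto simp: history_def after_def)

lemma history_empty: "history Map.empty" "0 \<le> s \<Longrightarrow> after Map.empty s"
  by (auto simp: history_def after_def)

text \<open>The prefix depends on \<open>r\<close> only through the finite set of history times up
  to \<open>r\<close>. Just to the right of \<open>t\<close> this set is that of the times up to
  \<open>t\<close>, just to the left that of the times strictly before \<open>t\<close>.\<close>

lemma append_path_cadlag:
  assumes h: "history h" and v: "v \<in> cadlag_paths"
  shows "append_path h v \<in> cadlag_paths"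
proof -
  let ?T = "last_time h" and ?w = "append_path h v"
  have T0: "0 \<le> ?T" by (rule last_time_nonneg[OF h])
  have fin: "finite (dom h)" using h by (simp add: history_def)
  have "eventually (\<lambda>s. ?w s = ?w t) (at_right t)" if t: "t \<ge> 0" for t
  proof (cases "t < ?T")
    case True
    have "eventually (\<lambda>r. t' \<le> r \<longleftrightarrow> t' \<le> t) (at_right t)" for t'
    proof (cases "t' \<le> t")
      case True
      then show ?thesis using eventually_at_right_less[of t] by (auto elim!: eventually_mono)
    next
      case False
      then show ?thesis using eventually_at_right_real[of t t'] by (auto elim!: eventually_mono)
    qed
    then have "eventually (\<lambda>r. \<forall>t'\<in>dom h. t' \<le> r \<longleftrightarrow> t' \<le> t) (at_right t)"
      using fin by (intro eventually_ball_finite) auto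
    then show ?thesis using eventually_at_right_real[OF True]
    proof eventually_elim
      case (elim r)
      then have "{t' \<in> dom h. t' \<le> r} = {t' \<in> dom h. t' \<le> t}" by blast
      then show ?case using elim t True by (simp add: append_path_def interpolate_def)
    qed
  next
    case False
    then have "eventually (\<lambda>s. v s = v (- ?T + t)) (at_right (- ?T + t))"
      using v by (auto simp: cadlag_paths_iff)
    from eventually_at_right_plus[OF this] eventually_at_right_less[of t]
    show ?thesis by eventually_elim (use t T0 False in \<open>auto simp: append_path_def\<close>)
  qed
  moreover have "\<exists>l. eventually (\<lambda>s. ?w s = l) (at_left t)" if t: "t > 0" for t
  proof (cases "t \<le> ?T")
    case True
    have "eventually (\<lambda>r. t' \<le> r \<longleftrightarrow> t' < t) (at_left t)" for t'
    proof (cases "t' < t")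
      case True
      then show ?thesis using eventually_at_left_real[OF True] by (auto elim!: eventually_mono)
    next
      case False
      then show ?thesis using eventually_at_left_real[OF t] by (auto elim!: eventually_mono)
    qed
    then have "eventually (\<lambda>r. \<forall>t'\<in>dom h. t' \<le> r \<longleftrightarrow> t' < t) (at_left t)"
      using fin by (intro eventually_ball_finite) auto
    then have "eventually (\<lambda>s. ?w s = the (h (Max {t' \<in> dom h. t' < t}))) (at_left t)"
      using eventually_at_left_real[OF t]
    proof eventually_elim
      case (elim r)
      then have "{t' \<in> dom h. t' \<le> r} = {t' \<in> dom h. t' < t}" by blast
      then show ?case using elim t True by (simp add: append_path_def interpolate_def)
    qed
    then show ?thesis ..
  next
    case False
    then have "0 < - ?T + t" by simp
    then obtain l where l: "eventually (\<lambda>s. v s = l) (at_left (- ?T + t))"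
      using v unfolding cadlag_paths_iff by blast
    have "?T < t" using False by simp
    from eventually_at_left_plus[OF l] eventually_at_left_real[OF this]
    have "eventually (\<lambda>s. ?w s = l) (at_left t)"
      by eventually_elim (use T0 in \<open>auto simp: append_path_def\<close>)
    then show ?thesis ..
  qed
  ultimately show ?thesis unfolding cadlag_paths_iff by (auto simp: append_path_def)
qed

lemma append_path_after:
  assumes "history h" "last_time h \<le> s"
  shows "append_path h v s = v (s - last_time h)"
  using assms last_time_nonneg[OF assms(1)] by (simp add: append_path_def)

lemma shift_append_path:
  assumes "history h" "last_time h \<le> s"
  shows "shift_path s (append_path h v) = shift_path (s - last_time h) v"
  using assms last_time_nonneg[OF assms(1)]
  by (auto simp: shift_path_def append_path_def fun_eq_iff algebra_simps)

lemma shift_path_0: "v \<in> cadlag_paths \<Longrightarrow> shift_path 0 v = v"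
  by (auto simp: shift_path_def cadlag_paths_def fun_eq_iff PiE_def extensional_def)

lemma append_path_history:
  assumes h: "history h" and v: "v \<in> cadlag_paths" and v0: "v 0 = last_state h"
  shows "append_path h v \<in> history_event h"
proof -
  have fin: "finite (dom h)" using h by (simp add: history_def)
  have "h t = Some (append_path h v t)" if t: "t \<in> dom h" for t
  proof (cases "t = last_time h")
    case True
    then show ?thesis using append_path_after[OF h, of t v] v0 t by (auto simp: last_state_def)
  next
    case False
    have "t \<le> last_time h" using t fin by (auto simp: last_time_def)
    moreover have "Max {t' \<in> dom h. t' \<le> t} = t" using t fin by (intro Max_eqI) auto
    ultimately show ?thesis using False t h
      by (auto simp: append_path_def interpolate_def history_def)
  qed
  then show ?thesis using append_path_cadlag[OF h v] by (simp add: history_event_def)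
qed

lemma measurable_append_path:
  assumes h: "history h"
  shows "append_path h \<in> measurable path_space path_space"
proof (rule measurable_path_spaceI)
  fix r :: real and x :: 'a assume r: "0 \<le> r"
  show "{v \<in> space path_space. append_path h v r = x} \<in> sets path_space"
  proof (cases "r < last_time h")
    case True
    then have "{v \<in> space path_space. append_path h v r = x} = (if interpolate h r = x then space path_space else {})"
      using r by (auto simp: append_path_def)
    then show ?thesis by (metis sets.top sets.empty_sets)
  next
    case False
    then have "{v \<in> space path_space. append_path h v r = x} = state_event (r - last_time h) x"
      using append_path_after[OF h, of r] by (auto simp: state_event_def)
    then show ?thesis using False by simp
  qed
qed (use append_path_cadlag h in auto)

lemma history_event_sets:
  assumes "history h"
  shows "history_event h \<in> sets path_space"
proof -
  have "history_event h = space path_space \<inter> (\<Inter>t\<in>dom h. state_event t (the (h t)))"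
    by (fastforce simp: history_event_def state_event_def dom_def)
  moreover have "space path_space \<inter> (\<Inter>t\<in>dom h. state_event t (the (h t))) \<in> sets path_space"
  proof (cases "dom h = {}")
    case True
    then show ?thesis using sets.top[of path_space] by simp
  next
    case False
    then show ?thesis using assms
      by (intro sets.Int sets.top sets.finite_INT) (auto simp: history_def intro!: state_event_sets)
  qed
  ultimately show ?thesis by simp
qed

text \<open>Conditionally on \<open>h\<close>, a fresh chain starts at \<open>last_time h\<close> in
  \<open>last_state h\<close>. Later transition probabilities depend on \<open>h\<close> only
  through these two values, which gives the Markov property and homogeneity; the chain rule reduces
  to the property \<open>markov\<close> at time \<open>s - last_time h\<close>.\<close>

lemma rate_matrix_process_exists:
  fixes Q :: "real ^ 'a ^ ('a::finite)"
  assumes Q: "rate_matrix Q"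
  obtains P :: "'a process"
  where "homogeneous_markov_chain P" "has_rate_matrix P Q"
proof -
  obtain \<mu> :: "'a \<Rightarrow> (real \<Rightarrow> 'a) measure"
    where prob: "\<And>x. prob_space (\<mu> x)"
    and sets: "\<And>x. sets (\<mu> x) = sets path_space"
    and start: "\<And>x. measure (\<mu> x) (state_event 0 x) = 1"
    and markov: "\<And>x y u B. B \<in> sets path_space \<Longrightarrow> 0 \<le> u \<Longrightarrow>
      measure (\<mu> x) (markov_event u y B) = measure (\<mu> x) (state_event u y) * measure (\<mu> y) B"
    and trans: "\<And>x y t. 0 \<le> t \<Longrightarrow> measure (\<mu> x) (state_event t y) = mat_exp (t *\<^sub>R Q) $ x $ y"
    by (rule markov_law_exists[OF Q]) (rule that, assumption+)
  define P where "P h = distr (\<mu> (last_state h)) path_space (append_path h)" for h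
  have space: "space (\<mu> x) = cadlag_paths" for x
    using sets_eq_imp_space_eq[OF sets[of x]] by simp
  have meas: "append_path h \<in> measurable (\<mu> x) path_space" if "history h" for h x
    using measurable_append_path[OF that] unfolding measurable_cong_sets[OF sets refl] .
  have P_eq: "measure (P h) E = measure (\<mu> (last_state h)) {v \<in> cadlag_paths. append_path h v \<in> E}"
    if "history h" "E \<in> sets path_space" for h E
  proof -
    have "append_path h -` E \<inter> space (\<mu> (last_state h)) = {v \<in> cadlag_paths. append_path h v \<in> E}"
      using space by auto
    then show ?thesis unfolding P_def using measure_distr[OF meas[OF that(1)] that(2)] by simp
  qed
  have P_state: "measure (P h) (state_event s y) = measure (\<mu> (last_state h)) (state_event (s - last_time h) y)"
    if "history h" "last_time h \<le> s" for h s y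
  proof -
    have "0 \<le> s" using last_time_nonneg[OF that(1)] that(2) by simp
    moreover have "{v \<in> cadlag_paths. append_path h v \<in> state_event s y} = state_event (s - last_time h) y"
      using append_path_after[OF that] append_path_cadlag[OF that(1)] by (auto simp: state_event_def)
    ultimately show ?thesis using P_eq[OF that(1), of "state_event s y"] by simp
  qed
  have "stochastic_process P"
    unfolding stochastic_process_def
  proof (intro allI impI conjI ballI)
    fix h :: "real \<rightharpoonup> 'a" assume h: "history h"
    interpret M: prob_space "\<mu> (last_state h)" by (rule prob)
    show pP: "prob_space (P h)" unfolding P_def by (rule M.prob_space_distr[OF meas[OF h]])
    show "space (P h) = space path_space" "sets (P h) = sets path_space" by (simp_all add: P_def)
    \<comment> \<open>The fresh chain starts in \<open>last_state h\<close> almost surely, and every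
      such start reproduces the whole history.\<close>
    have sub: "state_event 0 (last_state h) \<subseteq> {v \<in> cadlag_paths. append_path h v \<in> history_event h}"
      using append_path_history[OF h] by (auto simp: state_event_def)
    have "{v \<in> cadlag_paths. append_path h v \<in> history_event h} \<in> M.events"
      using measurable_sets[OF meas[OF h, of "last_state h"] history_event_sets[OF h]]
      by (simp add: space vimage_def Int_def conj_commute)
    then have "1 \<le> M.prob {v \<in> cadlag_paths. append_path h v \<in> history_event h}"
      using M.finite_measure_mono[OF sub] start by simp
    then show "measure (P h) (history_event h) = 1"
      unfolding P_eq[OF h history_event_sets[OF h]] using M.prob_le_1 by (meson antisym)
    fix s y and B :: "(real \<Rightarrow> 'a) set"
    assume s: "after h s" and B: "B \<in> sets (path_space_from s)"
    have s0: "0 \<le> s" using s by (simp add: after_def)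
    obtain B' where B': "B' \<in> sets path_space" "B = {v \<in> cadlag_paths. shift_path s v \<in> B'}"
      using sets_path_space_from_shift[OF B s0] by blast
    have T: "last_time h \<le> s" by (rule last_time_le[OF h s])
    have Bs: "B \<in> sets path_space" using B sets_path_space_from_subset[OF s0] by blast
    \<comment> \<open>Neither \<open>B\<close> nor the state at \<open>s\<close> sees the
      deterministic prefix, so the event pulls back to a \<open>markov_event\<close> of the fresh
      chain.\<close>
    have "{v \<in> cadlag_paths. append_path h v \<in> B \<inter> state_event s y} = markov_event (s - last_time h) y B'"
      using append_path_after[OF h T] shift_append_path[OF h T] append_path_cadlag[OF h]
      by (auto simp: B'(2) state_event_def markov_event_def)
    then have "measure (P h) (B \<inter> state_event s y) =
        measure (P h) (state_event s y) * measure (\<mu> y) B'"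
      using P_eq[OF h, of "B \<inter> state_event s y"] Bs s0 markov[OF B'(1), of "s - last_time h"] T
        P_state[OF h T] by simp
    moreover have "measure (P (h(s \<mapsto> y))) B = measure (\<mu> y) B'"
    proof -
      note h' = history_upd[OF h s, of y]
      have "B' \<subseteq> cadlag_paths" using sets.sets_into_space[OF B'(1)] by simp
      then have "{v \<in> cadlag_paths. append_path (h(s \<mapsto> y)) v \<in> B} = B'"
        using append_path_cadlag[OF h'] shift_append_path[OF h', of s]
        by (auto simp: B'(2) last_time_upd[OF h s] shift_path_0)
      then show ?thesis using P_eq[OF h' Bs] last_state_upd[OF h s] by simp
    qed
    ultimately show "measure (P h) (B \<inter> state_event s y) =
        measure (P (h(s \<mapsto> y))) B * measure (P h) (state_event s y)" by simp
  qed
  moreover have upd: "measure (P (h(t \<mapsto> x))) (state_event s y) = measure (\<mu> x) (state_event (s - t) y)"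
    if "history h" "after h t" "t \<le> s" for h t x s y
    using P_state[OF history_upd[OF that(1,2)], of x s y] that
    by (simp add: last_time_upd last_state_upd)
  moreover have "measure (P [t \<mapsto> x]) (state_event s y) = measure (\<mu> x) (state_event (s - t) y)"
    if "0 \<le> t" "t \<le> s" for t x s y
    using upd[OF history_empty that(2)] that(1) by simp
  ultimately have "homogeneous_markov_chain P"
    unfolding homogeneous_markov_chain_def markov_chain_def
    by (simp add: after_def)
  moreover have "has_rate_matrix P Q"
    using Q upd[OF history_empty] trans by (simp add: has_rate_matrix_def)
  ultimately show ?thesis by (rule that)
qed

section \<open>Consistency\<close>

text \<open>Continuous induction with a small slope \<epsilon> conceded. The set \<open>S\<close> of
  times at which the conceded bound holds is closed, so it contains its supremum; if that were below
  \<open>b\<close>, the bound on right increments would put a later time into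
  \<open>S\<close>.\<close>

lemma dini_nonincreasing:
  fixes \<phi> :: "real \<Rightarrow> real"
  assumes ab: "a \<le> b" and cont: "continuous_on {a..b} \<phi>"
    and dini: "\<And>t \<epsilon>. a \<le> t \<Longrightarrow> t < b \<Longrightarrow> 0 < \<epsilon> \<Longrightarrow>
      eventually (\<lambda>s. \<phi> s - \<phi> t \<le> \<epsilon> * (s - t)) (at_right t)"
  shows "\<phi> b \<le> \<phi> a"
proof (rule field_le_epsilon)
  fix e :: real assume e: "0 < e"
  \<comment> \<open>The concession over the whole interval is then at most \<open>e\<close>; the
    summand 1 covers \<open>a = b\<close>.\<close>
  define \<epsilon> where "\<epsilon> = e / (b - a + 1)"
  have \<epsilon>: "0 < \<epsilon>" using e ab by (simp add: \<epsilon>_def)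
  define S where "S = {t \<in> {a..b}. \<phi> t \<le> \<phi> a + \<epsilon> * (t - a)}"
  have "closed S"
    unfolding S_def by (intro continuous_on_closed_Collect_le cont continuous_intros closed_atLeastAtMost)
  moreover have "a \<in> S" using ab by (simp add: S_def)
  moreover have bdd: "bdd_above S" by (rule bdd_aboveI[of _ b]) (auto simp: S_def)
  ultimately have S: "Sup S \<in> S" by (intro closed_contains_Sup) auto
  have "Sup S = b"
  proof (rule ccontr)
    assume "Sup S \<noteq> b"
    with S have lt: "a \<le> Sup S" "Sup S < b" by (auto simp: S_def)
    have "eventually (\<lambda>s. Sup S < s \<and> s < b \<and> \<phi> s - \<phi> (Sup S) \<le> \<epsilon> * (s - Sup S)) (at_right (Sup S))"
      using dini[OF lt \<epsilon>] eventually_at_right_real[OF lt(2)] by eventually_elim auto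
    from eventually_happens[OF this]
    obtain s where s: "Sup S < s" "s < b" "\<phi> s - \<phi> (Sup S) \<le> \<epsilon> * (s - Sup S)"
      by auto
    then have "s \<in> S" using S lt by (auto simp: S_def algebra_simps)
    from cSup_upper[OF this bdd] show False using s(1) by simp
  qed
  with S have "\<phi> b \<le> \<phi> a + \<epsilon> * (b - a)" by (simp add: S_def)
  also have "\<epsilon> * (b - a) \<le> e"
  proof -
    have "e * (b - a) \<le> e * (b - a + 1)" using e by simp
    then show ?thesis using ab by (simp add: \<epsilon>_def divide_le_eq)
  qed
  finally show "\<phi> b \<le> \<phi> a + e" by simp
qed

section \<open>Operator norm bounds, entrywise bounds and limit points of quotients\<close>

lemma infnorm_le_iff: "infnorm (f :: real ^ 'a::finite) \<le> c \<longleftrightarrow> (\<forall>i. \<bar>f $ i\<bar> \<le> c)"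
proof
  assume "infnorm f \<le> c"
  then show "\<forall>i. \<bar>f $ i\<bar> \<le> c" using component_le_infnorm_cart order_trans by blast
next
  assume "\<forall>i. \<bar>f $ i\<bar> \<le> c"
  then show "infnorm f \<le> c" unfolding infnorm_cart by (intro cSup_least) auto
qed

lemma infnorm_axis: "infnorm (axis y 1 :: real ^ 'a::finite) = 1"
proof (rule antisym)
  show "infnorm (axis y 1 :: real ^ 'a) \<le> 1" by (simp add: infnorm_le_iff axis_def)
  show "1 \<le> infnorm (axis y 1 :: real ^ 'a)"
    using component_le_infnorm_cart[of "axis y 1 :: real ^ 'a" y] by (simp add: axis_def)
qed

lemma matrix_entry_le_op_norm: "ennreal \<bar>M $ x $ y\<bar> \<le> op_norm (\<lambda>f. M *v f)"
proof -
  have "\<bar>M $ x $ y\<bar> \<le> infnorm (M *v axis y 1)"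
    using component_le_infnorm_cart[of "M *v axis y 1" x]
    by (simp add: matrix_vector_mult_basis column_def)
  moreover have "ennreal (infnorm (M *v axis y 1)) \<le> op_norm (\<lambda>f. M *v f)"
    unfolding op_norm_def by (rule SUP_upper) (simp add: infnorm_axis)
  ultimately show ?thesis by (meson ennreal_leI order_trans)
qed

lemma op_norm_matrix_le:
  fixes M :: "real ^ 'a ^ ('a::finite)"
  assumes "\<And>x y. \<bar>M $ x $ y\<bar> \<le> b"
  shows "op_norm (\<lambda>f. M *v f) \<le> ennreal (real CARD('a) * b)"
  unfolding op_norm_def
proof (rule SUP_least)
  fix f :: "real ^ 'a" assume "f \<in> {f. infnorm f = 1}"
  then have f: "\<bar>f $ y\<bar> \<le> 1" for y using component_le_infnorm_cart[of f y] by simp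
  have b: "0 \<le> b" using assms[of undefined undefined] by linarith
  have "\<bar>(M *v f) $ x\<bar> \<le> real CARD('a) * b" for x
  proof -
    have "\<bar>(M *v f) $ x\<bar> \<le> (\<Sum>y\<in>UNIV. \<bar>M $ x $ y * f $ y\<bar>)"
      unfolding matrix_vector_mult_def by simp
    also have "\<dots> \<le> (\<Sum>y\<in>(UNIV::'a set). b * 1)"
      unfolding abs_mult using assms f b by (intro sum_mono mult_mono) auto
    finally show ?thesis by simp
  qed
  then have "infnorm (M *v f) \<le> real CARD('a) * b" by (simp add: infnorm_le_iff)
  then show "ennreal (infnorm (M *v f)) \<le> ennreal (real CARD('a) * b)" by (rule ennreal_leI)
qed

lemma derivative_consistent_mono:
  "derivative_consistent \<Q> D \<Longrightarrow> \<Q> \<subseteq> \<Q>' \<Longrightarrow> derivative_consistent \<Q>' D"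
  unfolding derivative_consistent_def by blast

lemma derivative_consistent_bounded:
  assumes "derivative_consistent \<Q> D"
  obtains C where "0 \<le> C" "eventually (\<lambda>\<Delta>. \<forall>x y. \<bar>D \<Delta> $ x $ y\<bar> \<le> C) (at_right 0)"
proof -
  have "Limsup (at_right 0) (\<lambda>\<Delta>. op_norm (\<lambda>f. D \<Delta> *v f)) < \<infinity>"
    using assms by (simp add: derivative_consistent_def)
  then obtain c where c: "Limsup (at_right 0) (\<lambda>\<Delta>. op_norm (\<lambda>f. D \<Delta> *v f)) < c" "c < \<infinity>"
    using dense by blast
  then obtain C where C: "c = ennreal C" "0 \<le> C" by (cases c) auto
  have "eventually (\<lambda>\<Delta>. op_norm (\<lambda>f. D \<Delta> *v f) < c) (at_right 0)"
    by (rule Limsup_lessD[OF c(1)])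
  then have "eventually (\<lambda>\<Delta>. \<forall>x y. \<bar>D \<Delta> $ x $ y\<bar> \<le> C) (at_right 0)"
  proof eventually_elim
    case (elim \<Delta>)
    have "ennreal \<bar>D \<Delta> $ x $ y\<bar> \<le> ennreal C" for x y
      using order_trans[OF matrix_entry_le_op_norm less_imp_le[OF elim]] by (simp add: C)
    then show ?case using C(2) by (simp add: ennreal_le_iff)
  qed
  then show ?thesis using that C(2) by blast
qed

text \<open>Turns information on limit points into an eventual bound, by compactness. If the bound
  failed along a sequence, boundedness of the quotients would yield a convergent subsequence; its
  limit lies in \<open>\<Q>\<close> by consistency, yet its value at \<open>x\<close> would be at
  least \<open>c + \<epsilon>\<close>.\<close>

lemma derivative_consistent_upper:
  assumes dc: "derivative_consistent \<Q> D"
    and le: "\<And>Q. Q \<in> \<Q> \<Longrightarrow> (Q *v f) $ x \<le> c" and \<epsilon>: "0 < \<epsilon>"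
  shows "eventually (\<lambda>\<Delta>. (D \<Delta> *v f) $ x \<le> c + \<epsilon>) (at_right 0)"
proof (rule sequentially_imp_eventually_at_right[of 0 1])
  fix \<delta> :: "nat \<Rightarrow> real"
  assume \<delta>: "\<And>n. 0 < \<delta> n" "\<delta> \<longlonglongrightarrow> 0"
  have lim: "filterlim \<delta> (at_right 0) sequentially"
    using \<delta> by (simp add: filterlim_at less_imp_neq[THEN not_sym])
  show "eventually (\<lambda>n. (D (\<delta> n) *v f) $ x \<le> c + \<epsilon>) sequentially"
  proof (rule ccontr)
    assume neg: "\<not> eventually (\<lambda>n. (D (\<delta> n) *v f) $ x \<le> c + \<epsilon>) sequentially"
    obtain C where C: "eventually (\<lambda>\<Delta>. \<forall>x y. \<bar>D \<Delta> $ x $ y\<bar> \<le> C) (at_right 0)"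
      using derivative_consistent_bounded[OF dc] .
    have evC: "eventually (\<lambda>n. \<forall>x y. \<bar>D (\<delta> n) $ x $ y\<bar> \<le> C) sequentially"
      by (rule eventually_compose_filterlim[OF C lim])
    have "frequently (\<lambda>n. c + \<epsilon> < (D (\<delta> n) *v f) $ x) sequentially"
      using neg by (simp add: not_eventually not_le)
    then have "frequently (\<lambda>n. c + \<epsilon> < (D (\<delta> n) *v f) $ x \<and> (\<forall>x y. \<bar>D (\<delta> n) $ x $ y\<bar> \<le> C)) sequentially"
      using evC by (rule frequently_eventually_frequently)
    then have "infinite {n. c + \<epsilon> < (D (\<delta> n) *v f) $ x \<and> (\<forall>x y. \<bar>D (\<delta> n) $ x $ y\<bar> \<le> C)}"
      by (simp add: frequently_cofinite[symmetric] cofinite_eq_sequentially)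
    from infinite_enumerate[OF this] obtain r :: "nat \<Rightarrow> nat" where r0: "strict_mono r"
      "\<forall>n. r n \<in> {n. c + \<epsilon> < (D (\<delta> n) *v f) $ x \<and> (\<forall>x y. \<bar>D (\<delta> n) $ x $ y\<bar> \<le> C)}"
      by (elim exE conjE)
    then have r: "strict_mono r"
      "\<And>n. c + \<epsilon> < (D (\<delta> (r n)) *v f) $ x" "\<And>n x y. \<bar>D (\<delta> (r n)) $ x $ y\<bar> \<le> C"
      by simp_all
    have "bounded (range (\<lambda>n. D (\<delta> (r n))))"
    proof (rule boundedI)
      fix M assume "M \<in> range (\<lambda>n. D (\<delta> (r n)))"
      then have M: "\<bar>M $ x $ y\<bar> \<le> C" for x y using r(3) by auto
      have "norm M \<le> (\<Sum>x\<in>UNIV. norm (M $ x))" by (simp add: norm_vec_def L2_set_le_sum)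
      also have "\<dots> \<le> (\<Sum>x\<in>(UNIV::'a set). \<Sum>y\<in>(UNIV::'a set). C)"
      proof (rule sum_mono)
        fix x
        have "norm (M $ x) \<le> (\<Sum>y\<in>UNIV. norm (M $ x $ y))" by (simp add: norm_vec_def L2_set_le_sum)
        also have "\<dots> \<le> (\<Sum>y\<in>(UNIV::'a set). C)" using M by (intro sum_mono) simp
        finally show "norm (M $ x) \<le> (\<Sum>y\<in>(UNIV::'a set). C)" .
      qed
      finally show "norm M \<le> (\<Sum>x\<in>(UNIV::'a set). \<Sum>y\<in>(UNIV::'a set). C)" .
    qed
    then obtain L s where s: "strict_mono (s :: nat \<Rightarrow> nat)" and L: "(\<lambda>n. D (\<delta> (r (s n)))) \<longlonglongrightarrow> L"
      using bounded_imp_convergent_subsequence[of "\<lambda>n. D (\<delta> (r n))"] by (auto simp: o_def)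
    have "filterlim (\<lambda>n. \<delta> (r (s n))) (at_right 0) sequentially"
      using filterlim_compose[OF lim filterlim_subseq[OF strict_mono_o[OF r(1) s]]] by (simp add: o_def)
    then have "L \<in> \<Q>" using dc L unfolding derivative_consistent_def by blast
    then have "(L *v f) $ x \<le> c" by (rule le)
    moreover have "c + \<epsilon> \<le> (L *v f) $ x"
    proof (rule LIMSEQ_le_const)
      show "(\<lambda>n. (D (\<delta> (r (s n))) *v f) $ x) \<longlonglongrightarrow> (L *v f) $ x"
        unfolding matrix_vector_mult_def vec_lambda_beta
        by (intro tendsto_intros tendsto_vec_nth L)
    qed (use r(2) in \<open>auto intro: less_imp_le\<close>)
    ultimately show False using \<epsilon> by simp
  qed
qed simp

text \<open>Convergence yields both clauses at once: a bound near 0 and a single possible limit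
  point.\<close>

lemma derivative_consistent_singleton:
  assumes lim: "(D \<longlongrightarrow> Q) (at_right 0)"
  shows "derivative_consistent {Q} D"
proof -
  define b where "b = (\<Sum>x\<in>UNIV. \<Sum>y\<in>UNIV. \<bar>Q $ x $ y\<bar>) + 1"
  have ev: "eventually (\<lambda>\<Delta>. \<forall>x y. \<bar>D \<Delta> $ x $ y\<bar> \<le> b) (at_right 0)"
  proof (intro eventually_all_finite)
    fix x y
    have "((\<lambda>\<Delta>. \<bar>D \<Delta> $ x $ y\<bar>) \<longlongrightarrow> \<bar>Q $ x $ y\<bar>) (at_right 0)"
      by (intro tendsto_intros tendsto_vec_nth lim)
    moreover have "\<bar>Q $ x $ y\<bar> < b"
    proof -
      have "\<bar>Q $ x $ y\<bar> \<le> (\<Sum>y\<in>UNIV. \<bar>Q $ x $ y\<bar>)" by (rule member_le_sum) auto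
      also have "\<dots> \<le> (\<Sum>x\<in>UNIV. \<Sum>y\<in>UNIV. \<bar>Q $ x $ y\<bar>)"
        by (rule member_le_sum[of x UNIV "\<lambda>x. \<Sum>y\<in>UNIV. \<bar>Q $ x $ y\<bar>"]) (auto intro: sum_nonneg)
      finally show ?thesis by (simp add: b_def)
    qed
    ultimately have "eventually (\<lambda>\<Delta>. \<bar>D \<Delta> $ x $ y\<bar> < b) (at_right 0)" by (rule order_tendstoD)
    then show "eventually (\<lambda>\<Delta>. \<bar>D \<Delta> $ x $ y\<bar> \<le> b) (at_right 0)" by eventually_elim simp
  qed
  have "Limsup (at_right 0) (\<lambda>\<Delta>. op_norm (\<lambda>f. D \<Delta> *v f)) \<le> ennreal (real CARD('a) * b)"
    by (rule Limsup_bounded) (use ev in \<open>eventually_elim, auto intro: op_norm_matrix_le\<close>)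
  also have "\<dots> < \<infinity>" by simp
  finally have "Limsup (at_right 0) (\<lambda>\<Delta>. op_norm (\<lambda>f. D \<Delta> *v f)) < \<infinity>" .
  moreover have "L = Q" if "filterlim \<delta> (at_right 0) sequentially" "(\<lambda>i. D (\<delta> i)) \<longlonglongrightarrow> L" for \<delta> L
    by (rule LIMSEQ_unique[OF that(2) filterlim_compose[OF lim that(1)]])
  ultimately show ?thesis unfolding derivative_consistent_def by blast
qed

section \<open>Homogeneous chains are consistent\<close>

lemma mat_exp_quotient_tendsto:
  "((\<lambda>\<Delta>. (1 / \<Delta>) *\<^sub>R (mat_exp (\<Delta> *\<^sub>R Q) - mat 1)) \<longlongrightarrow> Q) (at_right 0)"
proof (intro vec_tendstoI)
  fix x y
  have "((\<lambda>u. mat_exp (u *\<^sub>R Q) $ x $ y) has_real_derivative Q $ x $ y) (at 0)"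
    using mat_exp_deriv[of Q x y 0]
    by (simp add: mat_exp_zero[simplified] if_distrib[of "\<lambda>a. _ * a"] cong: if_cong)
  then have "((\<lambda>u. (mat_exp (u *\<^sub>R Q) $ x $ y - mat_exp (0 *\<^sub>R Q) $ x $ y) / (u - 0)) \<longlongrightarrow> Q $ x $ y) (at 0)"
    by (simp add: has_field_derivative_iff)
  then have "((\<lambda>u. (mat_exp (u *\<^sub>R Q) $ x $ y - mat_exp (0 *\<^sub>R Q) $ x $ y) / (u - 0)) \<longlongrightarrow> Q $ x $ y) (at_right 0)"
    by (rule tendsto_within_subset) simp
  then show "((\<lambda>\<Delta>. ((1 / \<Delta>) *\<^sub>R (mat_exp (\<Delta> *\<^sub>R Q) - mat 1)) $ x $ y) \<longlongrightarrow> Q $ x $ y) (at_right 0)"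
    unfolding mat_exp_zero by (simp add: mat_def)
qed

lemma homogeneous_trans_matrix:
  assumes P: "homogeneous_markov_chain P" "has_rate_matrix P Q"
    and h: "history h" "after h t" "t \<le> s"
  shows "trans_matrix P h t s = mat_exp ((s - t) *\<^sub>R Q)"
proof -
  have t: "0 \<le> t" using h by (simp add: after_def)
  have "measure (P (h(t \<mapsto> x))) (state_event s y) = mat_exp ((s - t) *\<^sub>R Q) $ x $ y" for x y
  proof -
    have "measure (P (h(t \<mapsto> x))) (state_event s y) = measure (P [t \<mapsto> x]) (state_event s y)"
      using P(1) h unfolding homogeneous_markov_chain_def markov_chain_def by blast
    also have "\<dots> = measure (P [0 \<mapsto> x]) (state_event (s - t) y)"
      using P(1) h(3) t unfolding homogeneous_markov_chain_def by blast
    also have "\<dots> = mat_exp ((s - t) *\<^sub>R Q) $ x $ y"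
      using P(2) h(3) unfolding has_rate_matrix_def by simp
    finally show ?thesis .
  qed
  then show ?thesis by (simp add: trans_matrix_def vec_eq_iff)
qed

text \<open>The singleton form is used twice: enlarged by \<open>consistent_mono\<close> it yields
  the inclusion of \<open>imprecise_HM\<close> in \<open>imprecise_M\<close>, and as it stands it
  permits hitting time bounds that test a single matrix.\<close>

lemma homogeneous_consistent:
  fixes P :: "('a::finite) process"
  assumes P: "homogeneous_markov_chain P" "has_rate_matrix P Q"
  shows "consistent {Q} P"
  unfolding consistent_def
proof (intro allI impI)
  fix h :: "real \<rightharpoonup> 'a" and t assume "history h \<and> after h t"
  then have h: "history h" "after h t" by simp_all
  let ?q = "\<lambda>\<Delta>. (1 / \<Delta>) *\<^sub>R (mat_exp (\<Delta> *\<^sub>R Q) - mat 1)"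
  have fwd: "derivative_consistent {Q} (forward_quotient P h t)"
  proof (intro derivative_consistent_singleton Lim_transform_eventually[OF mat_exp_quotient_tendsto])
    show "eventually (\<lambda>\<Delta>. ?q \<Delta> = forward_quotient P h t \<Delta>) (at_right 0)"
      using eventually_at_right_less[of 0]
      by eventually_elim (simp add: forward_quotient_def homogeneous_trans_matrix[OF P h])
  qed
  have bwd: "derivative_consistent {Q} (backward_quotient P h t)" if t: "0 < t"
  proof (intro derivative_consistent_singleton Lim_transform_eventually[OF mat_exp_quotient_tendsto])
    have fin: "finite (dom h)" using h(1) by (simp add: history_def)
    have ev: "eventually (\<lambda>\<Delta>. r < t - \<Delta>) (at_right 0)" if "r < t" for r
    proof -
      have "0 < t - r" using that by simp
      from eventually_at_right_real[OF this] show ?thesis by eventually_elim auto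
    qed
    \<comment> \<open>The backward quotient starts at \<open>t - \<Delta>\<close>, which must still
      lie beyond the history; this holds for small \<Delta>, as the history is finite.\<close>
    have "eventually (\<lambda>\<Delta>. 0 < t - \<Delta> \<and> (\<forall>r\<in>dom h. r < t - \<Delta>)) (at_right 0)"
      using h(2) t fin by (intro eventually_conj eventually_ball_finite ballI ev) (simp_all add: after_def)
    then show "eventually (\<lambda>\<Delta>. ?q \<Delta> = backward_quotient P h t \<Delta>) (at_right 0)"
      using eventually_at_right_less[of 0]
    proof eventually_elim
      case (elim \<Delta>)
      then have "after h (t - \<Delta>)" unfolding after_def by (simp add: less_imp_le)
      from homogeneous_trans_matrix[OF P h(1) this, of t] elim
      show ?case by (simp add: backward_quotient_def)
    qed
  qed
  show "derivative_consistent {Q} (forward_quotient P h t) \<and>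
      (0 < t \<longrightarrow> derivative_consistent {Q} (backward_quotient P h t))"
    using fwd bwd by blast
qed

lemma consistent_mono: "consistent \<Q> P \<Longrightarrow> \<Q> \<subseteq> \<Q>' \<Longrightarrow> consistent \<Q>' P"
  unfolding consistent_def using derivative_consistent_mono[of \<Q> _ \<Q>'] by blast

lemma imprecise_HM_subset_M: "imprecise_HM \<Q> \<subseteq> imprecise_M \<Q>"
proof
  fix P assume "P \<in> imprecise_HM \<Q>"
  then obtain Q where P: "homogeneous_markov_chain P" "has_rate_matrix P Q" and Q: "{Q} \<subseteq> \<Q>"
    by (auto simp: imprecise_HM_def)
  from consistent_mono[OF homogeneous_consistent[OF P] Q] P(1)
  show "P \<in> imprecise_M \<Q>"
    unfolding imprecise_M_def homogeneous_markov_chain_def by blast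
qed

lemma imprecise_M_subset_I: "imprecise_M \<Q> \<subseteq> imprecise_I \<Q>"
  by (auto simp: imprecise_M_def imprecise_I_def markov_chain_def)

section \<open>Evolution of means along a consistent process\<close>

text \<open>The expectation of \<open>f\<close> at the state at time \<open>s\<close>, written as a
  finite sum so that transition matrices act on it algebraically.\<close>

definition mean_at :: "(real \<Rightarrow> 'a::finite) measure \<Rightarrow> real ^ 'a \<Rightarrow> real \<Rightarrow> real"
  where "mean_at M f s = (\<Sum>z\<in>UNIV. measure M (state_event s z) * f $ z)"

lemma mean_at_uminus: "mean_at M (- f) s = - mean_at M f s"
  by (simp add: mean_at_def sum_negf)

lemma sum_measure_state_event:
  assumes "prob_space M" "sets M = sets path_space" "0 \<le> s"
    and B: "B \<in> sets path_space"
  shows "(\<Sum>z\<in>UNIV. measure M (B \<inter> state_event s z)) = measure M B"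
proof -
  interpret prob_space M by fact
  have "measure M (\<Union>z. B \<inter> state_event s z) = (\<Sum>z\<in>UNIV. measure M (B \<inter> state_event s z))"
  proof (intro finite_measure_finite_Union)
    show "(\<lambda>z. B \<inter> state_event s z) ` UNIV \<subseteq> events"
      using B assms(2,3) by (simp add: image_subset_iff sets.Int)
    show "disjoint_family (\<lambda>z. B \<inter> state_event s z)"
      by (auto simp: disjoint_family_on_def state_event_def)
  qed simp
  moreover have "(\<Union>z. B \<inter> state_event s z) = B"
    using sets.sets_into_space[OF B] by (auto simp: state_event_def)
  ultimately show ?thesis by simp
qed

text \<open>The start after an arbitrary history, rather than at time 0, matters for absorption: it
  is applied again after conditioning on a later visit to \<open>A\<close>.\<close>

locale process_from =
  fixes P :: "('a::finite) process" and \<Q> :: "(real ^ 'a ^ 'a) set"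
    and h0 :: "real \<rightharpoonup> 'a" and r :: real and x :: 'a
  assumes proc: "stochastic_process P" and cons: "consistent \<Q> P"
    and h0: "history h0" and r: "after h0 r"
begin

abbreviation h :: "real \<rightharpoonup> 'a" where "h \<equiv> h0(r \<mapsto> x)"

abbreviation p :: "real \<Rightarrow> 'a \<Rightarrow> real" where "p s z \<equiv> measure (P h) (state_event s z)"

lemma r0: "0 \<le> r" using r by (simp add: after_def)

lemma hist: "history h" using h0 r by (auto simp: history_def after_def)

lemma after_h: "r < s \<Longrightarrow> after h s"
  using r by (simp add: after_def) (use less_trans in blast)

lemma processD:
  assumes "history g"
  shows "prob_space (P g)" "sets (P g) = sets path_space" "measure (P g) (history_event g) = 1"
    and "after g s \<Longrightarrow> B \<in> sets (path_space_from s) \<Longrightarrow>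
      measure (P g) (B \<inter> state_event s y) = measure (P (g(s \<mapsto> y))) B * measure (P g) (state_event s y)"
  using proc assms unfolding stochastic_process_def by blast+

sublocale prob_space "P h" by (rule processD(1)[OF hist])

lemma events_eq: "events = sets path_space" by (rule processD(2)[OF hist])

lemma sum_p: "0 \<le> s \<Longrightarrow> (\<Sum>z\<in>UNIV. p s z) = 1"
proof -
  assume s: "0 \<le> s"
  have "(\<Sum>z\<in>UNIV. prob (cadlag_paths \<inter> state_event s z)) = prob cadlag_paths"
    using sum_measure_state_event[OF prob_space_axioms events_eq s, of cadlag_paths]
      sets.top[of path_space] by simp
  moreover have "cadlag_paths \<inter> state_event s z = state_event s z" for z :: 'a
    by (auto simp: state_event_def)
  moreover have "prob cadlag_paths = 1"
    using prob_space sets_eq_imp_space_eq[OF events_eq] by simp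
  ultimately show ?thesis by simp
qed

lemma p_start: "p r z = (if z = x then 1 else 0)"
proof -
  have sub: "history_event h \<subseteq> state_event r x"
    by (auto simp: history_event_def state_event_def)
  have ev: "state_event r z \<in> events" for z using r0 by (simp add: events_eq)
  have 1: "p r x = 1"
    using finite_measure_mono[OF sub ev] processD(3)[OF hist] prob_le_1[of "state_event r x"] by simp
  show ?thesis
  proof (cases "z = x")
    case False
    have "p r x + p r z = prob (state_event r x \<union> state_event r z)"
      using False ev by (intro finite_measure_Union[symmetric]) (auto simp: state_event_def)
    then have "p r z \<le> 0" using 1 prob_le_1[of "state_event r x \<union> state_event r z"] by linarith
    then show ?thesis using False measure_nonneg[of "P h" "state_event r z"] by simp
  qed (use 1 in simp)
qed

lemma chapman_kolmogorov:
  assumes "r < s" "s \<le> s'"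
  shows "p s' z = (\<Sum>w\<in>UNIV. p s w * trans_matrix P h s s' $ w $ z)"
proof -
  have s: "0 \<le> s" "0 \<le> s'" using assms r0 by auto
  have "p s' z = (\<Sum>w\<in>UNIV. prob (state_event s' z \<inter> state_event s w))"
    using sum_measure_state_event[OF prob_space_axioms events_eq s(1), of "state_event s' z"] s by simp
  also have "\<dots> = (\<Sum>w\<in>UNIV. p s w * trans_matrix P h s s' $ w $ z)"
    using processD(4)[OF hist after_h[OF assms(1)] state_event_sets_from[OF assms(2)]]
    by (simp add: trans_matrix_def mult.commute)
  finally show ?thesis .
qed

text \<open>For \<open>r < s\<close> the chain rule applies with the history \<open>h\<close>
  itself. At \<open>s = r\<close> it does not, since \<open>r\<close> is already a time of
  \<open>h\<close>; there the state is known to be \<open>x\<close>, and \<open>h0\<close> serves as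
  the history to which consistency applies.\<close>

lemma evolution:
  assumes "r \<le> s"
  obtains g where "history g" "after g s"
    "\<And>s' z. s \<le> s' \<Longrightarrow> p s' z = (\<Sum>w\<in>UNIV. p s w * trans_matrix P g s s' $ w $ z)"
proof (cases "s = r")
  case True
  show ?thesis
  proof (rule that)
    show "history h0" "after h0 s" using h0 r True by simp_all
    show "p s' z = (\<Sum>w\<in>UNIV. p s w * trans_matrix P h0 s s' $ w $ z)" for s' z
      unfolding True p_start trans_matrix_def by (simp add: if_distrib[of "\<lambda>a. a * _"] cong: if_cong)
  qed
next
  case False
  with assms have "r < s" by simp
  from that[OF hist after_h[OF this] chapman_kolmogorov[OF this]] show ?thesis .
qed

lemma mean_increment:
  assumes "\<And>z. p s' z = (\<Sum>w\<in>UNIV. p s w * T $ w $ z)" "0 < \<Delta>"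
  shows "mean_at (P h) f s' - mean_at (P h) f s =
    \<Delta> * (\<Sum>w\<in>UNIV. p s w * (((1 / \<Delta>) *\<^sub>R (T - mat 1)) *v f) $ w)"
proof -
  have "mean_at (P h) f s' = (\<Sum>w\<in>UNIV. p s w * (T *v f) $ w)"
  proof -
    have "mean_at (P h) f s' = (\<Sum>z\<in>UNIV. \<Sum>w\<in>UNIV. p s w * T $ w $ z * f $ z)"
      by (simp add: mean_at_def assms(1) sum_distrib_right)
    also have "\<dots> = (\<Sum>w\<in>UNIV. \<Sum>z\<in>UNIV. p s w * T $ w $ z * f $ z)" by (rule sum.swap)
    finally show ?thesis by (simp add: matrix_vector_mult_def sum_distrib_left mult.assoc)
  qed
  moreover have "\<Delta> * (p s w * (((1 / \<Delta>) *\<^sub>R (T - mat 1)) *v f) $ w) = p s w * (T *v f) $ w - p s w * f $ w" for w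
  proof -
    have "(((1 / \<Delta>) *\<^sub>R (T - mat 1)) *v f) $ w = (1 / \<Delta>) * ((T *v f) $ w - f $ w)"
      by (simp add: scaleR_matrix_vector_assoc[symmetric] matrix_vector_mult_diff_rdistrib)
    then show ?thesis using assms(2) by (simp add: right_diff_distrib)
  qed
  ultimately show ?thesis by (simp add: sum_distrib_left sum_subtractf mean_at_def)
qed

text \<open>The history \<open>g\<close> depends on \<open>s\<close> but not on the increment, so
  consistency at \<open>s\<close> concerns one family of quotients, and finitely many states allow
  one threshold for all of them.\<close>

lemma mean_dini:
  assumes s: "r \<le> s" and le: "\<And>Q w. Q \<in> \<Q> \<Longrightarrow> (Q *v f) $ w \<le> c $ w" and \<epsilon>: "0 < \<epsilon>"
  shows "eventually (\<lambda>s'. mean_at (P h) f s' - mean_at (P h) f s \<le> (mean_at (P h) c s + \<epsilon>) * (s' - s)) (at_right s)"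
proof -
  obtain g where g: "history g" "after g s"
    and ev: "\<And>s' z. s \<le> s' \<Longrightarrow> p s' z = (\<Sum>w\<in>UNIV. p s w * trans_matrix P g s s' $ w $ z)"
    by (rule evolution[OF s]) (rule that, assumption+)
  have dc: "derivative_consistent \<Q> (forward_quotient P g s)"
    using cons g unfolding consistent_def by blast
  have "eventually (\<lambda>\<Delta>. \<forall>w. (forward_quotient P g s \<Delta> *v f) $ w \<le> c $ w + \<epsilon>) (at_right 0)"
    by (intro eventually_all_finite derivative_consistent_upper[OF dc] le \<epsilon>)
  then have "eventually (\<lambda>s'. \<forall>w. (forward_quotient P g s (s' - s) *v f) $ w \<le> c $ w + \<epsilon>) (at_right s)"
    by (subst eventually_at_right_to_0) simp
  with eventually_at_right_less[of s] show ?thesis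
  proof eventually_elim
    case (elim s')
    have "mean_at (P h) f s' - mean_at (P h) f s =
        (s' - s) * (\<Sum>w\<in>UNIV. p s w * (forward_quotient P g s (s' - s) *v f) $ w)"
      using mean_increment[OF ev, of s' "s' - s" f] elim by (simp add: forward_quotient_def)
    also have "\<dots> \<le> (s' - s) * (\<Sum>w\<in>UNIV. p s w * (c $ w + \<epsilon>))"
      using elim by (intro mult_left_mono sum_mono mult_left_mono) auto
    also have "(\<Sum>w\<in>UNIV. p s w * (c $ w + \<epsilon>)) = mean_at (P h) c s + \<epsilon>"
      using sum_p[of s] s r0
      by (simp add: mean_at_def distrib_left sum.distrib sum_distrib_right[symmetric])
    finally show ?case by (subst mult.commute)
  qed
qed

lemma mean_increment_bound:
  assumes ev: "\<And>z. p s' z = (\<Sum>w\<in>UNIV. p s w * T $ w $ z)" and \<Delta>: "0 < \<Delta>"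
    and C: "\<And>w z. \<bar>((1 / \<Delta>) *\<^sub>R (T - mat 1)) $ w $ z\<bar> \<le> C"
  shows "\<bar>mean_at (P h) f s' - mean_at (P h) f s\<bar> \<le> \<Delta> * (\<Sum>w\<in>(UNIV::'a set). \<Sum>z\<in>UNIV. C * \<bar>f $ z\<bar>)"
proof -
  let ?D = "(1 / \<Delta>) *\<^sub>R (T - mat 1)"
  have "\<bar>(\<Sum>w\<in>UNIV. p s w * (?D *v f) $ w)\<bar> \<le> (\<Sum>w\<in>UNIV. \<bar>p s w * (?D *v f) $ w\<bar>)"
    by (rule sum_abs)
  also have "\<dots> \<le> (\<Sum>w\<in>(UNIV::'a set). \<Sum>z\<in>UNIV. C * \<bar>f $ z\<bar>)"
  proof (rule sum_mono)
    fix w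
    have "\<bar>p s w * (?D *v f) $ w\<bar> \<le> 1 * \<bar>(?D *v f) $ w\<bar>"
      unfolding abs_mult by (intro mult_right_mono) auto
    also have "\<bar>(?D *v f) $ w\<bar> \<le> (\<Sum>z\<in>UNIV. \<bar>?D $ w $ z * f $ z\<bar>)"
      unfolding matrix_vector_mult_def vec_lambda_beta by (rule sum_abs)
    also have "\<dots> \<le> (\<Sum>z\<in>UNIV. C * \<bar>f $ z\<bar>)"
      unfolding abs_mult by (intro sum_mono mult_right_mono C) auto
    finally show "\<bar>p s w * (?D *v f) $ w\<bar> \<le> (\<Sum>z\<in>UNIV. C * \<bar>f $ z\<bar>)" by simp
  qed
  finally show ?thesis
    unfolding mean_increment[OF ev \<Delta>] abs_mult using \<Delta> by simp
qed

text \<open>Bounded quotients give one-sided Lipschitz estimates at each time. Continuity from the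
  left is where the backward quotients of consistency enter.\<close>

lemma mean_continuous: "continuous_on {r..} (mean_at (P h) f)"
  unfolding continuous_on_def
proof
  fix s assume "s \<in> {r..}"
  then have s: "r \<le> s" by simp
  let ?m = "mean_at (P h) f"
  have right: "(?m \<longlongrightarrow> ?m s) (at_right s)"
  proof -
    obtain g where g: "history g" "after g s"
      and ev: "\<And>s' z. s \<le> s' \<Longrightarrow> p s' z = (\<Sum>w\<in>UNIV. p s w * trans_matrix P g s s' $ w $ z)"
      by (rule evolution[OF s]) (rule that, assumption+)
    have "derivative_consistent \<Q> (forward_quotient P g s)"
      using cons g unfolding consistent_def by blast
    then obtain C where C: "eventually (\<lambda>\<Delta>. \<forall>w z. \<bar>forward_quotient P g s \<Delta> $ w $ z\<bar> \<le> C) (at_right 0)"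
      by (rule derivative_consistent_bounded)
    then have "eventually (\<lambda>s'. \<forall>w z. \<bar>forward_quotient P g s (s' - s) $ w $ z\<bar> \<le> C) (at_right s)"
      by (subst eventually_at_right_to_0) simp
    with eventually_at_right_less[of s]
    have "eventually (\<lambda>s'. norm (?m s' - ?m s) \<le> (s' - s) * (\<Sum>w\<in>(UNIV::'a set). \<Sum>z\<in>UNIV. C * \<bar>f $ z\<bar>)) (at_right s)"
    proof eventually_elim
      case (elim s')
      show ?case
        using mean_increment_bound[OF ev, of s' "s' - s" C f] elim by (simp add: forward_quotient_def)
    qed
    moreover have "((\<lambda>s'. (s' - s) * (\<Sum>w\<in>(UNIV::'a set). \<Sum>z\<in>UNIV. C * \<bar>f $ z\<bar>)) \<longlongrightarrow> 0) (at_right s)"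
      by (rule tendsto_eq_intros refl)+ simp
    ultimately have "((\<lambda>s'. ?m s' - ?m s) \<longlongrightarrow> 0) (at_right s)"
      by (rule Lim_null_comparison)
    then show ?thesis by (simp add: LIM_zero_iff)
  qed
  show "(?m \<longlongrightarrow> ?m s) (at s within {r..})"
  proof (cases "s = r")
    case True
    then show ?thesis using right by (simp add: at_within_Ici_at_right)
  next
    case False
    then have rs: "r < s" using s by simp
    have "derivative_consistent \<Q> (backward_quotient P h s)"
    proof -
      have "0 < s" using rs r0 by simp
      then show ?thesis using cons hist after_h[OF rs] unfolding consistent_def by blast
    qed
    then obtain C where "eventually (\<lambda>\<Delta>. \<forall>w z. \<bar>backward_quotient P h s \<Delta> $ w $ z\<bar> \<le> C) (at_right 0)"
      by (rule derivative_consistent_bounded)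
    then obtain d where d: "0 < d" "\<And>\<Delta>. 0 < \<Delta> \<Longrightarrow> \<Delta> < d \<Longrightarrow> \<forall>w z. \<bar>backward_quotient P h s \<Delta> $ w $ z\<bar> \<le> C"
      unfolding eventually_at_right_field by blast
    have "s - d < s" using d(1) by simp
    from eventually_at_left_real[OF this]
    have "eventually (\<lambda>s'. \<forall>w z. \<bar>backward_quotient P h s (s - s') $ w $ z\<bar> \<le> C) (at_left s)"
      by eventually_elim (rule d(2), simp_all)
    with eventually_at_left_real[OF rs]
    have "eventually (\<lambda>s'. norm (?m s' - ?m s) \<le> (s - s') * (\<Sum>w\<in>(UNIV::'a set). \<Sum>z\<in>UNIV. C * \<bar>f $ z\<bar>)) (at_left s)"
    proof eventually_elim
      case (elim s')
      have "\<bar>?m s - ?m s'\<bar> \<le> (s - s') * (\<Sum>w\<in>(UNIV::'a set). \<Sum>z\<in>UNIV. C * \<bar>f $ z\<bar>)"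
        using elim by (intro mean_increment_bound[OF chapman_kolmogorov]) (auto simp: backward_quotient_def)
      then show ?case by (simp add: abs_minus_commute)
    qed
    moreover have "((\<lambda>s'. (s - s') * (\<Sum>w\<in>(UNIV::'a set). \<Sum>z\<in>UNIV. C * \<bar>f $ z\<bar>)) \<longlongrightarrow> 0) (at_left s)"
      by (rule tendsto_eq_intros refl)+ simp
    ultimately have "((\<lambda>s'. ?m s' - ?m s) \<longlongrightarrow> 0) (at_left s)"
      by (rule Lim_null_comparison)
    then have "(?m \<longlongrightarrow> ?m s) (at_left s)" by (simp add: LIM_zero_iff)
    with right have "(?m \<longlongrightarrow> ?m s) (at s)" by (simp add: filterlim_at_split)
    then show ?thesis by (rule tendsto_within_subset) simp
  qed
qed

text \<open>A Dynkin-type inequality: the mean of \<open>f\<close> minus the integral of the mean of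
  \<open>c\<close> satisfies the Dini condition, since the integral has the right derivative
  \<open>?g t\<close> by continuity and \<open>mean_dini\<close> bounds the increments of the
  mean.\<close>

lemma mean_upper:
  assumes le: "\<And>Q w. Q \<in> \<Q> \<Longrightarrow> (Q *v f) $ w \<le> c $ w" and b: "r \<le> b"
  shows "mean_at (P h) f b - f $ x \<le> integral {r..b} (mean_at (P h) c)"
proof -
  let ?m = "mean_at (P h) f" and ?g = "mean_at (P h) c"
  let ?I = "\<lambda>s. integral {r..s} ?g"
  have contg: "continuous_on {r..b} ?g" and contm: "continuous_on {r..b} ?m"
    using continuous_on_subset[OF mean_continuous, of "{r..b}"] by auto
  have I: "(?I has_real_derivative ?g s) (at s within {r..b})" if "s \<in> {r..b}" for s
    by (rule integral_has_real_derivative[OF contg that])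
  have "?m b - ?I b \<le> ?m r - ?I r"
  proof (rule dini_nonincreasing[OF b])
    show "continuous_on {r..b} (\<lambda>s. ?m s - ?I s)"
      using I by (intro continuous_on_diff contm DERIV_continuous_on)
    fix t \<epsilon> :: real assume t: "r \<le> t" "t < b" and \<epsilon>: "0 < \<epsilon>"
    have "(?I has_real_derivative ?g t) (at t within {t..b})"
      by (rule DERIV_subset[OF I]) (use t in auto)
    then have "(?I has_real_derivative ?g t) (at_right t)"
      using at_within_Icc_at_right[OF t(2)] by simp
    then have "((\<lambda>s. (?I s - ?I t) / (s - t)) \<longlongrightarrow> ?g t) (at_right t)"
      by (simp add: has_field_derivative_iff)
    \<comment> \<open>Half of \<epsilon> is spent on the integral, the other half on
      \<open>mean_dini\<close>.\<close>
    then have "eventually (\<lambda>s. ?g t - \<epsilon> / 2 < (?I s - ?I t) / (s - t)) (at_right t)"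
      by (rule order_tendstoD) (use \<epsilon> in simp)
    moreover have "eventually (\<lambda>s. ?m s - ?m t \<le> (?g t + \<epsilon> / 2) * (s - t)) (at_right t)"
      by (rule mean_dini[OF t(1) le]) (use \<epsilon> in auto)
    ultimately show "eventually (\<lambda>s. ?m s - ?I s - (?m t - ?I t) \<le> \<epsilon> * (s - t)) (at_right t)"
      using eventually_at_right_less[of t]
    proof eventually_elim
      case (elim s)
      then have "(?g t - \<epsilon> / 2) * (s - t) < ?I s - ?I t" by (simp add: pos_less_divide_eq)
      moreover have "(?g t + \<epsilon> / 2) * (s - t) = (?g t - \<epsilon> / 2) * (s - t) + \<epsilon> * (s - t)"
        by (simp add: algebra_simps)
      ultimately show ?case using elim(2) by linarith
    qed
  qed
  moreover have "?m r = f $ x"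
    by (simp add: mean_at_def p_start if_distrib[of "\<lambda>a. a * _"] cong: if_cong)
  ultimately show ?thesis by simp
qed

lemma mean_lower:
  assumes ge: "\<And>Q w. Q \<in> \<Q> \<Longrightarrow> c $ w \<le> (Q *v f) $ w" and b: "r \<le> b"
  shows "integral {r..b} (mean_at (P h) c) \<le> mean_at (P h) f b - f $ x"
proof -
  have "mean_at (P h) (- f) b - (- f) $ x \<le> integral {r..b} (mean_at (P h) (- c))"
    using ge by (intro mean_upper[OF _ b]) (simp add: matrix_vector_mult_def sum_negf)
  moreover have "mean_at (P h) (- c) = (\<lambda>s. - mean_at (P h) c s)"
    by (simp add: fun_eq_iff mean_at_uminus)
  ultimately show ?thesis by (simp add: mean_at_uminus)
qed

end

section \<open>Expected hitting times as integrated survival functions\<close>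

text \<open>By right-continuity the path keeps its state for a while after \<open>s\<close>. This
  replaces uncountably many times by rational ones, both for measurability of the hitting time and
  for the null set in \<open>survival_le\<close>.\<close>

lemma cadlag_hits_rationally:
  assumes \<omega>: "\<omega> \<in> cadlag_paths" and s: "0 \<le> s" "s < t" "\<omega> s \<in> A"
  obtains q where "q \<in> \<rat>" "s < q" "q < t" "\<omega> q \<in> A"
proof -
  have "eventually (\<lambda>r. \<omega> r = \<omega> s) (at_right s)"
    using \<omega> s(1) by (simp add: cadlag_paths_iff)
  then obtain b where b: "s < b" "\<forall>r>s. r < b \<longrightarrow> \<omega> r = \<omega> s"
    unfolding eventually_at_right_field by blast
  have "s < min b t" using b(1) s(2) by simp
  from Rats_dense_in_real[OF this] obtain q where "q \<in> \<rat>" "s < q" "q < min b t" by blast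
  then show ?thesis using b(2) s(3) by (intro that[of q]) auto
qed

lemma hitting_time_less_iff:
  "hitting_time A \<omega> < a \<longleftrightarrow> (\<exists>s\<ge>0. ennreal s < a \<and> \<omega> s \<in> A)"
  unfolding hitting_time_def INF_less_iff by auto

lemma hitting_time_less_iff_rational:
  assumes "\<omega> \<in> cadlag_paths"
  shows "hitting_time A \<omega> < a \<longleftrightarrow> (\<exists>q\<in>\<rat> \<inter> {0..}. ennreal q < a \<and> \<omega> q \<in> A)"
proof
  assume "hitting_time A \<omega> < a"
  then obtain s where s: "0 \<le> s" "ennreal s < a" "\<omega> s \<in> A"
    unfolding hitting_time_less_iff by blast
  obtain t where t: "s < t" "ennreal t \<le> a"
  proof (cases a)
    case (real b)
    then show ?thesis using s that[of b] by (simp add: ennreal_less_iff)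
  next
    case top
    then show ?thesis using that[of "s + 1"] by simp
  qed
  obtain q where q: "q \<in> \<rat>" "s < q" "q < t" "\<omega> q \<in> A"
    by (rule cadlag_hits_rationally[OF assms s(1) t(1) s(3)])
  have "ennreal q < ennreal t" using q s(1) by (simp add: ennreal_less_iff)
  then show "\<exists>q\<in>\<rat> \<inter> {0..}. ennreal q < a \<and> \<omega> q \<in> A"
    using q s(1) t(2) by (intro bexI[of _ q]) auto
next
  assume "\<exists>q\<in>\<rat> \<inter> {0..}. ennreal q < a \<and> \<omega> q \<in> A"
  then show "hitting_time A \<omega> < a" unfolding hitting_time_less_iff by auto
qed

lemma measurable_hitting_time: "hitting_time A \<in> borel_measurable path_space"
proof (rule borel_measurableI_less)
  fix a :: ennreal
  have "{\<omega> \<in> space path_space. hitting_time A \<omega> < a} =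
      (\<Union>q\<in>{q \<in> \<rat> \<inter> {0..}. ennreal q < a}. \<Union>x\<in>A. state_event q x)"
    using hitting_time_less_iff_rational[of _ A a] by (auto simp: state_event_def)
  moreover have "(\<Union>q\<in>{q \<in> \<rat> \<inter> {0..}. ennreal q < a}. \<Union>x\<in>A. state_event q x) \<in> sets path_space"
  proof (rule sets.countable_UN')
    show "countable {q \<in> \<rat> \<inter> {0..}. ennreal q < a}"
      using countable_rat by (rule countable_subset[rotated]) auto
  qed (auto intro!: sets.finite_UN)
  ultimately show "{\<omega> \<in> space path_space. hitting_time A \<omega> < a} \<in> sets path_space" by simp
qed

text \<open>The layer-cake formula in a strict and a non-strict version, between which the survival
  function will be squeezed.\<close>

lemma nn_integral_le_indicator:
  shows "(\<integral>\<^sup>+t. indicator {t. 0 \<le> t \<and> ennreal t < a} t \<partial>lborel) = a" (is "?L = _")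
    and "(\<integral>\<^sup>+t. indicator {t. 0 \<le> t \<and> ennreal t \<le> a} t \<partial>lborel) = a" (is "?M = _")
proof -
  have "?L = a \<and> ?M = a"
  proof (cases a)
    case (real b)
    then have "{t. 0 \<le> t \<and> ennreal t < a} = {0..<b}" "{t. 0 \<le> t \<and> ennreal t \<le> a} = {0..b}"
      by (auto simp: ennreal_less_iff)
    then show ?thesis using real by simp
  next
    case top
    then have "{t. 0 \<le> t \<and> ennreal t < a} = {0..}" "{t. 0 \<le> t \<and> ennreal t \<le> a} = {0..}"
      by auto
    moreover have "emeasure lborel {0::real..} = \<top>"
    proof (rule ccontr)
      assume "emeasure lborel {0::real..} \<noteq> \<top>"
      then obtain n where n: "emeasure lborel {0::real..} < of_nat n"
        using ennreal_Ex_less_of_nat by (auto simp: less_top)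
      have "emeasure lborel {0..real n} \<le> emeasure lborel {0::real..}"
        by (intro emeasure_mono) auto
      then show False using n by (simp add: ennreal_of_nat_eq_real_of_nat)
    qed
    ultimately show ?thesis using top by simp
  qed
  then show "?L = a" "?M = a" by auto
qed

section \<open>Absorption in \<open>A\<close>\<close>

lemma sum_ind_vec: "(\<Sum>z\<in>UNIV. a z * ind_vec B $ z) = (\<Sum>z\<in>B. a z)"
  by (rule sum.mono_neutral_cong_right) (auto simp: ind_vec_def)

text \<open>Rows sum to 0, so the row mass outside \<open>A\<close> is minus the mass inside; the
  latter is non-negative because the diagonal vanishes at states of \<open>A\<close>.\<close>

lemma rate_matrix_ind_compl_nonpos:
  assumes Q: "rate_matrix Q" and A: "\<forall>x\<in>A. Q $ x $ x = 0"
  shows "(Q *v ind_vec (- A)) $ w \<le> 0"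
proof -
  have eq: "(Q *v ind_vec (- A)) $ w = (\<Sum>z\<in>-A. Q $ w $ z)"
    by (simp add: matrix_vector_mult_def sum_ind_vec)
  have tot: "(\<Sum>z\<in>UNIV. Q $ w $ z) = 0" using Q by (simp add: rate_matrix_def)
  have *: "(\<Sum>z\<in>UNIV. Q $ w $ z) = (\<Sum>z\<in>A. Q $ w $ z) + (\<Sum>z\<in>-A. Q $ w $ z)"
    using sum.union_disjoint[of A "- A" "\<lambda>z. Q $ w $ z"] by (simp add: Compl_partition)
  have off: "0 \<le> Q $ w $ z" if "w \<noteq> z" for z using Q that by (simp add: rate_matrix_def)
  have "0 \<le> (\<Sum>z\<in>A. Q $ w $ z)"
  proof (rule sum_nonneg)
    fix z assume "z \<in> A"
    then show "0 \<le> Q $ w $ z" using off A by (cases "w = z") auto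
  qed
  then show ?thesis using eq tot * by linarith
qed

text \<open>A zero diagonal entry leaves a non-negative row with sum 0.\<close>

lemma rate_matrix_absorbing_row:
  assumes Q: "rate_matrix Q" and x: "Q $ x $ x = 0"
  shows "Q $ x $ y = 0"
proof (rule ccontr)
  assume "Q $ x $ y \<noteq> 0"
  moreover have nn: "0 \<le> Q $ x $ z" for z using Q x by (cases "x = z") (auto simp: rate_matrix_def)
  ultimately have "0 < Q $ x $ y" by (simp add: order_less_le)
  also have "Q $ x $ y \<le> (\<Sum>z\<in>UNIV. Q $ x $ z)" by (rule member_le_sum) (auto simp: nn)
  finally show False using Q by (simp add: rate_matrix_def)
qed

lemma mean_at_nonneg: "(\<And>z. 0 \<le> f $ z) \<Longrightarrow> 0 \<le> mean_at M f s"
  unfolding mean_at_def by (intro sum_nonneg mult_nonneg_nonneg) auto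

lemma mean_at_mono: "(\<And>z. f $ z \<le> g $ z) \<Longrightarrow> mean_at M f s \<le> mean_at M g s"
  unfolding mean_at_def by (intro sum_mono mult_left_mono) auto

text \<open>\<open>mean_upper\<close> with the indicator of the complement and \<open>c = 0\<close>:
  the probability of being outside \<open>A\<close> cannot grow from its initial value 0.\<close>

lemma (in process_from) absorbed:
  assumes \<Q>: "\<forall>Q\<in>\<Q>. rate_matrix Q" "\<forall>Q\<in>\<Q>. \<forall>x\<in>A. Q $ x $ x = 0"
    and x: "x \<in> A" and s: "r \<le> s" and z: "z \<notin> A"
  shows "p s z = 0"
proof -
  have up: "mean_at (P h) (ind_vec (- A)) s - ind_vec (- A) $ x \<le> integral {r..s} (mean_at (P h) 0)"
    using \<Q> by (intro mean_upper s) (simp add: rate_matrix_ind_compl_nonpos)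
  have "mean_at (P h) (ind_vec (- A)) s \<le> 0"
  proof -
    have "mean_at (P h) 0 = (\<lambda>_. 0)" by (simp add: fun_eq_iff mean_at_def)
    moreover have "ind_vec (- A) $ x = 0" using x by (simp add: ind_vec_def)
    ultimately show ?thesis using up by simp
  qed
  moreover have "p s z \<le> mean_at (P h) (ind_vec (- A)) s"
    unfolding mean_at_def
    using member_le_sum[of z UNIV "\<lambda>z. p s z * ind_vec (- A) $ z"] z by (simp add: ind_vec_def)
  ultimately show ?thesis using measure_nonneg[of "P h" "state_event s z"] by linarith
qed

locale absorbed_process =
  fixes P :: "('a::finite) process" and \<Q> :: "(real ^ 'a ^ 'a) set" and A :: "'a set" and x :: 'a
  assumes process: "stochastic_process P" "consistent \<Q> P"
    and rate: "\<forall>Q\<in>\<Q>. rate_matrix Q" and absorbing: "\<forall>Q\<in>\<Q>. \<forall>x\<in>A. Q $ x $ x = 0"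
begin

sublocale process_from P \<Q> Map.empty 0 x
  using process by unfold_locales (auto simp: history_def after_def)

text \<open>The probability that \<open>X_t\<close> lies outside \<open>A\<close>, which
  \<open>mean_upper\<close> and \<open>mean_lower\<close> can control; its comparison with the tail
  of the hitting time is left to \<open>survival_le\<close> and \<open>survival_ge\<close>.\<close>

definition survival :: "real \<Rightarrow> real"
  where "survival t = mean_at (P h) (ind_vec (- A)) t"

lemma survival_nonneg: "0 \<le> survival t"
  unfolding survival_def by (rule mean_at_nonneg) (simp add: ind_vec_def)

lemma survival_continuous: "continuous_on {0..} survival"
  unfolding survival_def[abs_def] by (rule mean_continuous)

lemma outside_event: "{\<omega> \<in> cadlag_paths. \<omega> t \<notin> A} = (\<Union>z\<in>-A. state_event t z)"
  by (auto simp: state_event_def)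

lemma outside_sets: "0 \<le> t \<Longrightarrow> {\<omega> \<in> cadlag_paths. \<omega> t \<notin> A} \<in> events"
  unfolding outside_event by (intro sets.finite_UN) (auto simp: events_eq)

lemma survival_eq: "0 \<le> t \<Longrightarrow> survival t = prob {\<omega> \<in> cadlag_paths. \<omega> t \<notin> A}"
proof -
  assume t: "0 \<le> t"
  have "prob (\<Union>z\<in>-A. state_event t z) = (\<Sum>z\<in>-A. p t z)"
  proof (intro finite_measure_finite_Union)
    show "state_event t ` (- A) \<subseteq> events" using t by (simp add: image_subset_iff events_eq)
    show "disjoint_family_on (state_event t) (- A)"
      by (auto simp: disjoint_family_on_def state_event_def)
  qed simp
  also have "\<dots> = survival t"
    by (simp add: survival_def mean_at_def sum_ind_vec)
  finally show ?thesis by (simp add: outside_event)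
qed

text \<open>The chain rule at time \<open>q\<close> conditions on the visit to \<open>y\<close>, and
  \<open>absorbed\<close> applies to the process continued from that longer history.\<close>

lemma leave_null:
  assumes "0 < q" "q < t" "y \<in> A" "z \<notin> A"
  shows "state_event t z \<inter> state_event q y \<in> null_sets (P h)"
proof (rule null_setsI)
  have q: "after h q" using after_h assms by simp
  interpret Q: process_from P \<Q> h q y
    using process hist q by unfold_locales
  have "prob (state_event t z \<inter> state_event q y) =
      measure (P (h(q \<mapsto> y))) (state_event t z) * prob (state_event q y)"
    using assms by (intro processD(4)[OF hist q] state_event_sets_from) simp
  also have "measure (P (h(q \<mapsto> y))) (state_event t z) = 0"
    using assms by (intro Q.absorbed[OF rate absorbing]) auto
  finally show "emeasure (P h) (state_event t z \<inter> state_event q y) = 0"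
    by (simp only: emeasure_eq_measure mult_zero_left ennreal_0)
  show "state_event t z \<inter> state_event q y \<in> events"
    using assms by (intro sets.Int) (simp_all add: events_eq)
qed

lemma hitting_events:
  "{\<omega> \<in> cadlag_paths. ennreal t \<le> hitting_time A \<omega>} \<in> events"
  "{\<omega> \<in> cadlag_paths. ennreal t < hitting_time A \<omega>} \<in> events"
proof -
  have [measurable]: "hitting_time A \<in> borel_measurable (P h)"
    using measurable_hitting_time unfolding measurable_cong_sets[OF events_eq refl] .
  have sp: "space (P h) = cadlag_paths" using sets_eq_imp_space_eq[OF events_eq] by simp
  show "{\<omega> \<in> cadlag_paths. ennreal t \<le> hitting_time A \<omega>} \<in> events"
    unfolding sp[symmetric] by measurable
  show "{\<omega> \<in> cadlag_paths. ennreal t < hitting_time A \<omega>} \<in> events"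
    unfolding sp[symmetric] by measurable
qed

text \<open>A path outside \<open>A\<close> at \<open>t\<close> that has hit \<open>A\<close>
  earlier was in \<open>A\<close> at a rational time strictly between 0 and \<open>t\<close>; this
  is a countable union of the null events of \<open>leave_null\<close>.\<close>

lemma survival_le:
  assumes t: "0 \<le> t"
  shows "ennreal (survival t) \<le> emeasure (P h) {\<omega> \<in> cadlag_paths. ennreal t \<le> hitting_time A \<omega>}"
proof -
  let ?N = "\<Union>q\<in>\<rat> \<inter> {0<..<t}. \<Union>y\<in>A. \<Union>z\<in>-A. state_event t z \<inter> state_event q y"
  have N: "?N \<in> null_sets (P h)"
  proof (rule null_sets_UN')
    show "countable (\<rat> \<inter> {0<..<t})" using countable_rat by (rule countable_subset[rotated]) auto
    fix q assume "q \<in> \<rat> \<inter> {0<..<t}"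
    then show "(\<Union>y\<in>A. \<Union>z\<in>-A. state_event t z \<inter> state_event q y) \<in> null_sets (P h)"
      by (intro null_sets.finite_UN leave_null) auto
  qed
  have "{\<omega> \<in> cadlag_paths. \<omega> t \<notin> A} \<subseteq> {\<omega> \<in> cadlag_paths. ennreal t \<le> hitting_time A \<omega>} \<union> ?N"
  proof
    fix \<omega> assume "\<omega> \<in> {\<omega> \<in> cadlag_paths. \<omega> t \<notin> A}"
    then have \<omega>: "\<omega> \<in> cadlag_paths" "\<omega> t \<notin> A" by auto
    show "\<omega> \<in> {\<omega> \<in> cadlag_paths. ennreal t \<le> hitting_time A \<omega>} \<union> ?N"
    proof (cases "hitting_time A \<omega> < ennreal t")
      case True
      then obtain s where s: "0 \<le> s" "ennreal s < ennreal t" "\<omega> s \<in> A"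
        unfolding hitting_time_less_iff by blast
      then have "s < t" by (simp add: ennreal_less_iff)
      from cadlag_hits_rationally[OF \<omega>(1) s(1) this s(3)]
      obtain q where q: "q \<in> \<rat>" "s < q" "q < t" "\<omega> q \<in> A" .
      then have "q \<in> \<rat> \<inter> {0<..<t}" "\<omega> \<in> state_event t (\<omega> t) \<inter> state_event q (\<omega> q)"
        using s(1) \<omega>(1) by (auto simp: state_event_def)
      then have "\<omega> \<in> ?N" using q(4) \<omega>(2) by blast
      then show ?thesis by blast
    next
      case False
      then show ?thesis using \<omega> by (simp add: not_less)
    qed
  qed
  then have "emeasure (P h) {\<omega> \<in> cadlag_paths. \<omega> t \<notin> A} \<le>
      emeasure (P h) ({\<omega> \<in> cadlag_paths. ennreal t \<le> hitting_time A \<omega>} \<union> ?N)"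
    using N hitting_events(1) by (intro emeasure_mono) auto
  also have "\<dots> = emeasure (P h) {\<omega> \<in> cadlag_paths. ennreal t \<le> hitting_time A \<omega>}"
    by (rule emeasure_Un_null_set[OF hitting_events(1) N])
  finally show ?thesis by (simp add: survival_eq[OF t] emeasure_eq_measure)
qed

lemma survival_ge:
  assumes t: "0 \<le> t"
  shows "emeasure (P h) {\<omega> \<in> cadlag_paths. ennreal t < hitting_time A \<omega>} \<le> ennreal (survival t)"
proof -
  have "{\<omega> \<in> cadlag_paths. ennreal t < hitting_time A \<omega>} \<subseteq> {\<omega> \<in> cadlag_paths. \<omega> t \<notin> A}"
  proof safe
    fix \<omega> assume "ennreal t < hitting_time A \<omega>" "\<omega> t \<in> A"
    moreover have "hitting_time A \<omega> \<le> ennreal t"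
      unfolding hitting_time_def using t \<open>\<omega> t \<in> A\<close> by (intro INF_lower) simp
    ultimately show False by simp
  qed
  then show ?thesis
    unfolding survival_eq[OF t] emeasure_eq_measure[symmetric]
    by (rule emeasure_mono[OF _ outside_sets[OF t]])
qed

text \<open>The survival function lies between the probabilities of \<open>t < hitting_time\<close>
  and \<open>t <= hitting_time\<close>. By Fubini and the layer-cake formula both integrate to the
  expected hitting time.\<close>

lemma expected_hitting_time_eq:
  "expected_hitting_time A P x = (\<integral>\<^sup>+t. ennreal (survival t) * indicator {0..} t \<partial>lborel)"
proof (rule antisym)
  interpret pair_sigma_finite lborel "P h" ..
  have hm: "hitting_time A \<in> borel_measurable (P h)"
    using measurable_hitting_time unfolding measurable_cong_sets[OF events_eq refl] .
  note [measurable] = hm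
  have sp: "space (P h) = cadlag_paths" using sets_eq_imp_space_eq[OF events_eq] by simp
  have "expected_hitting_time A P x =
      (\<integral>\<^sup>+\<omega>. \<integral>\<^sup>+t. indicator {t. 0 \<le> t \<and> ennreal t < hitting_time A \<omega>} t \<partial>lborel \<partial>P h)"
    by (simp add: expected_hitting_time_def nn_integral_le_indicator)
  also have "\<dots> = (\<integral>\<^sup>+t. \<integral>\<^sup>+\<omega>. indicator {t. 0 \<le> t \<and> ennreal t < hitting_time A \<omega>} t \<partial>P h \<partial>lborel)"
    by (rule Fubini') measurable
  also have "\<dots> = (\<integral>\<^sup>+t. emeasure (P h) {\<omega> \<in> cadlag_paths. ennreal t < hitting_time A \<omega>} * indicator {0..} t \<partial>lborel)"
  proof (rule nn_integral_cong)
    fix t :: real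
    have "(\<integral>\<^sup>+\<omega>. indicator {t. 0 \<le> t \<and> ennreal t < hitting_time A \<omega>} t \<partial>P h) =
        (\<integral>\<^sup>+\<omega>. indicator {0..} t * indicator {\<omega> \<in> cadlag_paths. ennreal t < hitting_time A \<omega>} \<omega> \<partial>P h)"
      by (intro nn_integral_cong) (auto simp: sp split: split_indicator)
    then show "(\<integral>\<^sup>+\<omega>. indicator {t. 0 \<le> t \<and> ennreal t < hitting_time A \<omega>} t \<partial>P h) =
        emeasure (P h) {\<omega> \<in> cadlag_paths. ennreal t < hitting_time A \<omega>} * indicator {0..} t"
      using hitting_events(2)[of t] by (simp add: nn_integral_cmult mult.commute)
  qed
  also have "\<dots> \<le> (\<integral>\<^sup>+t. ennreal (survival t) * indicator {0..} t \<partial>lborel)"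
    by (intro nn_integral_mono) (auto intro: survival_ge split: split_indicator)
  finally show "expected_hitting_time A P x \<le> (\<integral>\<^sup>+t. ennreal (survival t) * indicator {0..} t \<partial>lborel)" .
  have "(\<integral>\<^sup>+t. ennreal (survival t) * indicator {0..} t \<partial>lborel) \<le>
      (\<integral>\<^sup>+t. emeasure (P h) {\<omega> \<in> cadlag_paths. ennreal t \<le> hitting_time A \<omega>} * indicator {0..} t \<partial>lborel)"
    by (intro nn_integral_mono) (auto intro: survival_le split: split_indicator)
  also have "\<dots> = (\<integral>\<^sup>+t. \<integral>\<^sup>+\<omega>. indicator {t. 0 \<le> t \<and> ennreal t \<le> hitting_time A \<omega>} t \<partial>P h \<partial>lborel)"
  proof (rule nn_integral_cong)
    fix t :: real
    have "(\<integral>\<^sup>+\<omega>. indicator {t. 0 \<le> t \<and> ennreal t \<le> hitting_time A \<omega>} t \<partial>P h) =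
        (\<integral>\<^sup>+\<omega>. indicator {0..} t * indicator {\<omega> \<in> cadlag_paths. ennreal t \<le> hitting_time A \<omega>} \<omega> \<partial>P h)"
      by (intro nn_integral_cong) (auto simp: sp split: split_indicator)
    then show "emeasure (P h) {\<omega> \<in> cadlag_paths. ennreal t \<le> hitting_time A \<omega>} * indicator {0..} t =
        (\<integral>\<^sup>+\<omega>. indicator {t. 0 \<le> t \<and> ennreal t \<le> hitting_time A \<omega>} t \<partial>P h)"
      using hitting_events(1)[of t] by (simp add: nn_integral_cmult mult.commute)
  qed
  also have "\<dots> = (\<integral>\<^sup>+\<omega>. \<integral>\<^sup>+t. indicator {t. 0 \<le> t \<and> ennreal t \<le> hitting_time A \<omega>} t \<partial>lborel \<partial>P h)"
    by (rule Fubini'[symmetric]) measurable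
  also have "\<dots> = expected_hitting_time A P x"
    by (simp add: expected_hitting_time_def nn_integral_le_indicator)
  finally show "(\<integral>\<^sup>+t. ennreal (survival t) * indicator {0..} t \<partial>lborel) \<le> expected_hitting_time A P x" .
qed

lemma measurable_survival: "(\<lambda>t. ennreal (survival t) * indicator {0..} t) \<in> borel_measurable borel"
proof -
  have "(\<lambda>t. indicator {0..} t *\<^sub>R survival t) \<in> borel_measurable borel"
    by (rule borel_measurable_continuous_on_indicator[OF _ survival_continuous]) simp
  then have "(\<lambda>t. ennreal (indicator {0..} t *\<^sub>R survival t)) \<in> borel_measurable borel" by measurable
  moreover have "ennreal (indicator {0..} t *\<^sub>R survival t) = ennreal (survival t) * indicator {0..} t" for t
    by (simp split: split_indicator)
  ultimately show ?thesis by simp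
qed

lemma nn_integral_survival:
  assumes b: "0 \<le> b"
  shows "(\<integral>\<^sup>+t. ennreal (survival t) * indicator {0..b} t \<partial>lborel) = ennreal (integral {0..b} survival)"
proof -
  have cont: "continuous_on {0..b} survival"
    by (rule continuous_on_subset[OF survival_continuous]) auto
  let ?f = "\<lambda>t. indicator {0..b} t *\<^sub>R survival t"
  have "(survival has_integral integral {0..b} survival) {0..b}"
    by (rule integrable_integral[OF integrable_continuous_real[OF cont]])
  then have "(?f has_integral integral {0..b} survival) UNIV"
    unfolding has_integral_restrict_UNIV[symmetric, of _ _ "{0..b}"]
    by (rule has_integral_eq[rotated]) (auto split: split_indicator)
  moreover have "?f \<in> borel_measurable borel"
    by (rule borel_measurable_continuous_on_indicator[OF _ cont]) simp
  moreover have "0 \<le> ?f t" for t using survival_nonneg[of t] by (simp split: split_indicator)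
  ultimately have "(\<integral>\<^sup>+t. ennreal (?f t) \<partial>lborel) = ennreal (integral {0..b} survival)"
    by (intro nn_integral_has_integral_lborel)
  moreover have "ennreal (?f t) = ennreal (survival t) * indicator {0..b} t" for t
    by (simp split: split_indicator)
  ultimately show ?thesis by simp
qed

lemma row_zero:
  assumes "Q \<in> \<Q>" "w \<in> A"
  shows "(Q *v g) $ w = 0"
proof -
  have "Q $ w $ z = 0" for z
    by (rule rate_matrix_absorbing_row) (use rate absorbing assms in blast)+
  then show ?thesis by (simp add: matrix_vector_mult_def)
qed

theorem expected_hitting_time_le:
  assumes g: "\<And>z. 0 \<le> g $ z"
    and super: "\<And>Q z. Q \<in> \<Q> \<Longrightarrow> z \<notin> A \<Longrightarrow> (Q *v g) $ z \<le> - 1"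
  shows "expected_hitting_time A P x \<le> ennreal (g $ x)"
proof -
  have le: "(Q *v g) $ w \<le> (- ind_vec (- A)) $ w" if "Q \<in> \<Q>" for Q w
  proof (cases "w \<in> A")
    case True
    have "(Q *v g) $ w = 0" by (rule row_zero[OF that True])
    then show ?thesis using True by (simp add: ind_vec_def)
  qed (use super[OF that] in \<open>simp add: ind_vec_def\<close>)
  have bound: "integral {0..b} survival \<le> g $ x" if b: "0 \<le> b" for b
  proof -
    have "mean_at (P h) g b - g $ x \<le> integral {0..b} (mean_at (P h) (- ind_vec (- A)))"
      by (rule mean_upper[OF le b])
    also have "mean_at (P h) (- ind_vec (- A)) = (\<lambda>t. - survival t)"
      by (simp add: fun_eq_iff mean_at_uminus survival_def)
    finally show ?thesis using mean_at_nonneg[OF g, of "P h" b] unfolding integral_neg by linarith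
  qed
  have "(\<lambda>n. ennreal (survival t) * indicator {0..real n} t) \<longlonglongrightarrow> ennreal (survival t) * indicator {0..} t" for t
  proof -
    obtain m where m: "t \<le> real m" using real_arch_simple by blast
    have "eventually (\<lambda>n. ennreal (survival t) * indicator {0..real n} t = ennreal (survival t) * indicator {0..} t) sequentially"
      using eventually_ge_at_top[of m] by eventually_elim (use m in \<open>auto split: split_indicator\<close>)
    then show ?thesis by (rule tendsto_eventually)
  qed
  then have lim: "(\<lambda>n. \<integral>\<^sup>+t. ennreal (survival t) * indicator {0..real n} t \<partial>lborel) \<longlonglongrightarrow>
      (\<integral>\<^sup>+t. ennreal (survival t) * indicator {0..} t \<partial>lborel)"
  proof (intro nn_integral_LIMSEQ)
    show "incseq (\<lambda>n t. ennreal (survival t) * indicator {0..real n} t)"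
      by (auto simp: incseq_def le_fun_def split: split_indicator)
    fix n
    have "(\<lambda>t. ennreal (survival t) * indicator {0..} t * indicator {0..real n} t) \<in> borel_measurable lborel"
      using measurable_survival by measurable
    moreover have "ennreal (survival t) * indicator {0..} t * indicator {0..real n} t =
        ennreal (survival t) * indicator {0..real n} t" for t by (simp split: split_indicator)
    ultimately show "(\<lambda>t. ennreal (survival t) * indicator {0..real n} t) \<in> borel_measurable lborel" by simp
  qed
  show ?thesis
    unfolding expected_hitting_time_eq
  proof (rule LIMSEQ_le_const2[OF lim], intro exI allI impI)
    fix n :: nat
    show "(\<integral>\<^sup>+t. ennreal (survival t) * indicator {0..real n} t \<partial>lborel) \<le> ennreal (g $ x)"
      using bound[of "real n"] by (simp add: nn_integral_survival ennreal_leI)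
  qed
qed

text \<open>Here the mean of \<open>g\<close> at \<open>b\<close> has the unfavourable sign. As
  \<open>g\<close> vanishes on \<open>A\<close>, it is at most a constant times
  \<open>survival b\<close>, which becomes arbitrarily small at suitable \<open>b\<close> when the
  expected hitting time is finite.\<close>

theorem expected_hitting_time_ge:
  assumes g: "\<And>z. 0 \<le> g $ z" "\<And>z. z \<in> A \<Longrightarrow> g $ z = 0"
    and sub: "\<And>Q z. Q \<in> \<Q> \<Longrightarrow> z \<notin> A \<Longrightarrow> - 1 \<le> (Q *v g) $ z"
  shows "ennreal (g $ x) \<le> expected_hitting_time A P x"
proof (cases "expected_hitting_time A P x")
  case top
  then show ?thesis by simp
next
  case (real T)
  have ge: "(- ind_vec (- A)) $ w \<le> (Q *v g) $ w" if "Q \<in> \<Q>" for Q w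
  proof (cases "w \<in> A")
    case True
    have "(Q *v g) $ w = 0" by (rule row_zero[OF that True])
    then show ?thesis using True by (simp add: ind_vec_def)
  qed (use sub[OF that] in \<open>simp add: ind_vec_def\<close>)
  define G where "G = (\<Sum>z\<in>UNIV. g $ z)"
  have G0: "0 \<le> G" unfolding G_def by (intro sum_nonneg g)
  have gG: "g $ z \<le> (G *\<^sub>R ind_vec (- A)) $ z" for z
    using member_le_sum[of z UNIV "\<lambda>z. g $ z"] g by (auto simp: G_def ind_vec_def indicator_def)
  have T_ge: "integral {0..b} survival \<le> T" if b: "0 \<le> b" for b
  proof -
    have "ennreal (integral {0..b} survival) = (\<integral>\<^sup>+t. ennreal (survival t) * indicator {0..b} t \<partial>lborel)"
      by (rule nn_integral_survival[OF b, symmetric])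
    also have "\<dots> \<le> (\<integral>\<^sup>+t. ennreal (survival t) * indicator {0..} t \<partial>lborel)"
      by (intro nn_integral_mono) (auto split: split_indicator)
    finally show ?thesis using real by (simp add: expected_hitting_time_eq[symmetric] ennreal_le_iff)
  qed
  have main: "g $ x \<le> integral {0..b} survival + G * survival b" if b: "0 \<le> b" for b
  proof -
    have "integral {0..b} (mean_at (P h) (- ind_vec (- A))) \<le> mean_at (P h) g b - g $ x"
      by (rule mean_lower[OF ge b])
    moreover have "mean_at (P h) (- ind_vec (- A)) = (\<lambda>t. - survival t)"
      by (simp add: fun_eq_iff mean_at_uminus survival_def)
    moreover have "mean_at (P h) g b \<le> mean_at (P h) (G *\<^sub>R ind_vec (- A)) b"
      by (rule mean_at_mono[OF gG])
    moreover have "mean_at (P h) (G *\<^sub>R ind_vec (- A)) b = G * survival b"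
      by (simp add: survival_def mean_at_def sum_distrib_left algebra_simps)
    ultimately show ?thesis by simp
  qed
  \<comment> \<open>A survival function bounded below by \<delta> would have integral at least
    \<open>b * \<delta>\<close> up to \<open>b\<close>; with \<open>b = (T + 1) / \<delta>\<close>
    this exceeds \<open>T\<close>.\<close>
  have small: "\<exists>b\<ge>0. survival b < \<delta>" if \<delta>: "0 < \<delta>" for \<delta>
  proof (rule ccontr)
    assume "\<not> (\<exists>b\<ge>0. survival b < \<delta>)"
    then have ge: "\<delta> \<le> survival b" if "0 \<le> b" for b using that by (auto simp: not_less)
    have "b * \<delta> \<le> T" if b: "0 \<le> b" for b
    proof -
      have "integral {0..b} (\<lambda>_. \<delta>) \<le> integral {0..b} survival"
        using continuous_on_subset[OF survival_continuous, of "{0..b}"]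
        by (intro integral_le integrable_continuous_real) (auto intro: ge)
      then show ?thesis using T_ge[OF b] b by simp
    qed
    from this[of "(T + 1) / \<delta>"] real \<delta> show False by simp
  qed
  have "g $ x \<le> T"
  proof (rule field_le_epsilon)
    fix e :: real assume e: "0 < e"
    then obtain b where b: "0 \<le> b" "survival b < e / (G + 1)"
      using small[of "e / (G + 1)"] G0 by auto
    have "G * survival b \<le> (G + 1) * survival b" using survival_nonneg[of b] by (intro mult_right_mono) auto
    also have "\<dots> \<le> e" using b(2) G0 by (simp add: pos_less_divide_eq mult.commute)
    finally show "g $ x \<le> T + e" using main[OF b(1)] T_ge[OF b(1)] by linarith
  qed
  then show ?thesis using real by (simp add: ennreal_leI)
qed

end

section \<open>Lower and upper rate operators\<close>

locale rate_set =
  fixes \<Q> :: "(real ^ 'a ^ ('a::finite)) set"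
  assumes nonempty: "\<Q> \<noteq> {}" and compact: "compact \<Q>"
    and rate: "\<forall>Q\<in>\<Q>. rate_matrix Q" and rows: "separately_specified_rows \<Q>"
begin

abbreviation lower :: "real ^ 'a \<Rightarrow> real ^ 'a" where "lower \<equiv> lower_rate \<Q>"
abbreviation upper :: "real ^ 'a \<Rightarrow> real ^ 'a" where "upper \<equiv> upper_rate \<Q>"

text \<open>A common bound for the operator norms of the matrices in \<open>\<Q>\<close>, taken
  positive so that \<open>1 / bound\<close> is an admissible step size.\<close>

definition bound :: real
  where "bound = (SOME M. 0 < M \<and> (\<forall>Q\<in>\<Q>. \<forall>x. (\<Sum>y\<in>UNIV. \<bar>Q $ x $ y\<bar>) \<le> M))"

lemma bound: "0 < bound" "Q \<in> \<Q> \<Longrightarrow> (\<Sum>y\<in>UNIV. \<bar>Q $ x $ y\<bar>) \<le> bound"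
proof -
  obtain b where b: "\<And>Q. Q \<in> \<Q> \<Longrightarrow> norm Q \<le> b"
    using compact_imp_bounded[OF compact] unfolding bounded_iff by auto
  have entry: "\<bar>Q $ x $ y\<bar> \<le> \<bar>b\<bar>" if "Q \<in> \<Q>" for Q x y
    using component_le_norm_cart[of "Q $ x" y] Finite_Cartesian_Product.norm_nth_le[of Q x] b[OF that] by linarith
  have "(\<Sum>y\<in>UNIV. \<bar>Q $ x $ y\<bar>) \<le> real CARD('a) * \<bar>b\<bar> + 1" if "Q \<in> \<Q>" for Q x
  proof -
    have "(\<Sum>y\<in>UNIV. \<bar>Q $ x $ y\<bar>) \<le> (\<Sum>y\<in>(UNIV::'a set). \<bar>b\<bar>)" by (intro sum_mono entry that)
    then show ?thesis by simp
  qed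
  moreover have "0 < real CARD('a) * \<bar>b\<bar> + 1" by (intro add_nonneg_pos) auto
  ultimately have "\<exists>M>0. \<forall>Q\<in>\<Q>. \<forall>x. (\<Sum>y\<in>UNIV. \<bar>Q $ x $ y\<bar>) \<le> M" by blast
  from someI_ex[OF this] show "0 < bound" "Q \<in> \<Q> \<Longrightarrow> (\<Sum>y\<in>UNIV. \<bar>Q $ x $ y\<bar>) \<le> bound"
    unfolding bound_def by auto
qed

lemma abs_apply_le:
  assumes "Q \<in> \<Q>"
  shows "\<bar>(Q *v f) $ x\<bar> \<le> bound * infnorm f"
proof -
  have "\<bar>(Q *v f) $ x\<bar> \<le> (\<Sum>y\<in>UNIV. \<bar>Q $ x $ y * f $ y\<bar>)"
    unfolding matrix_vector_mult_def vec_lambda_beta by (rule sum_abs)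
  also have "\<dots> \<le> (\<Sum>y\<in>UNIV. \<bar>Q $ x $ y\<bar> * infnorm f)"
    unfolding abs_mult by (intro sum_mono mult_left_mono component_le_infnorm_cart) auto
  also have "\<dots> = (\<Sum>y\<in>UNIV. \<bar>Q $ x $ y\<bar>) * infnorm f" by (rule sum_distrib_right[symmetric])
  also have "\<dots> \<le> bound * infnorm f"
    by (intro mult_right_mono bound(2)[OF assms] infnorm_pos_le)
  finally show ?thesis .
qed

lemma continuous_apply: "continuous_on \<Q> (\<lambda>Q. (Q *v f) $ x)"
  unfolding matrix_vector_mult_def vec_lambda_beta by (intro continuous_intros)

lemma lower_le: "Q \<in> \<Q> \<Longrightarrow> lower f $ x \<le> (Q *v f) $ x"
  unfolding lower_rate_def vec_lambda_beta
proof (rule cINF_lower)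
  have "- (bound * infnorm f) \<le> (Q *v f) $ x" if "Q \<in> \<Q>" for Q
    using abs_apply_le[OF that, of f x] by linarith
  then show "bdd_below ((\<lambda>Q. (Q *v f) $ x) ` \<Q>)" by (intro bdd_belowI2)
qed

lemma upper_ge: "Q \<in> \<Q> \<Longrightarrow> (Q *v f) $ x \<le> upper f $ x"
  unfolding upper_rate_def vec_lambda_beta
proof (rule cSUP_upper)
  have "(Q *v f) $ x \<le> bound * infnorm f" if "Q \<in> \<Q>" for Q
    using abs_apply_le[OF that, of f x] by linarith
  then show "bdd_above ((\<lambda>Q. (Q *v f) $ x) ` \<Q>)" by (intro bdd_aboveI2)
qed

lemma row_selection:
  assumes "\<And>x. \<exists>Q\<in>\<Q>. (Q *v f) $ x = c x"
  shows "\<exists>Q\<in>\<Q>. \<forall>x. (Q *v f) $ x = c x"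
proof -
  have "\<forall>x. \<exists>Q. Q \<in> \<Q> \<and> (Q *v f) $ x = c x" using assms by blast
  from choice[OF this] obtain R where R: "\<forall>x. R x \<in> \<Q> \<and> (R x *v f) $ x = c x" by (elim exE)
  show ?thesis
  proof (intro bexI allI)
    show "(\<chi> x. R x $ x) \<in> \<Q>" using rows R unfolding separately_specified_rows_def by simp
    show "((\<chi> x. R x $ x) *v f) $ x = c x" for x
      using R by (simp add: matrix_vector_mult_def)
  qed
qed

lemma lower_attained: "\<exists>Q\<in>\<Q>. \<forall>x. (Q *v f) $ x = lower f $ x"
proof (rule row_selection)
  fix x
  obtain Q where Q: "Q \<in> \<Q>" "\<forall>R\<in>\<Q>. (Q *v f) $ x \<le> (R *v f) $ x"
    using continuous_attains_inf[OF compact nonempty continuous_apply] by blast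
  then have "(Q *v f) $ x \<le> lower f $ x"
    unfolding lower_rate_def vec_lambda_beta by (intro cINF_greatest nonempty) auto
  then show "\<exists>Q\<in>\<Q>. (Q *v f) $ x = lower f $ x"
    using Q(1) lower_le[OF Q(1), of f x] by (intro bexI[of _ Q]) auto
qed

lemma upper_attained: "\<exists>Q\<in>\<Q>. \<forall>x. (Q *v f) $ x = upper f $ x"
proof (rule row_selection)
  fix x
  obtain Q where Q: "Q \<in> \<Q>" "\<forall>R\<in>\<Q>. (R *v f) $ x \<le> (Q *v f) $ x"
    using continuous_attains_sup[OF compact nonempty continuous_apply] by blast
  then have "upper f $ x \<le> (Q *v f) $ x"
    unfolding upper_rate_def vec_lambda_beta by (intro cSUP_least nonempty) auto
  then show "\<exists>Q\<in>\<Q>. (Q *v f) $ x = upper f $ x"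
    using Q(1) upper_ge[OF Q(1), of f x] by (intro bexI[of _ Q]) auto
qed

text \<open>Under \<open>d * bound <= 1\<close> the matrix \<open>I + d Q\<close> has non-negative
  entries: the off-diagonal ones always, the diagonal ones because \<open>d\<close> times the exit
  rate is at most 1.\<close>

lemma step_mono:
  assumes Q: "Q \<in> \<Q>" and d: "0 \<le> d" "d * bound \<le> 1" and le: "\<And>x. f $ x \<le> g $ x"
  shows "f $ x + d * (Q *v f) $ x \<le> g $ x + d * (Q *v g) $ x"
proof -
  have "0 \<le> (\<Sum>y\<in>UNIV. ((if x = y then 1 else 0) + d * Q $ x $ y) * (g $ y - f $ y))"
  proof (intro sum_nonneg mult_nonneg_nonneg)
    fix y
    show "0 \<le> (if x = y then 1 else 0) + d * Q $ x $ y"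
    proof (cases "x = y")
      case True
      have "\<bar>Q $ x $ x\<bar> \<le> (\<Sum>y\<in>UNIV. \<bar>Q $ x $ y\<bar>)" by (rule member_le_sum) auto
      then have "\<bar>Q $ x $ x\<bar> \<le> bound" using bound(2)[OF Q, of x] by linarith
      then have "d * \<bar>Q $ x $ x\<bar> \<le> 1" using d mult_left_mono[of "\<bar>Q $ x $ x\<bar>" bound d] by linarith
      moreover have "- (d * \<bar>Q $ x $ x\<bar>) \<le> d * Q $ x $ x"
        using mult_left_mono[of "- \<bar>Q $ x $ x\<bar>" "Q $ x $ x" d] d by simp
      ultimately show ?thesis using True by simp
    next
      case False
      then show ?thesis using Q rate d by (simp add: rate_matrix_def)
    qed
  qed (use le in simp)
  also have "\<dots> = (g $ x + d * (Q *v g) $ x) - (f $ x + d * (Q *v f) $ x)"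
    by (simp add: matrix_vector_mult_def algebra_simps sum.distrib sum_subtractf sum_distrib_left
        if_distrib[of "\<lambda>a. _ * a"] cong: if_cong)
  finally show ?thesis by simp
qed

text \<open>Take the matrix optimal for the larger function \<open>g\<close>; for \<open>f\<close>
  it is merely admissible, so it can only overestimate \<open>lower f\<close>.\<close>

lemma lower_step_mono:
  assumes d: "0 \<le> d" "d * bound \<le> 1" and le: "\<And>x. f $ x \<le> g $ x"
  shows "f $ x + d * lower f $ x \<le> g $ x + d * lower g $ x"
proof -
  obtain Q where Q: "Q \<in> \<Q>" "\<And>x. (Q *v g) $ x = lower g $ x" using lower_attained by blast
  have "d * lower f $ x \<le> d * (Q *v f) $ x" by (intro mult_left_mono lower_le Q d)
  then show ?thesis using step_mono[OF Q(1) d le, of x] Q(2)[of x] by simp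
qed

lemma upper_step_mono:
  assumes d: "0 \<le> d" "d * bound \<le> 1" and le: "\<And>x. f $ x \<le> g $ x"
  shows "f $ x + d * upper f $ x \<le> g $ x + d * upper g $ x"
proof -
  obtain Q where Q: "Q \<in> \<Q>" "\<And>x. (Q *v f) $ x = upper f $ x" using upper_attained by blast
  have "d * (Q *v g) $ x \<le> d * upper g $ x" by (intro mult_left_mono upper_ge Q d)
  then show ?thesis using step_mono[OF Q(1) d le, of x] Q(2)[of x] by simp
qed

lemma apply_const: "Q \<in> \<Q> \<Longrightarrow> (Q *v (f + (\<chi> _. c))) $ x = (Q *v f) $ x"
  using rate by (simp add: matrix_vector_mult_def rate_matrix_def distrib_left sum.distrib
      sum_distrib_right[symmetric])

lemma lower_const: "lower (f + (\<chi> _. c)) = lower f"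
  unfolding lower_rate_def by (simp add: apply_const cong: INF_cong_simp)

lemma lower_scale:
  assumes "0 \<le> c"
  shows "lower (c *\<^sub>R f) = c *\<^sub>R lower f"
proof -
  have "lower (c *\<^sub>R f) $ x = c * lower f $ x" for x
  proof (rule antisym)
    obtain Q where Q: "Q \<in> \<Q>" "\<And>x. (Q *v f) $ x = lower f $ x" using lower_attained by blast
    show "lower (c *\<^sub>R f) $ x \<le> c * lower f $ x"
      using lower_le[OF Q(1), of "c *\<^sub>R f" x] Q(2)[of x] by (simp add: matrix_vector_mult_scaleR)
    obtain R where R: "R \<in> \<Q>" "\<And>x. (R *v (c *\<^sub>R f)) $ x = lower (c *\<^sub>R f) $ x" using lower_attained by blast
    show "c * lower f $ x \<le> lower (c *\<^sub>R f) $ x"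
      using mult_left_mono[OF lower_le[OF R(1), of f x] assms] R(2)[of x]
      by (simp add: matrix_vector_mult_scaleR)
  qed
  then show ?thesis by (simp add: vec_eq_iff)
qed

lemma lower_lipschitz: "infnorm (lower f - lower g) \<le> bound * infnorm (f - g)"
proof -
  have "lower f $ x - lower g $ x \<le> bound * infnorm (f - g)" for f g x
  proof -
    obtain Q where Q: "Q \<in> \<Q>" "\<And>x. (Q *v g) $ x = lower g $ x" using lower_attained by blast
    have "lower f $ x - lower g $ x \<le> (Q *v f) $ x - (Q *v g) $ x"
      using lower_le[OF Q(1), of f x] Q(2)[of x] by simp
    also have "\<dots> = (Q *v (f - g)) $ x" by (simp add: matrix_vector_mult_diff_distrib)
    also have "\<dots> \<le> bound * infnorm (f - g)" using abs_apply_le[OF Q(1), of "f - g" x] by linarith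
    finally show ?thesis .
  qed
  from this[of f _ g] this[of g _ f] show ?thesis
    unfolding infnorm_le_iff by (simp add: abs_le_iff infnorm_sub[of g f])
qed

lemma lower_zero: "lower 0 = 0"
  using lower_scale[of 0 0] by simp

lemma lower_norm: "infnorm (lower f) \<le> bound * infnorm f"
  using lower_lipschitz[of f 0] by (simp add: lower_zero)

section \<open>Euler steps and the lower exponential\<close>

definition euler :: "real \<Rightarrow> real ^ 'a \<Rightarrow> real ^ 'a"
  where "euler d f = f + d *\<^sub>R lower f"

text \<open>A monotone map that commutes with adding constants is nonexpansive in the supremum norm:
  apply it to \<open>f <= g + infnorm (f - g)\<close>.\<close>

lemma euler_nonexpansive:
  assumes d: "0 \<le> d" "d * bound \<le> 1"
  shows "infnorm (euler d f - euler d g) \<le> infnorm (f - g)"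
proof -
  have "euler d f $ x - euler d g $ x \<le> infnorm (f - g)" for f g x
  proof -
    have "f $ x \<le> (g + (\<chi> _. infnorm (f - g))) $ x" for x
      using component_le_infnorm_cart[of "f - g" x] by simp
    from lower_step_mono[OF d this, of x] show ?thesis
      unfolding lower_const by (simp add: euler_def)
  qed
  from this[of f _ g] this[of g _ f] show ?thesis
    unfolding infnorm_le_iff by (simp add: abs_le_iff infnorm_sub[of g f])
qed

lemma euler_zero: "euler d 0 = 0"
  by (simp add: euler_def lower_zero)

lemma euler_scale: "0 \<le> c \<Longrightarrow> euler d (c *\<^sub>R f) = c *\<^sub>R euler d f"
  by (simp add: euler_def lower_scale algebra_simps)

lemma euler_power_scale: "0 \<le> c \<Longrightarrow> (euler d ^^ n) (c *\<^sub>R f) = c *\<^sub>R (euler d ^^ n) f"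
  by (induction n) (simp_all add: euler_scale)

lemma euler_power_norm:
  assumes "0 \<le> d" "d * bound \<le> 1"
  shows "infnorm ((euler d ^^ n) f) \<le> infnorm f"
proof (induction n)
  case (Suc n)
  then show ?case
    using euler_nonexpansive[OF assms, of "(euler d ^^ n) f" 0] by (simp add: euler_zero)
qed simp

lemma euler_power_increment:
  assumes d: "0 \<le> d" "d * bound \<le> 1"
  shows "infnorm ((euler d ^^ n) f - f) \<le> real n * (d * bound * infnorm f)"
proof (induction n)
  case 0
  show ?case by (simp add: infnorm_0)
next
  case (Suc n)
  have eq: "(euler d ^^ Suc n) f - f = ((euler d ^^ n) f - f) + d *\<^sub>R lower ((euler d ^^ n) f)"
    by (simp add: euler_def)
  have "infnorm ((euler d ^^ Suc n) f - f) \<le>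
      infnorm ((euler d ^^ n) f - f) + d * infnorm (lower ((euler d ^^ n) f))"
    unfolding eq using infnorm_triangle[of "(euler d ^^ n) f - f" "d *\<^sub>R lower ((euler d ^^ n) f)"] d(1)
    by (simp add: infnorm_mul)
  moreover have "d * infnorm (lower ((euler d ^^ n) f)) \<le> d * (bound * infnorm f)"
    using lower_norm[of "(euler d ^^ n) f"] euler_power_norm[OF d, of n f] bound(1) d(1)
    by (intro mult_left_mono) (auto intro: order_trans mult_left_mono)
  ultimately show ?case using Suc by (simp add: algebra_simps)
qed

text \<open>Small steps versus one long step: the \<open>n\<close>-th small step evaluates
  \<open>lower\<close> at a point that has moved by at most
  \<open>n * d * bound * infnorm f\<close>, so by the Lipschitz bound it adds an error of order
  \<open>n * (d * bound)^2\<close>, and these sum to at most the square.\<close>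

lemma euler_power_local_error:
  assumes d: "0 \<le> d" "d * bound \<le> 1"
  shows "infnorm ((euler d ^^ n) f - euler (real n * d) f) \<le> (real n * (d * bound))\<^sup>2 * infnorm f"
proof (induction n)
  case 0
  show ?case by (simp add: euler_def infnorm_0)
next
  case (Suc n)
  let ?g = "(euler d ^^ n) f" and ?b = "d * bound"
  have "(euler d ^^ Suc n) f - euler (real (Suc n) * d) f =
      (?g - euler (real n * d) f) + d *\<^sub>R (lower ?g - lower f)"
    by (simp add: euler_def algebra_simps)
  then have "infnorm ((euler d ^^ Suc n) f - euler (real (Suc n) * d) f) \<le>
      infnorm (?g - euler (real n * d) f) + d * infnorm (lower ?g - lower f)"
    using infnorm_triangle[of "?g - euler (real n * d) f" "d *\<^sub>R (lower ?g - lower f)"] d(1)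
    by (simp add: infnorm_mul)
  also have "d * infnorm (lower ?g - lower f) \<le> d * (bound * (real n * (?b * infnorm f)))"
    using lower_lipschitz[of ?g f] mult_left_mono[OF euler_power_increment[OF d, of n f], of bound] bound(1)
    by (intro mult_left_mono d(1)) linarith
  also have "\<dots> = real n * ?b\<^sup>2 * infnorm f" by (simp add: power2_eq_square)
  also note Suc
  finally have "infnorm ((euler d ^^ Suc n) f - euler (real (Suc n) * d) f) \<le>
      ((real n * ?b)\<^sup>2 + real n * ?b\<^sup>2) * infnorm f" by (simp add: algebra_simps)
  also have "\<dots> \<le> (real (Suc n) * ?b)\<^sup>2 * infnorm f"
  proof (intro mult_right_mono infnorm_pos_le)
    have "(real (Suc n) * ?b)\<^sup>2 = (real n * ?b)\<^sup>2 + real n * ?b\<^sup>2 + (real n + 1) * ?b\<^sup>2"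
      by (simp add: power2_eq_square algebra_simps)
    then show "(real n * ?b)\<^sup>2 + real n * ?b\<^sup>2 \<le> (real (Suc n) * ?b)\<^sup>2" by simp
  qed
  finally show ?case .
qed

text \<open>Each coarse step commits one local error, and nonexpansiveness carries earlier errors
  along without amplification. With total time \<open>t\<close>, \<open>n\<close> local errors of
  order \<open>(t / n)^2\<close> leave a global error of order \<open>1 / n\<close>.\<close>

lemma euler_refine:
  assumes d: "0 \<le> d" "real k * d * bound \<le> 1" and k: "0 < k"
  shows "infnorm ((euler (real k * d) ^^ n) f - (euler d ^^ (k * n)) f) \<le>
    real n * ((real k * (d * bound))\<^sup>2 * infnorm f)"
proof (induction n)
  case 0
  show ?case by (simp add: infnorm_0)
next
  case (Suc n)
  have kd: "0 \<le> real k * d" using d by simp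
  have "d * bound * 1 \<le> d * bound * real k"
    using d(1) bound(1) k by (intro mult_left_mono) auto
  then have d': "d * bound \<le> 1" using d(2) by (simp add: mult.commute mult.left_commute)
  let ?S = "euler (real k * d)" and ?R = "euler d ^^ k"
  let ?a = "(?S ^^ n) f" and ?b = "(euler d ^^ (k * n)) f"
  have "(euler d ^^ (k * Suc n)) f = ?R ?b" by (simp add: funpow_add)
  then have "(?S ^^ Suc n) f - (euler d ^^ (k * Suc n)) f = (?S ?a - ?S ?b) + (?S ?b - ?R ?b)" by simp
  then have "infnorm ((?S ^^ Suc n) f - (euler d ^^ (k * Suc n)) f) \<le>
      infnorm (?S ?a - ?S ?b) + infnorm (?S ?b - ?R ?b)"
    using infnorm_triangle by metis
  also have "infnorm (?S ?a - ?S ?b) \<le> infnorm (?a - ?b)"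
    by (rule euler_nonexpansive[OF kd d(2)])
  also note Suc
  also have "infnorm (?S ?b - ?R ?b) \<le> (real k * (d * bound))\<^sup>2 * infnorm ?b"
    using euler_power_local_error[OF d(1) d', of k ?b] by (simp add: infnorm_sub)
  also have "\<dots> \<le> (real k * (d * bound))\<^sup>2 * infnorm f"
    by (intro mult_left_mono euler_power_norm[OF d(1) d']) simp
  finally show ?case by (simp add: algebra_simps)
qed

definition euler_iter :: "real \<Rightarrow> nat \<Rightarrow> real ^ 'a \<Rightarrow> real ^ 'a"
  where "euler_iter t n = (\<lambda>g. g + (t / real n) *\<^sub>R lower g) ^^ n"

lemma euler_iter_eq: "euler_iter t n = euler (t / real n) ^^ n"
  by (simp add: euler_iter_def euler_def[abs_def])

lemma euler_iter_refine:
  assumes t: "0 \<le> t" and n: "t * bound \<le> real n" "0 < n" and k: "0 < k"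
  shows "infnorm (euler_iter t n f - euler_iter t (k * n) f) \<le> (t * bound)\<^sup>2 * infnorm f / real n"
proof -
  let ?d = "t / real (k * n)"
  have kd: "real k * ?d = t / real n" using k by simp
  have "infnorm ((euler (real k * ?d) ^^ n) f - (euler ?d ^^ (k * n)) f) \<le>
    real n * ((real k * (?d * bound))\<^sup>2 * infnorm f)"
    using t n k by (intro euler_refine) (auto simp: field_simps)
  moreover have "real n * ((real k * (?d * bound))\<^sup>2 * infnorm f) = (t * bound)\<^sup>2 * infnorm f / real n"
    using n k by (simp add: power2_eq_square field_simps)
  ultimately show ?thesis unfolding euler_iter_eq kd by simp
qed

text \<open>Both iterates are compared with their common refinement into \<open>m * n\<close>
  steps.\<close>

lemma euler_iter_cauchy:
  assumes t: "0 \<le> t" and n: "t * bound \<le> real n" "0 < n" and m: "t * bound \<le> real m" "0 < m"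
  shows "infnorm (euler_iter t n f - euler_iter t m f) \<le> (t * bound)\<^sup>2 * infnorm f * (1 / real n + 1 / real m)"
proof -
  let ?U = "\<lambda>n. euler_iter t n f"
  have "infnorm (?U n - ?U m) \<le> infnorm (?U n - ?U (m * n)) + infnorm (?U (m * n) - ?U m)"
    using infnorm_triangle[of "?U n - ?U (m * n)" "?U (m * n) - ?U m"] by simp
  moreover have "infnorm (?U n - ?U (m * n)) \<le> (t * bound)\<^sup>2 * infnorm f / real n"
    by (rule euler_iter_refine[OF t n m(2)])
  moreover have "infnorm (?U (m * n) - ?U m) \<le> (t * bound)\<^sup>2 * infnorm f / real m"
    using euler_iter_refine[OF t m n(2), of f] by (simp add: infnorm_sub mult.commute)
  ultimately show ?thesis by (simp add: algebra_simps)
qed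

lemma euler_iter_convergent:
  assumes t: "0 \<le> t"
  shows "convergent (\<lambda>n. euler_iter t n f)"
proof (rule Cauchy_convergent, rule metric_CauchyI)
  fix e :: real assume e: "0 < e"
  \<comment> \<open>The square root of the dimension passes from the supremum norm to the Euclidean
    norm, in which \<open>dist\<close> is measured.\<close>
  define C where "C = sqrt (real DIM(real ^ 'a)) * ((t * bound)\<^sup>2 * infnorm f)"
  have C: "0 \<le> C" unfolding C_def by (intro mult_nonneg_nonneg infnorm_pos_le) auto
  obtain N :: nat where N: "max (t * bound) (2 * C / e) < real N" using reals_Archimedean2 by blast
  have N0: "0 < real N" using N t bound(1) mult_nonneg_nonneg[of t bound] by linarith
  show "\<exists>N. \<forall>n\<ge>N. \<forall>m\<ge>N. dist (euler_iter t n f) (euler_iter t m f) < e"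
  proof (intro exI allI impI)
    fix n m assume nm: "N \<le> n" "N \<le> m"
    have n: "t * bound \<le> real n" "0 < n" and m: "t * bound \<le> real m" "0 < m"
      using N N0 nm by auto
    have "dist (euler_iter t n f) (euler_iter t m f) \<le>
        sqrt (real DIM(real ^ 'a)) * infnorm (euler_iter t n f - euler_iter t m f)"
      unfolding dist_norm by (rule norm_le_infnorm)
    also have "\<dots> \<le> sqrt (real DIM(real ^ 'a)) * ((t * bound)\<^sup>2 * infnorm f * (1 / real n + 1 / real m))"
      by (intro mult_left_mono euler_iter_cauchy[OF t n m]) simp
    also have "\<dots> = C * (1 / real n + 1 / real m)" by (simp add: C_def)
    also have "\<dots> \<le> C * (1 / real N + 1 / real N)"
      using nm N0 C by (intro mult_left_mono add_mono divide_left_mono) auto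
    also have "\<dots> < e" using N N0 e by (simp add: field_simps)
    finally show "dist (euler_iter t n f) (euler_iter t m f) < e" .
  qed
qed

text \<open>As \<open>op_exp\<close> is a definite description, the limit must be shown to exist in
  operator norm and to be unique. Existence follows from an error estimate proportional to
  \<open>infnorm f\<close>; uniqueness holds on the unit sphere and extends by homogeneity.\<close>

lemma euler_iter_tendsto_op_exp:
  assumes t: "0 \<le> t"
  shows "(\<lambda>n. euler_iter t n f) \<longlonglongrightarrow> op_exp lower t f"
proof -
  define E where "E f = lim (\<lambda>n. euler_iter t n f)" for f
  have E: "(\<lambda>n. euler_iter t n f) \<longlonglongrightarrow> E f" for f
    unfolding E_def using euler_iter_convergent[OF t] by (simp add: convergent_LIMSEQ_iff)
  have hom: "nonneg_homogeneous E"
    unfolding nonneg_homogeneous_def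
  proof (intro allI impI)
    fix c :: real and f assume "0 \<le> c"
    then have "(\<lambda>n. euler_iter t n (c *\<^sub>R f)) = (\<lambda>n. c *\<^sub>R euler_iter t n f)"
      by (simp add: euler_iter_eq euler_power_scale)
    then have "(\<lambda>n. c *\<^sub>R euler_iter t n f) \<longlonglongrightarrow> E (c *\<^sub>R f)" using E[of "c *\<^sub>R f"] by simp
    moreover have "(\<lambda>n. c *\<^sub>R euler_iter t n f) \<longlonglongrightarrow> c *\<^sub>R E f" by (intro tendsto_intros E)
    ultimately show "E (c *\<^sub>R f) = c *\<^sub>R E f" by (rule LIMSEQ_unique)
  qed
  have err: "infnorm (euler_iter t n f - E f) \<le> (t * bound)\<^sup>2 * infnorm f / real n"
    if n: "t * bound \<le> real n" "0 < n" for n f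
  proof (rule LIMSEQ_le)
    show "(\<lambda>m. infnorm (euler_iter t n f - euler_iter t m f)) \<longlonglongrightarrow> infnorm (euler_iter t n f - E f)"
      by (intro tendsto_intros E)
    have "(\<lambda>m. (t * bound)\<^sup>2 * infnorm f * (1 / real n + 1 / real m)) \<longlonglongrightarrow>
        (t * bound)\<^sup>2 * infnorm f * (1 / real n + 0)"
      by (intro tendsto_intros lim_1_over_n)
    then show "(\<lambda>m. (t * bound)\<^sup>2 * infnorm f * (1 / real n + 1 / real m)) \<longlonglongrightarrow>
        (t * bound)\<^sup>2 * infnorm f / real n" by simp
    obtain N :: nat where N: "max (t * bound) 0 < real N" using reals_Archimedean2 by blast
    show "\<exists>N. \<forall>m\<ge>N. infnorm (euler_iter t n f - euler_iter t m f) \<le>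
        (t * bound)\<^sup>2 * infnorm f * (1 / real n + 1 / real m)"
      using N by (intro exI[of _ N] allI impI euler_iter_cauchy[OF t n]) auto
  qed
  have conv: "(\<lambda>n. op_norm (\<lambda>f. euler_iter t n f - E f)) \<longlonglongrightarrow> 0"
  proof (rule tendsto_sandwich[OF _ _ tendsto_const])
    have "(\<lambda>n. (t * bound)\<^sup>2 * (1 / real n)) \<longlonglongrightarrow> (t * bound)\<^sup>2 * 0"
      by (intro tendsto_intros lim_1_over_n)
    then show "(\<lambda>n. ennreal ((t * bound)\<^sup>2 / real n)) \<longlonglongrightarrow> 0"
      using tendsto_ennrealI by fastforce
    obtain N :: nat where N: "max (t * bound) 0 < real N" using reals_Archimedean2 by blast
    show "eventually (\<lambda>n. op_norm (\<lambda>f. euler_iter t n f - E f) \<le> ennreal ((t * bound)\<^sup>2 / real n)) sequentially"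
      using eventually_ge_at_top[of N]
    proof eventually_elim
      case (elim n)
      then have n: "t * bound \<le> real n" "0 < n" using N by auto
      show ?case
        unfolding op_norm_def
      proof (rule SUP_least, rule ennreal_leI)
        fix f :: "real ^ 'a" assume "f \<in> {f. infnorm f = 1}"
        then show "infnorm (euler_iter t n f - E f) \<le> (t * bound)\<^sup>2 / real n"
          using err[OF n, of f] by simp
      qed
    qed
  qed simp
  have uniq: "E' = E"
    if hom': "nonneg_homogeneous E'" and conv': "(\<lambda>n. op_norm (\<lambda>f. euler_iter t n f - E' f)) \<longlonglongrightarrow> 0" for E'
  proof
    have unit: "E' f = E f" if f: "infnorm f = 1" for f
    proof -
      have "(\<lambda>n. ennreal (infnorm (euler_iter t n f - E' f))) \<longlonglongrightarrow> 0"
      proof (rule tendsto_sandwich[OF _ _ tendsto_const conv'])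
        show "eventually (\<lambda>n. ennreal (infnorm (euler_iter t n f - E' f)) \<le>
            op_norm (\<lambda>f. euler_iter t n f - E' f)) sequentially"
          unfolding op_norm_def using f by (intro always_eventually allI SUP_upper) simp
      qed simp
      moreover have "(\<lambda>n. ennreal (infnorm (euler_iter t n f - E' f))) \<longlonglongrightarrow> ennreal (infnorm (E f - E' f))"
        by (intro tendsto_ennrealI tendsto_intros E)
      ultimately have "ennreal (infnorm (E f - E' f)) = 0" by (rule LIMSEQ_unique[rotated])
      then have "infnorm (E f - E' f) \<le> 0" by (simp add: ennreal_eq_0_iff)
      then show ?thesis using infnorm_pos_le[of "E f - E' f"] infnorm_eq_0[of "E f - E' f"] by simp
    qed
    fix f
    show "E' f = E f"
    proof (cases "f = 0")
      case True
      have "F 0 = 0" if "nonneg_homogeneous F" for F :: "real ^ 'a \<Rightarrow> real ^ 'a"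
      proof -
        have "F (0 *\<^sub>R 0) = 0 *\<^sub>R F 0" using that unfolding nonneg_homogeneous_def by blast
        then show ?thesis by simp
      qed
      from this[OF hom] this[OF hom'] True show ?thesis by simp
    next
      case False
      define c where "c = infnorm f"
      have c: "0 < c" using False by (simp add: c_def infnorm_pos_lt)
      define g where "g = (1 / c) *\<^sub>R f"
      have f: "f = c *\<^sub>R g" using c by (simp add: g_def)
      have "infnorm g = 1" using c by (simp add: g_def infnorm_mul c_def[symmetric])
      from unit[OF this] show ?thesis
        using hom hom' c unfolding nonneg_homogeneous_def f by (simp add: less_imp_le)
    qed
  qed
  have "op_exp lower t = E"
    unfolding op_exp_def
  proof (rule the_equality)
    show "nonneg_homogeneous E \<and>
        (\<lambda>n. op_norm (\<lambda>f. ((\<lambda>g. g + (t / real n) *\<^sub>R lower g) ^^ n) f - E f)) \<longlonglongrightarrow> 0"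
      using hom conv unfolding euler_iter_def by simp
    show "E' = E" if "nonneg_homogeneous E' \<and>
        (\<lambda>n. op_norm (\<lambda>f. ((\<lambda>g. g + (t / real n) *\<^sub>R lower g) ^^ n) f - E' f)) \<longlonglongrightarrow> 0" for E'
      using uniq[of E'] that unfolding euler_iter_def by simp
  qed
  then show ?thesis using E by simp
qed

end

section \<open>The hitting time systems\<close>

text \<open>Products are componentwise, so the indicators split the system: off \<open>A\<close> it
  reads \<open>0 = 1 + r $ x\<close>.\<close>

lemma hitting_system_iff:
  "ind_vec A * g = ind_vec (- A) + ind_vec (- A) * r \<longleftrightarrow>
    (\<forall>x\<in>A. g $ x = 0) \<and> (\<forall>x. x \<notin> A \<longrightarrow> r $ x = - 1)"
proof -
  have "(ind_vec A * g) $ x = (ind_vec (- A) + ind_vec (- A) * r) $ x \<longleftrightarrow>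
      (if x \<in> A then g $ x = 0 else r $ x = - 1)" for x
    by (auto simp: ind_vec_def)
  then show ?thesis unfolding vec_eq_iff by (metis (full_types))
qed

text \<open>A Knaster--Tarski argument: the pointwise infimum of the supersolutions is a fixed point.\<close>

lemma minimal_solution_exists:
  fixes L :: "real ^ 'a \<Rightarrow> real ^ ('a::finite)"
  assumes d: "0 < d"
    and mono: "\<And>f g x. (\<And>x. f $ x \<le> g $ x) \<Longrightarrow> f $ x + d * L f $ x \<le> g $ x + d * L g $ x"
    and zero: "L 0 = 0"
    and w: "\<And>x. 0 \<le> w $ x" "\<And>x. x \<notin> A \<Longrightarrow> L w $ x \<le> - 1"
  shows "\<exists>h. minimal_nonneg_solution (\<lambda>h. ind_vec A * h = ind_vec (- A) + ind_vec (- A) * L h) h"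
proof -
  \<comment> \<open>One Euler step off \<open>A\<close>, plus the elapsed time \<open>d\<close>. As
    \<open>d\<close> is positive, the fixed points are exactly the solutions of the system.\<close>
  define \<Phi> where "\<Phi> g = (\<chi> x. if x \<in> A then 0 else d + (g $ x + d * L g $ x))" for g
  define S where "S = {g. (\<forall>x. 0 \<le> g $ x) \<and> (\<forall>x. \<Phi> g $ x \<le> g $ x)}"
  define h :: "real ^ 'a" where "h = (\<chi> x. INF g\<in>S. g $ x)"
  have \<Phi>_mono: "\<Phi> f $ x \<le> \<Phi> g $ x" if "\<And>x. f $ x \<le> g $ x" for f g x
    using mono[OF that, of x] by (simp add: \<Phi>_def)
  have \<Phi>_nonneg: "0 \<le> \<Phi> g $ x" if "\<And>x. 0 \<le> g $ x" for g x
  proof -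
    have "\<Phi> 0 $ x \<le> \<Phi> g $ x" using that by (intro \<Phi>_mono) simp
    moreover have "0 \<le> \<Phi> 0 $ x" using d by (simp add: \<Phi>_def zero)
    ultimately show ?thesis by linarith
  qed
  have "w \<in> S"
  proof -
    have "\<Phi> w $ x \<le> w $ x" for x
    proof (cases "x \<in> A")
      case False
      then show ?thesis using mult_left_mono[OF w(2)[OF False], of d] d by (simp add: \<Phi>_def)
    qed (simp add: \<Phi>_def w(1))
    then show ?thesis using w(1) by (simp add: S_def)
  qed
  then have S_ne: "S \<noteq> {}" by blast
  have h_le: "h $ x \<le> g $ x" if "g \<in> S" for g x
  proof -
    have "bdd_below ((\<lambda>g. g $ x) ` S)" by (rule bdd_belowI2[of _ 0]) (simp add: S_def)
    then show ?thesis unfolding h_def vec_lambda_beta by (rule cINF_lower[OF _ that])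
  qed
  have h_greatest: "a \<le> h $ x" if "\<And>g. g \<in> S \<Longrightarrow> a \<le> g $ x" for a x
    unfolding h_def vec_lambda_beta by (rule cINF_greatest[OF S_ne that])
  have h_nonneg: "0 \<le> h $ x" for x by (rule h_greatest) (simp add: S_def)
  have \<Phi>h_le: "\<Phi> h $ x \<le> h $ x" for x
  proof (rule h_greatest)
    fix g assume g: "g \<in> S"
    have "\<Phi> h $ x \<le> \<Phi> g $ x" by (rule \<Phi>_mono[OF h_le[OF g]])
    also have "\<dots> \<le> g $ x" using g by (simp add: S_def)
    finally show "\<Phi> h $ x \<le> g $ x" .
  qed
  have "\<Phi> h \<in> S"
    unfolding S_def using \<Phi>_nonneg[OF h_nonneg] \<Phi>_mono[OF \<Phi>h_le] by simp
  then have fixed: "\<Phi> h $ x = h $ x" for x using h_le[of "\<Phi> h" x] \<Phi>h_le[of x] by simp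
  have "minimal_nonneg_solution (\<lambda>h. ind_vec A * h = ind_vec (- A) + ind_vec (- A) * L h) h"
    unfolding minimal_nonneg_solution_def hitting_system_iff
  proof (intro conjI allI ballI impI; (elim conjE)?)
    fix x assume "x \<in> A"
    then show "h $ x = 0" using fixed[of x] by (simp add: \<Phi>_def)
  next
    fix x assume "x \<notin> A"
    then have "d * (L h $ x + 1) = 0" using fixed[of x] by (simp add: \<Phi>_def algebra_simps)
    then show "L h $ x = - 1" using d by simp
  next
    fix g x
    assume g: "\<forall>x\<in>A. g $ x = 0" "\<forall>x. x \<notin> A \<longrightarrow> L g $ x = - 1" "\<forall>x. 0 \<le> g $ x"
    then have "\<Phi> g $ x \<le> g $ x" for x by (simp add: \<Phi>_def)
    then have "g \<in> S" using g(3) by (simp add: S_def)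
    then show "h $ x \<le> g $ x" by (rule h_le)
  qed (rule h_nonneg)
  then show ?thesis ..
qed

locale hitting_rate_set = rate_set \<Q> for \<Q> :: "(real ^ 'a ^ ('a::finite)) set" +
  fixes A :: "'a set"
  assumes proper: "A \<noteq> UNIV"
    and absorbing: "\<forall>Q\<in>\<Q>. \<forall>x\<in>A. Q $ x $ x = 0"
    and reachable: "\<forall>t>0. \<forall>x\<in>-A. op_exp (lower_rate \<Q>) t (ind_vec A) $ x > 0"
begin

lemma lower_absorbing: "x \<in> A \<Longrightarrow> lower f $ x = 0"
proof -
  assume x: "x \<in> A"
  obtain Q where Q: "Q \<in> \<Q>" "\<forall>x. (Q *v f) $ x = lower f $ x" by (rule bexE[OF lower_attained])
  have "rate_matrix Q" "Q $ x $ x = 0" using rate absorbing Q(1) x by blast+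
  then have "Q $ x $ y = 0" for y by (rule rate_matrix_absorbing_row)
  then have "(Q *v f) $ x = 0" by (simp add: matrix_vector_mult_def)
  then show ?thesis using Q(2) by simp
qed

text \<open>The Euler step is monotone, fixes the constants 0 and 1, and leaves values on
  \<open>A\<close> unchanged since the rows there vanish.\<close>

lemma euler_power_bounds:
  assumes d: "0 \<le> d" "d * bound \<le> 1"
  shows "0 \<le> (euler d ^^ n) (ind_vec A) $ x" "(euler d ^^ n) (ind_vec A) $ x \<le> 1"
    "x \<in> A \<Longrightarrow> (euler d ^^ n) (ind_vec A) $ x = 1"
proof -
  have "(\<forall>x. 0 \<le> (euler d ^^ n) (ind_vec A) $ x) \<and> (\<forall>x. (euler d ^^ n) (ind_vec A) $ x \<le> 1) \<and>
      (\<forall>x\<in>A. (euler d ^^ n) (ind_vec A) $ x = 1)"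
  proof (induction n)
    case 0
    show ?case by (simp add: ind_vec_def)
  next
    case (Suc n)
    let ?g = "(euler d ^^ n) (ind_vec A)"
    have "(0::real ^ 'a) $ x + d * lower 0 $ x \<le> ?g $ x + d * lower ?g $ x" for x
      using Suc by (intro lower_step_mono d) simp
    moreover have "?g $ x + d * lower ?g $ x \<le> (0 + (\<chi> _. 1)) $ x + d * lower (0 + (\<chi> _. 1)) $ x" for x
      using Suc by (intro lower_step_mono d) simp
    moreover have "(euler d ^^ Suc n) (ind_vec A) $ x = ?g $ x + d * lower ?g $ x" for x
      by (simp add: euler_def[of d ?g])
    ultimately show ?case
      using Suc unfolding lower_const by (simp del: funpow.simps add: lower_zero lower_absorbing)
  qed
  then show "0 \<le> (euler d ^^ n) (ind_vec A) $ x" "(euler d ^^ n) (ind_vec A) $ x \<le> 1"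
    "x \<in> A \<Longrightarrow> (euler d ^^ n) (ind_vec A) $ x = 1" by simp_all
qed

text \<open>
  Summing the iterates \<open>v\<^sub>k = 1 - (I + d lower)\<^sup>k 1\<^sub>A\<close> telescopes: \<open>v\<^sub>k + d Q v\<^sub>k \<le> v\<^sub>k\<^sub>+\<^sub>1\<close> for every \<open>Q\<close>.
\<close>

lemma supersolution_exists:
  "\<exists>w. (\<forall>x. 0 \<le> w $ x) \<and> (\<forall>Q\<in>\<Q>. \<forall>x. x \<notin> A \<longrightarrow> (Q *v w) $ x \<le> - 1)"
proof -
  have conv: "(\<lambda>n. euler_iter 1 n (ind_vec A)) \<longlonglongrightarrow> op_exp lower 1 (ind_vec A)"
    by (rule euler_iter_tendsto_op_exp) simp
  \<comment> \<open>Reachability speaks of the limit. Since \<open>- A\<close> is finite, positivity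
    on it already holds for some iterate, with \<open>n\<close> large enough for the step
    \<open>1 / n\<close> to be monotone.\<close>
  have "eventually (\<lambda>n. \<forall>x\<in>-A. 0 < euler_iter 1 n (ind_vec A) $ x) sequentially"
  proof (intro eventually_ball_finite ballI)
    fix x assume "x \<in> - A"
    then have "0 < op_exp lower 1 (ind_vec A) $ x" using reachable by simp
    then show "eventually (\<lambda>n. 0 < euler_iter 1 n (ind_vec A) $ x) sequentially"
      by (rule order_tendstoD(1)[OF tendsto_vec_nth[OF conv]])
  qed simp
  note pos = this
  obtain N :: nat where N: "bound < real N" by (rule exE[OF reals_Archimedean2])
  have "eventually (\<lambda>n. (\<forall>x\<in>-A. 0 < euler_iter 1 n (ind_vec A) $ x) \<and> N \<le> n) sequentially"
    by (rule eventually_conj[OF pos eventually_ge_at_top])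
  from eventually_happens'[OF sequentially_bot this]
  obtain n where n: "\<forall>x\<in>-A. 0 < euler_iter 1 n (ind_vec A) $ x" "N \<le> n" by (elim exE conjE)
  define d where "d = 1 / real n"
  have n0: "0 < real n" using N n(2) bound(1) by linarith
  have d: "0 < d" "d * bound \<le> 1" using n0 N n(2) by (auto simp: d_def)
  note d' = less_imp_le[OF d(1)] d(2)
  let ?T = "\<lambda>k. (euler d ^^ k) (ind_vec A)"
  define c where "c = Min ((\<lambda>x. ?T n $ x) ` (- A))"
  have c: "0 < c" "x \<notin> A \<Longrightarrow> c \<le> ?T n $ x" for x
  proof -
    have "- A \<noteq> {}" using proper by auto
    then show "0 < c" using n(1) by (simp add: c_def euler_iter_eq d_def)
    show "c \<le> ?T n $ x" if "x \<notin> A" using that by (simp add: c_def)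
  qed
  define v where "v k = (\<chi> _. 1) - ?T k" for k
  \<comment> \<open>Off \<open>A\<close> the telescoped sum gives
    \<open>d * Q (sum of v k) <= v n - v 0 <= - c\<close>, as \<open>v 0 = 1\<close> and
    \<open>v n <= 1 - c\<close> there; the factor \<open>d / c\<close> normalises this to
    \<open>- 1\<close>.\<close>
  define w where "w = (d / c) *\<^sub>R (\<Sum>k<n. v k)"
  have v_nonneg: "0 \<le> v k $ x" for k x using euler_power_bounds(2)[OF d', of k x] by (simp add: v_def)
  have "0 \<le> w $ x" for x
  proof -
    have "0 \<le> (d / c) * (\<Sum>k<n. v k $ x)"
      using c(1) d(1) by (intro mult_nonneg_nonneg sum_nonneg v_nonneg) simp
    then show ?thesis by (simp add: w_def)
  qed
  moreover have "(Q *v w) $ x \<le> - 1" if Q: "Q \<in> \<Q>" and x: "x \<notin> A" for Q x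
  proof -
    have step: "d * (Q *v v k) $ x \<le> v (Suc k) $ x - v k $ x" for k
    proof -
      have "(Q *v v k) $ x = - (Q *v ?T k) $ x"
        using apply_const[OF Q, of "- ?T k" 1 x]
        by (simp add: v_def matrix_vector_mult_def sum_negf)
      moreover have "d * lower (?T k) $ x \<le> d * (Q *v ?T k) $ x"
        by (intro mult_left_mono lower_le Q d')
      ultimately show ?thesis by (simp add: v_def euler_def)
    qed
    have "d * (Q *v (\<Sum>k<n. v k)) $ x = (\<Sum>k<n. d * (Q *v v k) $ x)"
      by (simp add: matrix_vector_mult_def sum_distrib_left sum.swap[of _ _ "{..<n}"])
    also have "\<dots> \<le> (\<Sum>k<n. v (Suc k) $ x - v k $ x)" by (intro sum_mono step)
    also have "\<dots> = v n $ x - v 0 $ x" by (rule sum_lessThan_telescope)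
    also have "\<dots> \<le> - c" using x c(2)[OF x] by (simp add: v_def ind_vec_def)
    finally have "d * (Q *v (\<Sum>k<n. v k)) $ x \<le> - c" .
    moreover have "(Q *v w) $ x = (d * (Q *v (\<Sum>k<n. v k)) $ x) / c"
      by (simp add: w_def matrix_vector_mult_scaleR)
    ultimately show ?thesis using c(1) by (simp add: pos_divide_le_eq)
  qed
  ultimately show ?thesis by blast
qed

lemma step_size: "0 < 1 / bound" "1 / bound * bound \<le> 1"
  using bound(1) by simp_all

lemma upper_zero: "upper 0 = 0"
proof -
  have "upper 0 $ x = 0" for x
  proof -
    obtain Q where "Q \<in> \<Q>" "\<forall>x. (Q *v 0) $ x = upper 0 $ x" by (rule bexE[OF upper_attained])
    then show ?thesis by simp
  qed
  then show ?thesis by (simp add: vec_eq_iff)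
qed

lemma lower_solution_exists:
  "\<exists>h. minimal_nonneg_solution (\<lambda>h. ind_vec A * h = ind_vec (- A) + ind_vec (- A) * lower h) h"
proof -
  obtain w where w: "\<forall>x. 0 \<le> w $ x" "\<forall>Q\<in>\<Q>. \<forall>x. x \<notin> A \<longrightarrow> (Q *v w) $ x \<le> - 1"
    using supersolution_exists by (elim exE conjE)
  obtain Q where Q: "Q \<in> \<Q>" "\<forall>x. (Q *v w) $ x = lower w $ x" by (rule bexE[OF lower_attained])
  show ?thesis
    using w(1) bspec[OF w(2) Q(1)] Q(2) step_size lower_zero lower_step_mono[of "1 / bound"]
    by (intro minimal_solution_exists[of "1 / bound" _ w]) simp_all
qed

lemma upper_solution_exists:
  "\<exists>h. minimal_nonneg_solution (\<lambda>h. ind_vec A * h = ind_vec (- A) + ind_vec (- A) * upper h) h"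
proof -
  obtain w where w: "\<forall>x. 0 \<le> w $ x" "\<forall>Q\<in>\<Q>. \<forall>x. x \<notin> A \<longrightarrow> (Q *v w) $ x \<le> - 1"
    using supersolution_exists by (elim exE conjE)
  obtain Q where Q: "Q \<in> \<Q>" "\<forall>x. (Q *v w) $ x = upper w $ x" by (rule bexE[OF upper_attained])
  show ?thesis
    using w(1) bspec[OF w(2) Q(1)] Q(2) step_size upper_zero upper_step_mono[of "1 / bound"]
    by (intro minimal_solution_exists[of "1 / bound" _ w]) simp_all
qed

lemma homogeneous_process:
  assumes "Q \<in> \<Q>"
  obtains P where "P \<in> imprecise_HM \<Q>" "stochastic_process P" "consistent {Q} P"
proof -
  have "rate_matrix Q" using assms rate by blast
  then obtain P where P: "homogeneous_markov_chain P" "has_rate_matrix P Q"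
    by (rule rate_matrix_process_exists)
  show ?thesis
  proof (rule that)
    show "P \<in> imprecise_HM \<Q>" using P assms by (auto simp: imprecise_HM_def)
    show "stochastic_process P" using P(1) by (simp add: homogeneous_markov_chain_def markov_chain_def)
    show "consistent {Q} P" by (rule homogeneous_consistent[OF P])
  qed
qed

text \<open>The two inclusions treat the three sets of processes at once: one chain in the smallest
  set gives one inequality, all processes of the largest the other. Since \<open>h\<close> is an
  arbitrary non-negative solution, the system has only one.\<close>

lemma lower_hitting_time_eq:
  assumes \<P>: "imprecise_HM \<Q> \<subseteq> \<P>" "\<P> \<subseteq> imprecise_I \<Q>"
    and h: "\<And>x. 0 \<le> h $ x" "\<And>x. x \<in> A \<Longrightarrow> h $ x = 0" "\<And>x. x \<notin> A \<Longrightarrow> lower h $ x = - 1"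
  shows "lower_hitting_time A \<P> x = ennreal (h $ x)"
proof (rule antisym)
  obtain Q where Q: "Q \<in> \<Q>" "\<forall>x. (Q *v h) $ x = lower h $ x" by (rule bexE[OF lower_attained])
  obtain P where P: "P \<in> imprecise_HM \<Q>" "stochastic_process P" "consistent {Q} P"
    by (rule homogeneous_process[OF Q(1)])
  \<comment> \<open>With the singleton as rate set, the supersolution condition concerns the optimal
    matrix alone, where it holds with equality.\<close>
  interpret absorbed_process P "{Q}" A x
    using P rate absorbing Q(1) by unfold_locales simp_all
  have "lower_hitting_time A \<P> x \<le> expected_hitting_time A P x"
    unfolding lower_hitting_time_def using P(1) \<P>(1) by (intro INF_lower) blast
  also have "\<dots> \<le> ennreal (h $ x)"
    using Q(2) h by (intro expected_hitting_time_le) simp_all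
  finally show "lower_hitting_time A \<P> x \<le> ennreal (h $ x)" .
next
  show "ennreal (h $ x) \<le> lower_hitting_time A \<P> x"
    unfolding lower_hitting_time_def
  proof (rule INF_greatest)
    fix P assume "P \<in> \<P>"
    then have P: "stochastic_process P" "consistent \<Q> P" using \<P>(2) by (auto simp: imprecise_I_def)
    interpret absorbed_process P \<Q> A x
      using P rate absorbing by unfold_locales
    show "ennreal (h $ x) \<le> expected_hitting_time A P x"
    proof (intro expected_hitting_time_ge h)
      fix Q z assume "Q \<in> \<Q>" "z \<notin> A"
      then show "- 1 \<le> (Q *v h) $ z" using lower_le[of Q h z] h(3)[of z] by simp
    qed
  qed
qed

lemma upper_hitting_time_eq:
  assumes \<P>: "imprecise_HM \<Q> \<subseteq> \<P>" "\<P> \<subseteq> imprecise_I \<Q>"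
    and h: "\<And>x. 0 \<le> h $ x" "\<And>x. x \<in> A \<Longrightarrow> h $ x = 0" "\<And>x. x \<notin> A \<Longrightarrow> upper h $ x = - 1"
  shows "upper_hitting_time A \<P> x = ennreal (h $ x)"
proof (rule antisym)
  show "upper_hitting_time A \<P> x \<le> ennreal (h $ x)"
    unfolding upper_hitting_time_def
  proof (rule SUP_least)
    fix P assume "P \<in> \<P>"
    then have P: "stochastic_process P" "consistent \<Q> P" using \<P>(2) by (auto simp: imprecise_I_def)
    interpret absorbed_process P \<Q> A x
      using P rate absorbing by unfold_locales
    show "expected_hitting_time A P x \<le> ennreal (h $ x)"
    proof (intro expected_hitting_time_le h)
      fix Q z assume "Q \<in> \<Q>" "z \<notin> A"
      then show "(Q *v h) $ z \<le> - 1" using upper_ge[of Q h z] h(3)[of z] by simp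
    qed
  qed
next
  obtain Q where Q: "Q \<in> \<Q>" "\<forall>x. (Q *v h) $ x = upper h $ x" by (rule bexE[OF upper_attained])
  obtain P where P: "P \<in> imprecise_HM \<Q>" "stochastic_process P" "consistent {Q} P"
    by (rule homogeneous_process[OF Q(1)])
  interpret absorbed_process P "{Q}" A x
    using P rate absorbing Q(1) by unfold_locales simp_all
  have "ennreal (h $ x) \<le> expected_hitting_time A P x"
    using Q(2) h by (intro expected_hitting_time_ge) simp_all
  also have "\<dots> \<le> upper_hitting_time A \<P> x"
    unfolding upper_hitting_time_def using P(1) \<P>(1) by (intro SUP_upper) blast
  finally show "ennreal (h $ x) \<le> upper_hitting_time A \<P> x" .
qed

end

theorem theorem2:
  fixes \<Q> :: "(real ^ 'a ^ ('a::finite)) set"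
    and A :: "'a set"
    and \<P> :: "'a process set"
  assumes "A \<noteq> {}" and "A \<noteq> UNIV"
    and "\<Q> \<noteq> {}" and "compact \<Q>" and "convex \<Q>"
    and "\<forall>Q\<in>\<Q>. rate_matrix Q"
    and "separately_specified_rows \<Q>"
    and absorbing: "\<forall>Q\<in>\<Q>. \<forall>x\<in>A. Q $ x $ x = 0"
    and lower_reachable:
      "\<forall>t>0. \<forall>x\<in>-A. op_exp (lower_rate \<Q>) t (ind_vec A) $ x > 0"
    and "\<P> \<in> {imprecise_HM \<Q>, imprecise_M \<Q>, imprecise_I \<Q>}"
  shows
    "(\<exists>h. (\<forall>x. lower_hitting_time A \<P> x = ennreal (h $ x)) \<and>
       minimal_nonneg_solution
         (\<lambda>h. ind_vec A * h = ind_vec (-A) + ind_vec (-A) * lower_rate \<Q> h) h) \<and>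
     (\<exists>h. (\<forall>x. upper_hitting_time A \<P> x = ennreal (h $ x)) \<and>
       minimal_nonneg_solution
         (\<lambda>h. ind_vec A * h = ind_vec (-A) + ind_vec (-A) * upper_rate \<Q> h) h)"
proof -
  interpret hitting_rate_set \<Q> A
    using assms by unfold_locales
  have \<P>: "imprecise_HM \<Q> \<subseteq> \<P>" "\<P> \<subseteq> imprecise_I \<Q>"
    using assms(10) imprecise_HM_subset_M[of \<Q>] imprecise_M_subset_I[of \<Q>] by auto
  obtain h1 where h1: "minimal_nonneg_solution
      (\<lambda>h. ind_vec A * h = ind_vec (-A) + ind_vec (-A) * lower_rate \<Q> h) h1"
    using lower_solution_exists by blast
  then have "lower_hitting_time A \<P> x = ennreal (h1 $ x)" for x
    by (intro lower_hitting_time_eq[OF \<P>]) (simp_all add: minimal_nonneg_solution_def hitting_system_iff)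
  moreover obtain h2 where h2: "minimal_nonneg_solution
      (\<lambda>h. ind_vec A * h = ind_vec (-A) + ind_vec (-A) * upper_rate \<Q> h) h2"
    using upper_solution_exists by blast
  then have "upper_hitting_time A \<P> x = ennreal (h2 $ x)" for x
    by (intro upper_hitting_time_eq[OF \<P>]) (simp_all add: minimal_nonneg_solution_def hitting_system_iff)
  ultimately show ?thesis using h1 h2 by blast
qed

end
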